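(* Let $\sigma_{\mathcal{A}}=(\mathcal{A}_0,Z_{\mathcal{A}})$ and $\sigma_{\mathcal{B}}=(\mathcal{B}_0,Z_{\mathcal{B}})$ be stability conditions on the components $\mathcal{A}$ and $\mathcal{B}$ of a semiorthogonal decomposition $\mathcal{D}=\langle\mathcal{A},\mathcal{B}\rangle$ of a triangulated category such that 1. $\mathrm{Hom}_{\mathcal{D}}(A,B[i])=0$ for all $A\in\mathcal{A}_0$, $B\in\mathcal{B}_0$, $i\le0$; 2. $\phi^-_{\mathcal{B}}(B)\ge\phi^+_{\mathcal{A}}(A)$ for all nonzero $A\in\mathcal{A}_0$ and $B\in\mathcal{B}_0$. Then $\sigma_{\mathcal{A}}$ and $\sigma_{\mathcal{B}}$ glue to a stability condition $(\mathrm{gl}(\mathcal{A}_0,\mathcal{B}_0),Z_{\mathrm{gl}})$ on $\mathcal{D}$.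
   Context: Semiorthogonal decomposition $\mathcal{D}=\langle\mathcal{A},\mathcal{B}\rangle$: full triangulated subcategories with $\mathrm{Hom}_{\mathcal{D}}(\mathcal{B},\mathcal{A})=0$ and every $E\in\mathcal{D}$ in a triangle $B\to E\to A\to B[1]$, $A\in\mathcal{A}$, $B\in\mathcal{B}$; $i_{\mathcal{A}}^*$ is the left adjoint of $\mathcal{A}\hookrightarrow\mathcal{D}$ and $i_{\mathcal{B}}^!$ the right adjoint of $\mathcal{B}\hookrightarrow\mathcal{D}$. A stability condition is a locally finite Bridgeland stability condition $(Z,\mathcal{P})$ satisfying the support property (a factorization $Z\colon K_0\xrightarrow{u}\Lambda\to\mathbb{C}$ through a finite-rank free abelian group, a norm on $\Lambda\otimes\mathbb{R}$ and $C>0$ with $\|u([E])\|\le C|Z(E)|$ for all semistable $E$), written as (heart $\mathcal{P}(0,1]$, central charge). $\phi^{\pm}$ are the maximal/minimal phases of Harder–Narasimhan factors. Under hypothesis 1, the extension closure $\mathrm{gl}(\mathcal{A}_0,\mathcal{B}_0)$ of $\mathcal{A}_0$ and $\mathcal{B}_0$ is the heart of a bounded $t$-structure on $\mathcal{D}$; $Z_{\mathrm{gl}}(E)=Z_{\mathcal{A}}(i_{\mathcal{A}}^*E)+Z_{\mathcal{B}}(i_{\mathcal{B}}^!E)$. "Glue to a stability condition" means $(\mathrm{gl}(\mathcal{A}_0,\mathcal{B}_0),Z_{\mathrm{gl}})$ is a stability condition on $\mathcal{D}$. *)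

theory Defs
  imports Complex_Main "HOL-Algebra.Free_Abelian_Groups"
begin

section \<open>Triangulated categories\<close>

text \<open>
  The hom-sets are abelian groups in the sense of HOL-Algebra, written multiplicatively there:
  \<open>\<one>\<close> of \<open>Hom T X Y\<close> is the zero morphism, \<open>\<otimes>\<close> is the sum and \<open>inv\<close> the negative.
  \<open>Comp T g f\<close> is the composite of \<open>f\<close> followed by \<open>g\<close>.  \<open>Shift\<close> and \<open>ShiftM\<close> are the action of
  \<open>[1]\<close> on objects and on morphisms, and \<open>Tri T X Y Z f g h\<close> says that
  \<open>X \<rightarrow> Y \<rightarrow> Z \<rightarrow> X[1]\<close> (with maps \<open>f, g, h\<close>) is a distinguished triangle.
\<close>

record ('o, 'm) tricat =
  Ob :: "'o set"
  Hom :: "'o \<Rightarrow> 'o \<Rightarrow> 'm monoid"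
  Comp :: "'m \<Rightarrow> 'm \<Rightarrow> 'm"
  Idm :: "'o \<Rightarrow> 'm"
  Shift :: "'o \<Rightarrow> 'o"
  ShiftM :: "'m \<Rightarrow> 'm"
  Tri :: "'o \<Rightarrow> 'o \<Rightarrow> 'o \<Rightarrow> 'm \<Rightarrow> 'm \<Rightarrow> 'm \<Rightarrow> bool"

definition homs :: "('o, 'm) tricat \<Rightarrow> 'o \<Rightarrow> 'o \<Rightarrow> 'm set" where
  "homs T X Y = carrier (Hom T X Y)"

definition zero_mor :: "('o, 'm) tricat \<Rightarrow> 'o \<Rightarrow> 'o \<Rightarrow> 'm" where
  "zero_mor T X Y = \<one>\<^bsub>Hom T X Y\<^esub>"

definition is_zero_ob :: "('o, 'm) tricat \<Rightarrow> 'o \<Rightarrow> bool" where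
  "is_zero_ob T N \<longleftrightarrow> N \<in> Ob T \<and>
     (\<forall>X\<in>Ob T. (\<exists>!f. f \<in> homs T N X) \<and> (\<exists>!f. f \<in> homs T X N))"

definition is_iso_mor :: "('o, 'm) tricat \<Rightarrow> 'o \<Rightarrow> 'o \<Rightarrow> 'm \<Rightarrow> bool" where
  "is_iso_mor T X Y f \<longleftrightarrow> f \<in> homs T X Y \<and>
     (\<exists>g\<in>homs T Y X. Comp T g f = Idm T X \<and> Comp T f g = Idm T Y)"

definition iso_obs :: "('o, 'm) tricat \<Rightarrow> 'o \<Rightarrow> 'o \<Rightarrow> bool" where
  "iso_obs T X Y \<longleftrightarrow> X \<in> Ob T \<and> Y \<in> Ob T \<and> (\<exists>f. is_iso_mor T X Y f)"

definition is_biproduct :: "('o, 'm) tricat \<Rightarrow> 'o \<Rightarrow> 'o \<Rightarrow> 'o \<Rightarrow> bool" where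
  "is_biproduct T X Y W \<longleftrightarrow> X \<in> Ob T \<and> Y \<in> Ob T \<and> W \<in> Ob T \<and>
     (\<exists>i1\<in>homs T X W. \<exists>i2\<in>homs T Y W. \<exists>p1\<in>homs T W X. \<exists>p2\<in>homs T W Y.
        Comp T p1 i1 = Idm T X \<and> Comp T p2 i2 = Idm T Y \<and>
        Comp T p1 i2 = zero_mor T Y X \<and> Comp T p2 i1 = zero_mor T X Y \<and>
        Comp T i1 p1 \<otimes>\<^bsub>Hom T W W\<^esub> Comp T i2 p2 = Idm T W)"

text \<open>Distinct ordered pairs of objects have disjoint hom-sets, so a morphism determines its
  domain and codomain.\<close>

locale preadditive_category =
  fixes T :: "('o, 'm) tricat"
  assumes homs_disjoint:
      "\<lbrakk>X \<in> Ob T; Y \<in> Ob T; X' \<in> Ob T; Y' \<in> Ob T; f \<in> homs T X Y; f \<in> homs T X' Y'\<rbrakk>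
        \<Longrightarrow> X = X' \<and> Y = Y'"
    and Idm_in: "X \<in> Ob T \<Longrightarrow> Idm T X \<in> homs T X X"
    and Comp_in:
      "\<lbrakk>X \<in> Ob T; Y \<in> Ob T; Z \<in> Ob T; f \<in> homs T X Y; g \<in> homs T Y Z\<rbrakk>
        \<Longrightarrow> Comp T g f \<in> homs T X Z"
    and Comp_Idm_right: "\<lbrakk>X \<in> Ob T; Y \<in> Ob T; f \<in> homs T X Y\<rbrakk> \<Longrightarrow> Comp T f (Idm T X) = f"
    and Comp_Idm_left: "\<lbrakk>X \<in> Ob T; Y \<in> Ob T; f \<in> homs T X Y\<rbrakk> \<Longrightarrow> Comp T (Idm T Y) f = f"
    and Comp_assoc:
      "\<lbrakk>W \<in> Ob T; X \<in> Ob T; Y \<in> Ob T; Z \<in> Ob T;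
        f \<in> homs T W X; g \<in> homs T X Y; h \<in> homs T Y Z\<rbrakk>
        \<Longrightarrow> Comp T h (Comp T g f) = Comp T (Comp T h g) f"
    and Hom_comm_group: "\<lbrakk>X \<in> Ob T; Y \<in> Ob T\<rbrakk> \<Longrightarrow> comm_group (Hom T X Y)"
    and Comp_additive_right:
      "\<lbrakk>X \<in> Ob T; Y \<in> Ob T; Z \<in> Ob T; g \<in> homs T Y Z\<rbrakk>
        \<Longrightarrow> (\<lambda>f. Comp T g f) \<in> hom (Hom T X Y) (Hom T X Z)"
    and Comp_additive_left:
      "\<lbrakk>X \<in> Ob T; Y \<in> Ob T; Z \<in> Ob T; f \<in> homs T X Y\<rbrakk>
        \<Longrightarrow> (\<lambda>g. Comp T g f) \<in> hom (Hom T Y Z) (Hom T X Z)"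

locale additive_category = preadditive_category +
  assumes zero_ob_exists: "\<exists>N. is_zero_ob T N"
    and biproduct_exists: "\<lbrakk>X \<in> Ob T; Y \<in> Ob T\<rbrakk> \<Longrightarrow> \<exists>W. is_biproduct T X Y W"

locale triangulated_category = additive_category +
  assumes Shift_bij: "bij_betw (Shift T) (Ob T) (Ob T)"
    and ShiftM_bij:
      "\<lbrakk>X \<in> Ob T; Y \<in> Ob T\<rbrakk>
        \<Longrightarrow> bij_betw (ShiftM T) (homs T X Y) (homs T (Shift T X) (Shift T Y))"
    and ShiftM_additive:
      "\<lbrakk>X \<in> Ob T; Y \<in> Ob T\<rbrakk>
        \<Longrightarrow> ShiftM T \<in> hom (Hom T X Y) (Hom T (Shift T X) (Shift T Y))"
    and ShiftM_Idm: "X \<in> Ob T \<Longrightarrow> ShiftM T (Idm T X) = Idm T (Shift T X)"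
    and ShiftM_Comp:
      "\<lbrakk>X \<in> Ob T; Y \<in> Ob T; Z \<in> Ob T; f \<in> homs T X Y; g \<in> homs T Y Z\<rbrakk>
        \<Longrightarrow> ShiftM T (Comp T g f) = Comp T (ShiftM T g) (ShiftM T f)"
    and Tri_types:
      "Tri T X Y Z f g h \<Longrightarrow> X \<in> Ob T \<and> Y \<in> Ob T \<and> Z \<in> Ob T \<and>
         f \<in> homs T X Y \<and> g \<in> homs T Y Z \<and> h \<in> homs T Z (Shift T X)"
    and Tri_iso:
      "\<lbrakk>Tri T X Y Z f g h; X' \<in> Ob T; Y' \<in> Ob T; Z' \<in> Ob T;
        f' \<in> homs T X' Y'; g' \<in> homs T Y' Z'; h' \<in> homs T Z' (Shift T X');
        is_iso_mor T X X' a; is_iso_mor T Y Y' b; is_iso_mor T Z Z' c;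
        Comp T b f = Comp T f' a; Comp T c g = Comp T g' b;
        Comp T (ShiftM T a) h = Comp T h' c\<rbrakk>
        \<Longrightarrow> Tri T X' Y' Z' f' g' h'"
    and Tri_Idm:
      "\<lbrakk>X \<in> Ob T; is_zero_ob T N\<rbrakk>
        \<Longrightarrow> Tri T X X N (Idm T X) (zero_mor T X N) (zero_mor T N (Shift T X))"
    and Tri_cone:
      "\<lbrakk>X \<in> Ob T; Y \<in> Ob T; f \<in> homs T X Y\<rbrakk> \<Longrightarrow> \<exists>Z g h. Tri T X Y Z f g h"
    and Tri_rotate:
      "\<lbrakk>X \<in> Ob T; Y \<in> Ob T; Z \<in> Ob T;
        f \<in> homs T X Y; g \<in> homs T Y Z; h \<in> homs T Z (Shift T X)\<rbrakk>
        \<Longrightarrow> Tri T X Y Z f g h \<longleftrightarrow>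
            Tri T Y Z (Shift T X) g h (inv\<^bsub>Hom T (Shift T X) (Shift T Y)\<^esub> (ShiftM T f))"
    and Tri_morphism:
      "\<lbrakk>Tri T X Y Z f g h; Tri T X' Y' Z' f' g' h'; a \<in> homs T X X'; b \<in> homs T Y Y';
        Comp T b f = Comp T f' a\<rbrakk>
        \<Longrightarrow> \<exists>c\<in>homs T Z Z'. Comp T c g = Comp T g' b \<and>
              Comp T (ShiftM T a) h = Comp T h' c"
    and Tri_octahedral:
      "\<lbrakk>Tri T X Y U f p q; Tri T Y Z V g r s; Tri T X Z W (Comp T g f) v w\<rbrakk>
        \<Longrightarrow> \<exists>a b. Tri T U W V a b (Comp T (ShiftM T p) s) \<and>
              Comp T a p = Comp T v g \<and> Comp T w a = q \<and>
              Comp T b v = r \<and> Comp T s b = Comp T (ShiftM T f) w"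

definition shift_int :: "('o, 'm) tricat \<Rightarrow> int \<Rightarrow> 'o \<Rightarrow> 'o" where
  "shift_int T i X =
     (if i \<ge> 0 then (Shift T ^^ nat i) X else (inv_into (Ob T) (Shift T) ^^ nat (- i)) X)"

section \<open>Full subcategories\<close>

text \<open>The full subcategory on the objects in \<open>S\<close>, with the triangles of \<open>T\<close> all of whose vertices
  lie in \<open>S\<close>.  It is again triangulated if \<open>S\<close> is a full triangulated subcategory.\<close>

definition full_subcat :: "('o, 'm) tricat \<Rightarrow> 'o set \<Rightarrow> ('o, 'm) tricat" where
  "full_subcat T S = T\<lparr>Ob := Ob T \<inter> S,
     Tri := (\<lambda>X Y Z f g h. X \<in> S \<and> Y \<in> S \<and> Z \<in> S \<and> Tri T X Y Z f g h)\<rparr>"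

definition replete :: "('o, 'm) tricat \<Rightarrow> 'o set \<Rightarrow> bool" where
  "replete T S \<longleftrightarrow> (\<forall>X Y. X \<in> S \<and> iso_obs T X Y \<longrightarrow> Y \<in> S)"

definition additive_subcat :: "('o, 'm) tricat \<Rightarrow> 'o set \<Rightarrow> bool" where
  "additive_subcat T S \<longleftrightarrow> S \<subseteq> Ob T \<and> replete T S \<and> (\<exists>N\<in>S. is_zero_ob T N) \<and>
     (\<forall>X\<in>S. \<forall>Y\<in>S. \<forall>W. is_biproduct T X Y W \<longrightarrow> W \<in> S)"

definition triangulated_subcat :: "('o, 'm) tricat \<Rightarrow> 'o set \<Rightarrow> bool" where
  "triangulated_subcat T S \<longleftrightarrow> additive_subcat T S \<and>
     (\<forall>X\<in>Ob T. Shift T X \<in> S \<longleftrightarrow> X \<in> S) \<and>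
     (\<forall>X Y Z f g h. X \<in> S \<and> Y \<in> S \<and> Tri T X Y Z f g h \<longrightarrow> Z \<in> S)"

inductive_set ext_closure :: "('o, 'm) tricat \<Rightarrow> 'o set \<Rightarrow> 'o set"
  for T :: "('o, 'm) tricat" and G :: "'o set" where
  base: "X \<in> G \<Longrightarrow> X \<in> ext_closure T G"
| ext: "\<lbrakk>X \<in> ext_closure T G; Y \<in> ext_closure T G; Tri T X E Y f g h\<rbrakk>
          \<Longrightarrow> E \<in> ext_closure T G"

definition semiorthogonal_decomposition ::
    "('o, 'm) tricat \<Rightarrow> 'o set \<Rightarrow> 'o set \<Rightarrow> bool" where
  "semiorthogonal_decomposition T \<A> \<B> \<longleftrightarrow>
     triangulated_subcat T \<A> \<and> triangulated_subcat T \<B> \<and>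
     (\<forall>B\<in>\<B>. \<forall>A\<in>\<A>. homs T B A = {zero_mor T B A}) \<and>
     (\<forall>E\<in>Ob T. \<exists>B\<in>\<B>. \<exists>A\<in>\<A>. \<exists>f g h. Tri T B E A f g h)"

section \<open>Functors and adjoints\<close>

type_synonym ('o, 'm) cat_functor = "('o \<Rightarrow> 'o) \<times> ('m \<Rightarrow> 'm)"

definition is_functor :: "('o, 'm) tricat \<Rightarrow> ('o, 'm) tricat \<Rightarrow> ('o, 'm) cat_functor \<Rightarrow> bool" where
  "is_functor C D F \<longleftrightarrow>
     (\<forall>X\<in>Ob C. fst F X \<in> Ob D \<and> snd F (Idm C X) = Idm D (fst F X)) \<and>
     (\<forall>X\<in>Ob C. \<forall>Y\<in>Ob C. \<forall>f\<in>homs C X Y. snd F f \<in> homs D (fst F X) (fst F Y)) \<and>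
     (\<forall>X\<in>Ob C. \<forall>Y\<in>Ob C. \<forall>Z\<in>Ob C. \<forall>f\<in>homs C X Y. \<forall>g\<in>homs C Y Z.
        snd F (Comp C g f) = Comp D (snd F g) (snd F f))"

text \<open>\<open>L : C \<rightarrow> D\<close> is left adjoint to \<open>R : D \<rightarrow> C\<close>: bijections
  \<open>Hom\<^sub>D(L X, Y) \<cong> Hom\<^sub>C(X, R Y)\<close>, natural in \<open>X\<close> and \<open>Y\<close>.\<close>

definition adjoint_functors ::
    "('o, 'm) tricat \<Rightarrow> ('o, 'm) tricat \<Rightarrow> ('o, 'm) cat_functor \<Rightarrow> ('o, 'm) cat_functor \<Rightarrow> bool" where
  "adjoint_functors C D L R \<longleftrightarrow> is_functor C D L \<and> is_functor D C R \<and>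
     (\<exists>\<Phi>. (\<forall>X\<in>Ob C. \<forall>Y\<in>Ob D. bij_betw (\<Phi> X Y) (homs D (fst L X) Y) (homs C X (fst R Y))) \<and>
        (\<forall>X\<in>Ob C. \<forall>X'\<in>Ob C. \<forall>Y\<in>Ob D. \<forall>Y'\<in>Ob D.
           \<forall>f\<in>homs C X' X. \<forall>k\<in>homs D Y Y'. \<forall>u\<in>homs D (fst L X) Y.
             \<Phi> X' Y' (Comp D k (Comp D u (snd L f)))
               = Comp C (snd R k) (Comp C (\<Phi> X Y u) f)))"

text \<open>The adjoints of an inclusion, which are unique up to isomorphism when they exist;
  \<open>(id, id)\<close> is the inclusion functor.\<close>

definition left_adj_incl :: "('o, 'm) tricat \<Rightarrow> 'o set \<Rightarrow> ('o, 'm) cat_functor" where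
  "left_adj_incl T S = (SOME L. adjoint_functors T (full_subcat T S) L (id, id))"

definition right_adj_incl :: "('o, 'm) tricat \<Rightarrow> 'o set \<Rightarrow> ('o, 'm) cat_functor" where
  "right_adj_incl T S = (SOME R. adjoint_functors (full_subcat T S) T (id, id) R)"

section \<open>The Grothendieck group\<close>

definition K0_relations :: "('o, 'm) tricat \<Rightarrow> ('o \<Rightarrow>\<^sub>0 int) set" where
  "K0_relations T = {frag_of Y - frag_of X - frag_of Z | X Y Z. \<exists>f g h. Tri T X Y Z f g h}"

definition K0 :: "('o, 'm) tricat \<Rightarrow> ('o \<Rightarrow>\<^sub>0 int) set monoid" where
  "K0 T = free_Abelian_group (Ob T) Mod generate (free_Abelian_group (Ob T)) (K0_relations T)"

definition K0_class :: "('o, 'm) tricat \<Rightarrow> 'o \<Rightarrow> ('o \<Rightarrow>\<^sub>0 int) set" where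
  "K0_class T E =
     generate (free_Abelian_group (Ob T)) (K0_relations T) #>\<^bsub>free_Abelian_group (Ob T)\<^esub> frag_of E"

definition complex_group :: "complex monoid" where
  "complex_group = \<lparr>carrier = UNIV, monoid.mult = (+), one = 0\<rparr>"

section \<open>Slicings\<close>

text \<open>A Harder--Narasimhan filtration \<open>0 = F 0 \<rightarrow> F 1 \<rightarrow> \<dots> \<rightarrow> F n = E\<close> with nonzero factors
  \<open>Q j\<close>, the cones of \<open>F j \<rightarrow> F (j + 1)\<close>, of phases \<open>\<phi> 0 > \<dots> > \<phi> (n - 1)\<close>.\<close>

definition HN_filtration ::
    "('o, 'm) tricat \<Rightarrow> (real \<Rightarrow> 'o set) \<Rightarrow> 'o \<Rightarrow> nat \<Rightarrow> (nat \<Rightarrow> 'o) \<Rightarrow> (nat \<Rightarrow> 'o)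
      \<Rightarrow> (nat \<Rightarrow> real) \<Rightarrow> bool" where
  "HN_filtration T P E n F Q \<phi> \<longleftrightarrow>
     is_zero_ob T (F 0) \<and> F n = E \<and>
     (\<forall>j. Suc j < n \<longrightarrow> \<phi> (Suc j) < \<phi> j) \<and>
     (\<forall>j<n. Q j \<in> P (\<phi> j) \<and> \<not> is_zero_ob T (Q j) \<and>
        (\<exists>f g h. Tri T (F j) (F (Suc j)) (Q j) f g h))"

definition slicing :: "('o, 'm) tricat \<Rightarrow> (real \<Rightarrow> 'o set) \<Rightarrow> bool" where
  "slicing T P \<longleftrightarrow>
     (\<forall>\<phi>. additive_subcat T (P \<phi>)) \<and>
     (\<forall>\<phi>. P (\<phi> + 1) = Shift T ` P \<phi>) \<and>
     (\<forall>\<phi>1 \<phi>2. \<phi>1 > \<phi>2 \<longrightarrow> (\<forall>X\<in>P \<phi>1. \<forall>Y\<in>P \<phi>2. homs T X Y = {zero_mor T X Y})) \<and>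
     (\<forall>E\<in>Ob T. \<not> is_zero_ob T E \<longrightarrow> (\<exists>n F Q \<phi>. HN_filtration T P E n F Q \<phi>))"

text \<open>The Harder--Narasimhan filtration of a nonzero object is unique up to isomorphism, so its
  largest and smallest phases are well defined.\<close>

definition phi_plus :: "('o, 'm) tricat \<Rightarrow> (real \<Rightarrow> 'o set) \<Rightarrow> 'o \<Rightarrow> real" where
  "phi_plus T P E = (THE r. \<exists>n F Q \<phi>. HN_filtration T P E n F Q \<phi> \<and> r = \<phi> 0)"

definition phi_minus :: "('o, 'm) tricat \<Rightarrow> (real \<Rightarrow> 'o set) \<Rightarrow> 'o \<Rightarrow> real" where
  "phi_minus T P E = (THE r. \<exists>n F Q \<phi>. HN_filtration T P E n F Q \<phi> \<and> r = \<phi> (n - 1))"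

definition P_interval :: "('o, 'm) tricat \<Rightarrow> (real \<Rightarrow> 'o set) \<Rightarrow> real set \<Rightarrow> 'o set" where
  "P_interval T P I = ext_closure T (\<Union>\<phi>\<in>I. P \<phi>)"

definition heart :: "('o, 'm) tricat \<Rightarrow> (real \<Rightarrow> 'o set) \<Rightarrow> 'o set" where
  "heart T P = P_interval T P {0<..1}"

section \<open>Local finiteness\<close>

definition is_kernel :: "('o, 'm) tricat \<Rightarrow> 'o \<Rightarrow> 'o \<Rightarrow> 'o \<Rightarrow> 'm \<Rightarrow> 'm \<Rightarrow> bool" where
  "is_kernel C X Y Z i p \<longleftrightarrow>
     i \<in> homs C X Y \<and> p \<in> homs C Y Z \<and> Comp C p i = zero_mor C X Z \<and>
     (\<forall>W\<in>Ob C. \<forall>w\<in>homs C W Y. Comp C p w = zero_mor C W Z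
        \<longrightarrow> (\<exists>!v. v \<in> homs C W X \<and> Comp C i v = w))"

definition is_cokernel :: "('o, 'm) tricat \<Rightarrow> 'o \<Rightarrow> 'o \<Rightarrow> 'o \<Rightarrow> 'm \<Rightarrow> 'm \<Rightarrow> bool" where
  "is_cokernel C X Y Z i p \<longleftrightarrow>
     i \<in> homs C X Y \<and> p \<in> homs C Y Z \<and> Comp C p i = zero_mor C X Z \<and>
     (\<forall>W\<in>Ob C. \<forall>w\<in>homs C Y W. Comp C w i = zero_mor C X W
        \<longrightarrow> (\<exists>!v. v \<in> homs C Z W \<and> Comp C v p = w))"

text \<open>The strict monomorphisms of a quasi-abelian category are the maps \<open>i\<close> in strict short exact
  sequences \<open>0 \<rightarrow> X \<rightarrow> Y \<rightarrow> Z \<rightarrow> 0\<close>.\<close>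

definition strict_mono_mor :: "('o, 'm) tricat \<Rightarrow> 'o \<Rightarrow> 'o \<Rightarrow> 'm \<Rightarrow> bool" where
  "strict_mono_mor C X Y i \<longleftrightarrow> X \<in> Ob C \<and> Y \<in> Ob C \<and>
     (\<exists>Z\<in>Ob C. \<exists>p. is_kernel C X Y Z i p \<and> is_cokernel C X Y Z i p)"

definition subobject_le ::
    "('o, 'm) tricat \<Rightarrow> 'o \<Rightarrow> 'm \<Rightarrow> 'o \<Rightarrow> 'm \<Rightarrow> bool" where
  "subobject_le C X i Y k \<longleftrightarrow> (\<exists>v\<in>homs C X Y. Comp C k v = i)"

definition finite_length_cat :: "('o, 'm) tricat \<Rightarrow> bool" where
  "finite_length_cat C \<longleftrightarrow>
     (\<forall>E\<in>Ob C. \<forall>X i. (\<forall>n::nat. strict_mono_mor C (X n) E (i n)) \<longrightarrow>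
        ((\<forall>n. subobject_le C (X n) (i n) (X (Suc n)) (i (Suc n))) \<longrightarrow>
           (\<exists>N. \<forall>n\<ge>N. subobject_le C (X (Suc n)) (i (Suc n)) (X n) (i n))) \<and>
        ((\<forall>n. subobject_le C (X (Suc n)) (i (Suc n)) (X n) (i n)) \<longrightarrow>
           (\<exists>N. \<forall>n\<ge>N. subobject_le C (X n) (i n) (X (Suc n)) (i (Suc n)))))"

text \<open>The bound \<open>1/2\<close> keeps the intervals of length less than 1, so that the categories
  \<open>P(t - \<epsilon>, t + \<epsilon>)\<close> are quasi-abelian.\<close>

definition locally_finite :: "('o, 'm) tricat \<Rightarrow> (real \<Rightarrow> 'o set) \<Rightarrow> bool" where
  "locally_finite T P \<longleftrightarrow> (\<exists>\<epsilon>. 0 < \<epsilon> \<and> \<epsilon> < 1/2 \<and>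
     (\<forall>t. finite_length_cat (full_subcat T (P_interval T P {t - \<epsilon><..<t + \<epsilon>}))))"

section \<open>Stability conditions\<close>

text \<open>A finite-rank free abelian group is taken in the form \<open>\<int>\<^sup>n\<close>, i.e.
  \<open>free_Abelian_group {..<n}\<close>; then \<open>\<Lambda> \<otimes> \<real>\<close> is \<open>\<real>\<^sup>n\<close>, the sequences vanishing from index \<open>n\<close> on.\<close>

definition norm_on :: "nat \<Rightarrow> ((nat \<Rightarrow> real) \<Rightarrow> real) \<Rightarrow> bool" where
  "norm_on n N \<longleftrightarrow> (let V = {x. \<forall>i\<ge>n. x i = 0} in
     (\<forall>x\<in>V. N x \<ge> 0 \<and> (N x = 0 \<longrightarrow> x = (\<lambda>_. 0))) \<and>
     (\<forall>x\<in>V. \<forall>c. N (\<lambda>i. c * x i) = \<bar>c\<bar> * N x) \<and>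
     (\<forall>x\<in>V. \<forall>y\<in>V. N (\<lambda>i. x i + y i) \<le> N x + N y))"

definition semistable :: "('o, 'm) tricat \<Rightarrow> (real \<Rightarrow> 'o set) \<Rightarrow> 'o \<Rightarrow> bool" where
  "semistable T P E \<longleftrightarrow> \<not> is_zero_ob T E \<and> (\<exists>\<phi>. E \<in> P \<phi>)"

definition support_property ::
    "('o, 'm) tricat \<Rightarrow> (real \<Rightarrow> 'o set) \<Rightarrow> (('o \<Rightarrow>\<^sub>0 int) set \<Rightarrow> complex) \<Rightarrow> bool" where
  "support_property T P Z \<longleftrightarrow>
     (\<exists>n. \<exists>u\<in>hom (K0 T) (free_Abelian_group {..<n}).
      \<exists>Z'\<in>hom (free_Abelian_group {..<n}) complex_group.
        (\<forall>x\<in>carrier (K0 T). Z x = Z' (u x)) \<and>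
        (\<exists>N C. norm_on n N \<and> C > 0 \<and>
          (\<forall>E. semistable T P E \<longrightarrow>
             N (\<lambda>i. real_of_int (Poly_Mapping.lookup (u (K0_class T E)) i))
               \<le> C * cmod (Z (K0_class T E)))))"

definition stability_condition ::
    "('o, 'm) tricat \<Rightarrow> (real \<Rightarrow> 'o set) \<Rightarrow> (('o \<Rightarrow>\<^sub>0 int) set \<Rightarrow> complex) \<Rightarrow> bool" where
  "stability_condition T P Z \<longleftrightarrow>
     slicing T P \<and> Z \<in> hom (K0 T) complex_group \<and>
     (\<forall>\<phi>. \<forall>E\<in>P \<phi>. \<not> is_zero_ob T E \<longrightarrow>
        (\<exists>m>0. Z (K0_class T E) = complex_of_real m * exp (\<i> * complex_of_real (pi * \<phi>)))) \<and>
     locally_finite T P \<and> support_property T P Z"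

text \<open>A stability condition written as a pair (heart, central charge).\<close>

definition stability_pair ::
    "('o, 'm) tricat \<Rightarrow> 'o set \<Rightarrow> (('o \<Rightarrow>\<^sub>0 int) set \<Rightarrow> complex) \<Rightarrow> bool" where
  "stability_pair T H Z \<longleftrightarrow> (\<exists>P. stability_condition T P Z \<and> heart T P = H)"

section \<open>Gluing\<close>

definition gl :: "('o, 'm) tricat \<Rightarrow> 'o set \<Rightarrow> 'o set \<Rightarrow> 'o set" where
  "gl T A0 B0 = ext_closure T (A0 \<union> B0)"

text \<open>\<open>Z\<close> is the homomorphism \<open>Z\<^sub>g\<^sub>l\<close>: it is determined on \<open>K0 T\<close> by its values on classes of
  objects.\<close>

definition is_glued_charge ::
    "('o, 'm) tricat \<Rightarrow> 'o set \<Rightarrow> 'o set \<Rightarrow> (('o \<Rightarrow>\<^sub>0 int) set \<Rightarrow> complex)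
      \<Rightarrow> (('o \<Rightarrow>\<^sub>0 int) set \<Rightarrow> complex) \<Rightarrow> (('o \<Rightarrow>\<^sub>0 int) set \<Rightarrow> complex) \<Rightarrow> bool" where
  "is_glued_charge T \<A> \<B> ZA ZB Z \<longleftrightarrow> Z \<in> hom (K0 T) complex_group \<and>
     (\<forall>E\<in>Ob T. Z (K0_class T E) =
        ZA (K0_class (full_subcat T \<A>) (fst (left_adj_incl T \<A>) E)) +
        ZB (K0_class (full_subcat T \<B>) (fst (right_adj_incl T \<B>) E)))"

end

theory Submission
  imports Defs
begin

text \<open>
  Put \<open>P(\<phi>) = P\<^sub>B(\<phi>) * P\<^sub>A(\<phi>)\<close>, the class of extensions \<open>B \<rightarrow> E \<rightarrow> A\<close> with \<open>B \<in> P\<^sub>B(\<phi>)\<close> and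
  \<open>A \<in> P\<^sub>A(\<phi>)\<close>.  Both hypotheses together give \<open>Hom(A, B) = Hom(A, B[1]) = 0\<close> for \<open>A \<in> P\<^sub>A(\<phi>)\<close>,
  \<open>B \<in> P\<^sub>B(\<psi>)\<close> and \<open>\<psi> < \<phi>\<close>.  Hence an \<open>\<A>\<close>-factor can be moved past every \<open>\<B>\<close>-factor of smaller
  phase, and sorting the factors of the two components of an object produces its
  Harder--Narasimhan filtration with respect to \<open>P\<close>.

  The same exchange argument, now with \<open>Hom(\<B>, \<A>) = 0\<close>, shows that the components of an object are
  additive on triangles, so that \<open>K\<^sub>0\<close> maps to the Grothendieck groups of \<open>\<A>\<close> and \<open>\<B>\<close>.  The
  support property follows with \<open>\<Lambda> = \<Lambda>\<^sub>A \<oplus> \<Lambda>\<^sub>B\<close>, because the charges of the two components of a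
  semistable object lie on the same ray.  Local finiteness is not inherited but deduced from the
  support property: along a chain of strict subobjects of \<open>E\<close> in a thin slice
  \<open>P(t - \<epsilon>, t + \<epsilon>)\<close> the real part of \<open>exp(-i\<pi>t) Z\<close> is monotone, bounded by its value at \<open>E\<close>, and
  takes finitely many values since only finitely many lattice points are within reach.
\<close>

section \<open>Triangulated categories\<close>

text \<open>The two hypotheses enter only through the vanishing of Hom(X, Y) and Hom(X, Y[1]) for X
  in a slice of \<A> whose phase exceeds that of the slice of \<B> containing Y. The second
  vanishing is what permits the exchange: the connecting morphism of an extension with sub Y and
  quotient X is then zero, so its terms can change places. Slices are treated for all real phases at
  once, so no t-structure has to be constructed; the heart is identified with \<open>gl\<close>
  afterwards. Phases given by \<open>THE\<close> are evaluated only on objects of a single slice,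
  where uniqueness is elementary. The charge is stated through adjoints picked by
  \<open>SOME\<close>: existence of adjoints shows that the pick is genuine, and uniqueness of
  universal arrows lets any decomposition triangle compute it. For local finiteness the half-width
  1/3 serves two ends: within an angle pi/3 the cosine is at least 1/2, so the real part controls
  the modulus, and the total length 2/3 is below 1, so strict short exact sequences are
  triangles.\<close>

definition orth :: "('o, 'm) tricat \<Rightarrow> 'o \<Rightarrow> 'o \<Rightarrow> bool" where
  "orth T X Y \<longleftrightarrow> (\<forall>f\<in>homs T X Y. f = zero_mor T X Y)"

text \<open>Most of the argument needs only that a triangle on three given objects exists;
  forgetting its maps turns the octahedral axiom into a calculus of objects.\<close>

definition tri :: "('o, 'm) tricat \<Rightarrow> 'o \<Rightarrow> 'o \<Rightarrow> 'o \<Rightarrow> bool" where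
  "tri T X Y Z \<longleftrightarrow> (\<exists>f g h. Tri T X Y Z f g h)"

lemma triI: "Tri T X Y Z f g h \<Longrightarrow> tri T X Y Z"
  by (auto simp: tri_def)

section \<open>Additive calculus of hom-groups, zero objects and isomorphisms\<close>

context preadditive_category
begin

abbreviation comp_infix (infixr "\<star>" 75) where "g \<star> f \<equiv> Comp T g f"

lemma Hom_group: "X \<in> Ob T \<Longrightarrow> Y \<in> Ob T \<Longrightarrow> group (Hom T X Y)"
  using Hom_comm_group comm_group.axioms(2) by blast

lemma zero_mor_in: "X \<in> Ob T \<Longrightarrow> Y \<in> Ob T \<Longrightarrow> zero_mor T X Y \<in> homs T X Y"
  unfolding zero_mor_def homs_def by (rule monoid.one_closed[OF group.is_monoid[OF Hom_group]])

lemma neg_in: "X \<in> Ob T \<Longrightarrow> Y \<in> Ob T \<Longrightarrow> f \<in> homs T X Y \<Longrightarrow> inv\<^bsub>Hom T X Y\<^esub> f \<in> homs T X Y"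
  unfolding homs_def by (rule group.inv_closed[OF Hom_group])

lemma comp_right_group_hom:
  assumes "X \<in> Ob T" "Y \<in> Ob T" "Z \<in> Ob T" "g \<in> homs T Y Z"
  shows "group_hom (Hom T X Y) (Hom T X Z) (\<lambda>f. g \<star> f)"
  by (simp add: Comp_additive_right Hom_group assms group_hom.intro group_hom_axioms.intro)

lemma comp_left_group_hom:
  assumes "X \<in> Ob T" "Y \<in> Ob T" "Z \<in> Ob T" "f \<in> homs T X Y"
  shows "group_hom (Hom T Y Z) (Hom T X Z) (\<lambda>g. g \<star> f)"
  by (simp add: Comp_additive_left Hom_group assms group_hom.intro group_hom_axioms.intro)

lemma comp_zero_right:
  assumes "X \<in> Ob T" "Y \<in> Ob T" "Z \<in> Ob T" "g \<in> homs T Y Z"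
  shows "g \<star> zero_mor T X Y = zero_mor T X Z"
  using group_hom.hom_one[OF comp_right_group_hom[OF assms]] by (simp add: zero_mor_def)

lemma comp_zero_left:
  assumes "X \<in> Ob T" "Y \<in> Ob T" "Z \<in> Ob T" "f \<in> homs T X Y"
  shows "zero_mor T Y Z \<star> f = zero_mor T X Z"
  using group_hom.hom_one[OF comp_left_group_hom[OF assms]] by (simp add: zero_mor_def)

lemma comp_neg_right:
  assumes "X \<in> Ob T" "Y \<in> Ob T" "Z \<in> Ob T" "g \<in> homs T Y Z" "f \<in> homs T X Y"
  shows "g \<star> (inv\<^bsub>Hom T X Y\<^esub> f) = inv\<^bsub>Hom T X Z\<^esub> (g \<star> f)"
  using group_hom.hom_inv[OF comp_right_group_hom[OF assms(1-4)]] assms(5) by (simp add: homs_def)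

lemma comp_neg_left:
  assumes "X \<in> Ob T" "Y \<in> Ob T" "Z \<in> Ob T" "f \<in> homs T X Y" "g \<in> homs T Y Z"
  shows "(inv\<^bsub>Hom T Y Z\<^esub> g) \<star> f = inv\<^bsub>Hom T X Z\<^esub> (g \<star> f)"
  using group_hom.hom_inv[OF comp_left_group_hom[OF assms(1-4)]] assms(5) by (simp add: homs_def)

lemma neg_neg:
  assumes "X \<in> Ob T" "Y \<in> Ob T" "f \<in> homs T X Y"
  shows "inv\<^bsub>Hom T X Y\<^esub> (inv\<^bsub>Hom T X Y\<^esub> f) = f"
  using group.inv_inv[OF Hom_group[OF assms(1,2)]] assms(3) by (simp add: homs_def)

lemma neg_zero:
  assumes "X \<in> Ob T" "Y \<in> Ob T"
  shows "inv\<^bsub>Hom T X Y\<^esub> (zero_mor T X Y) = zero_mor T X Y"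
  using Hom_group[OF assms] by (simp add: zero_mor_def group.is_monoid monoid.inv_one)

lemma orthI: "(\<And>f. f \<in> homs T X Y \<Longrightarrow> f = zero_mor T X Y) \<Longrightarrow> orth T X Y"
  by (simp add: orth_def)

lemma orth_singleton:
  assumes "X \<in> Ob T" "Y \<in> Ob T"
  shows "orth T X Y \<longleftrightarrow> homs T X Y = {zero_mor T X Y}"
  using zero_mor_in[OF assms] by (auto simp: orth_def)

text \<open>A trivial kernel gives injectivity, applied to the difference of \<open>a\<close> and
  \<open>b\<close>, which is \<open>?d\<close> in the multiplicative notation of the
  hom-groups.\<close>

lemma left_cancel:
  assumes "X \<in> Ob T" "Y \<in> Ob T" "Z \<in> Ob T" "g \<in> homs T Y Z"
    and "a \<in> homs T X Y" "b \<in> homs T X Y" "g \<star> a = g \<star> b"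
    and "\<And>d. d \<in> homs T X Y \<Longrightarrow> g \<star> d = zero_mor T X Z \<Longrightarrow> d = zero_mor T X Y"
  shows "a = b"
proof -
  interpret h: group_hom "Hom T X Y" "Hom T X Z" "\<lambda>f. g \<star> f"
    by (rule comp_right_group_hom[OF assms(1-4)])
  have c: "a \<in> carrier (Hom T X Y)" "b \<in> carrier (Hom T X Y)"
    using assms(5,6) by (auto simp: homs_def)
  let ?d = "a \<otimes>\<^bsub>Hom T X Y\<^esub> inv\<^bsub>Hom T X Y\<^esub> b"
  have "g \<star> ?d = zero_mor T X Z"
    using c assms(7) by (simp add: zero_mor_def)
  then have "?d = \<one>\<^bsub>Hom T X Y\<^esub>"
    using assms(8)[of ?d] c by (simp add: homs_def zero_mor_def)
  then show ?thesis using c using h.G.inv_solve_right'[of "\<one>\<^bsub>Hom T X Y\<^esub>" a b] by simp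
qed

lemma right_cancel:
  assumes "X \<in> Ob T" "Y \<in> Ob T" "Z \<in> Ob T" "g \<in> homs T X Y"
    and "a \<in> homs T Y Z" "b \<in> homs T Y Z" "a \<star> g = b \<star> g"
    and "\<And>d. d \<in> homs T Y Z \<Longrightarrow> d \<star> g = zero_mor T X Z \<Longrightarrow> d = zero_mor T Y Z"
  shows "a = b"
proof -
  interpret h: group_hom "Hom T Y Z" "Hom T X Z" "\<lambda>f. f \<star> g"
    by (rule comp_left_group_hom[OF assms(1-4)])
  have c: "a \<in> carrier (Hom T Y Z)" "b \<in> carrier (Hom T Y Z)"
    using assms(5,6) by (auto simp: homs_def)
  let ?d = "a \<otimes>\<^bsub>Hom T Y Z\<^esub> inv\<^bsub>Hom T Y Z\<^esub> b"
  have "?d \<star> g = zero_mor T X Z"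
    using c assms(7) by (simp add: zero_mor_def)
  then have "?d = \<one>\<^bsub>Hom T Y Z\<^esub>"
    using assms(8)[of ?d] c by (simp add: homs_def zero_mor_def)
  then show ?thesis using c using h.G.inv_solve_right'[of "\<one>\<^bsub>Hom T Y Z\<^esub>" a b] by simp
qed

text \<open>The condition on the identity involves no other object, so it passes to full
  subcategories; this is how their zero objects are recognised later.\<close>

lemma zero_ob_iff: "is_zero_ob T N \<longleftrightarrow> N \<in> Ob T \<and> Idm T N = zero_mor T N N"
proof (intro iffI conjI)
  assume N: "is_zero_ob T N"
  then show "N \<in> Ob T" by (simp add: is_zero_ob_def)
  with N show "Idm T N = zero_mor T N N"
    using Idm_in zero_mor_in unfolding is_zero_ob_def by blast
next
  assume N: "N \<in> Ob T \<and> Idm T N = zero_mor T N N"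
  have "f = zero_mor T N X" if "X \<in> Ob T" "f \<in> homs T N X" for X f
    using that N Comp_Idm_right comp_zero_right by metis
  moreover have "f = zero_mor T X N" if "X \<in> Ob T" "f \<in> homs T X N" for X f
    using that N Comp_Idm_left comp_zero_left by metis
  ultimately show "is_zero_ob T N"
    unfolding is_zero_ob_def using N zero_mor_in by metis
qed

lemma zero_ob_Ob: "is_zero_ob T N \<Longrightarrow> N \<in> Ob T"
  by (simp add: is_zero_ob_def)

lemma zero_ob_orth_left: "is_zero_ob T N \<Longrightarrow> X \<in> Ob T \<Longrightarrow> orth T N X"
  using zero_mor_in unfolding is_zero_ob_def orth_def by blast

lemma zero_ob_orth_right: "is_zero_ob T N \<Longrightarrow> X \<in> Ob T \<Longrightarrow> orth T X N"
  using zero_mor_in unfolding is_zero_ob_def orth_def by blast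

lemma orth_self_zero_ob: "X \<in> Ob T \<Longrightarrow> orth T X X \<Longrightarrow> is_zero_ob T X"
  using zero_ob_iff Idm_in orth_def by metis

lemma iso_Idm: "X \<in> Ob T \<Longrightarrow> is_iso_mor T X X (Idm T X)"
  unfolding is_iso_mor_def using Idm_in Comp_Idm_left by blast

lemma iso_obs_refl: "X \<in> Ob T \<Longrightarrow> iso_obs T X X"
  unfolding iso_obs_def using iso_Idm by blast

lemma iso_obs_sym: "iso_obs T X Y \<Longrightarrow> iso_obs T Y X"
  unfolding iso_obs_def is_iso_mor_def by blast

lemma iso_obs_zero: "is_zero_ob T X \<Longrightarrow> is_zero_ob T Y \<Longrightarrow> iso_obs T X Y"
proof -
  assume N: "is_zero_ob T X" "is_zero_ob T Y"
  note O = zero_ob_Ob[OF N(1)] zero_ob_Ob[OF N(2)]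
  note z = zero_mor_in[OF O] zero_mor_in[OF O(2,1)]
  have "zero_mor T Y X \<star> zero_mor T X Y = Idm T X" "zero_mor T X Y \<star> zero_mor T Y X = Idm T Y"
    using N O comp_zero_right[OF O(1,2,1) z(2)] comp_zero_right[OF O(2,1,2) z(1)]
    by (simp_all add: zero_ob_iff)
  with z O show ?thesis unfolding iso_obs_def is_iso_mor_def by blast
qed

lemma iso_zero_ob:
  assumes "iso_obs T X Y" "is_zero_ob T X"
  shows "is_zero_ob T Y"
proof -
  obtain f g where fg: "f \<in> homs T X Y" "g \<in> homs T Y X" "f \<star> g = Idm T Y" "X \<in> Ob T" "Y \<in> Ob T"
    using assms(1) unfolding iso_obs_def is_iso_mor_def by blast
  have "f = zero_mor T X Y" using assms(2) fg zero_ob_orth_left orth_def by metis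
  then have "Idm T Y = zero_mor T Y Y" using fg comp_zero_left by metis
  then show ?thesis using zero_ob_iff fg by simp
qed

end

section \<open>Shifts, rotation and the weak universal properties of triangles\<close>

context triangulated_category
begin

lemma Shift_Ob: "X \<in> Ob T \<Longrightarrow> Shift T X \<in> Ob T"
  using bij_betw_apply[OF Shift_bij] by metis

lemma Shift_Ob_cases:
  assumes "Y \<in> Ob T" obtains X where "X \<in> Ob T" "Shift T X = Y"
proof -
  have "Y \<in> Shift T ` Ob T" using assms bij_betw_imp_surj_on[OF Shift_bij] by simp
  then show thesis using that by auto
qed

lemma Shift_inj: "X \<in> Ob T \<Longrightarrow> Y \<in> Ob T \<Longrightarrow> Shift T X = Shift T Y \<Longrightarrow> X = Y"
  using bij_betw_imp_inj_on[OF Shift_bij] inj_onD by metis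

lemma ShiftM_in:
  "X \<in> Ob T \<Longrightarrow> Y \<in> Ob T \<Longrightarrow> f \<in> homs T X Y \<Longrightarrow> ShiftM T f \<in> homs T (Shift T X) (Shift T Y)"
  using bij_betw_apply[OF ShiftM_bij] by metis

lemma ShiftM_cases:
  assumes "X \<in> Ob T" "Y \<in> Ob T" "f \<in> homs T (Shift T X) (Shift T Y)"
  obtains g where "g \<in> homs T X Y" "ShiftM T g = f"
proof -
  have "f \<in> ShiftM T ` homs T X Y" using assms bij_betw_imp_surj_on[OF ShiftM_bij] by simp
  then show thesis using that by auto
qed

lemma ShiftM_inj:
  "X \<in> Ob T \<Longrightarrow> Y \<in> Ob T \<Longrightarrow> f \<in> homs T X Y \<Longrightarrow> g \<in> homs T X Y \<Longrightarrow> ShiftM T f = ShiftM T g \<Longrightarrow> f = g"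
  using bij_betw_imp_inj_on[OF ShiftM_bij] inj_onD by metis

lemma ShiftM_group_hom:
  assumes "X \<in> Ob T" "Y \<in> Ob T"
  shows "group_hom (Hom T X Y) (Hom T (Shift T X) (Shift T Y)) (ShiftM T)"
  by (simp add: Hom_group ShiftM_additive Shift_Ob assms group_hom.intro group_hom_axioms.intro)

lemma ShiftM_zero:
  assumes "X \<in> Ob T" "Y \<in> Ob T"
  shows "ShiftM T (zero_mor T X Y) = zero_mor T (Shift T X) (Shift T Y)"
  using group_hom.hom_one[OF ShiftM_group_hom[OF assms]] by (simp add: zero_mor_def)

lemma orth_Shift:
  assumes "X \<in> Ob T" "Y \<in> Ob T"
  shows "orth T (Shift T X) (Shift T Y) \<longleftrightarrow> orth T X Y"
proof
  assume o: "orth T (Shift T X) (Shift T Y)"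
  show "orth T X Y"
  proof (rule orthI)
    fix f assume f: "f \<in> homs T X Y"
    then have "ShiftM T f = ShiftM T (zero_mor T X Y)"
      using o ShiftM_in[OF assms f] ShiftM_zero[OF assms] by (simp add: orth_def)
    then show "f = zero_mor T X Y" using ShiftM_inj assms f zero_mor_in by blast
  qed
next
  assume o: "orth T X Y"
  show "orth T (Shift T X) (Shift T Y)"
  proof (rule orthI)
    fix f assume f: "f \<in> homs T (Shift T X) (Shift T Y)"
    then obtain g where "g \<in> homs T X Y" "ShiftM T g = f" using ShiftM_cases[OF assms] by blast
    then show "f = zero_mor T (Shift T X) (Shift T Y)"
      using o ShiftM_zero[OF assms] by (auto simp: orth_def)
  qed
qed

lemma zero_ob_Shift:
  assumes "X \<in> Ob T" shows "is_zero_ob T (Shift T X) \<longleftrightarrow> is_zero_ob T X"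
  using orth_Shift[OF assms assms] orth_self_zero_ob zero_ob_orth_left assms Shift_Ob by metis

lemma zero_ob_cases:
  assumes "is_zero_ob T N" obtains M where "is_zero_ob T M" "Shift T M = N"
  using assms zero_ob_Ob zero_ob_Shift Shift_Ob_cases by metis

lemma TriD:
  assumes "Tri T X Y Z f g h"
  shows "X \<in> Ob T" "Y \<in> Ob T" "Z \<in> Ob T" "f \<in> homs T X Y" "g \<in> homs T Y Z"
    "h \<in> homs T Z (Shift T X)"
  using Tri_types[OF assms] by auto

lemma triD: "tri T X Y Z \<Longrightarrow> X \<in> Ob T \<and> Y \<in> Ob T \<and> Z \<in> Ob T"
  unfolding tri_def using Tri_types by blast

lemma Tri_rotate1:
  assumes "Tri T X Y Z f g h"
  shows "Tri T Y Z (Shift T X) g h (inv\<^bsub>Hom T (Shift T X) (Shift T Y)\<^esub> (ShiftM T f))"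
  using Tri_rotate TriD[OF assms] assms by blast

lemma Tri_unrotate:
  assumes "Tri T Y Z X' g h k" "X' = Shift T X" "X \<in> Ob T"
  obtains f where "Tri T X Y Z f g h" "k = inv\<^bsub>Hom T (Shift T X) (Shift T Y)\<^esub> (ShiftM T f)"
proof -
  note d = TriD[OF assms(1)]
  have k: "inv\<^bsub>Hom T (Shift T X) (Shift T Y)\<^esub> k \<in> homs T (Shift T X) (Shift T Y)"
    using d assms Shift_Ob neg_in by metis
  then obtain f where f: "f \<in> homs T X Y" "ShiftM T f = inv\<^bsub>Hom T (Shift T X) (Shift T Y)\<^esub> k"
    using ShiftM_cases assms d by metis
  have kk: "k = inv\<^bsub>Hom T (Shift T X) (Shift T Y)\<^esub> (ShiftM T f)"
    using f d assms Shift_Ob neg_neg by metis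
  with assms d f have "Tri T X Y Z f g h" using Tri_rotate[of X Y Z f g h] by blast
  with kk that show thesis by blast
qed

lemma Tri_zero_left:
  assumes "W \<in> Ob T" "is_zero_ob T M"
  shows "Tri T M W W (zero_mor T M W) (Idm T W) (zero_mor T W (Shift T M))"
proof -
  have M: "M \<in> Ob T" "Shift T M \<in> Ob T" "is_zero_ob T (Shift T M)" "Shift T W \<in> Ob T"
    using assms zero_ob_Ob Shift_Ob zero_ob_Shift by blast+
  have "inv\<^bsub>Hom T (Shift T M) (Shift T W)\<^esub> (ShiftM T (zero_mor T M W)) = zero_mor T (Shift T M) (Shift T W)"
    using M assms by (simp add: ShiftM_zero neg_zero)
  then show ?thesis
    using Tri_rotate[OF M(1) assms(1) assms(1) zero_mor_in[OF M(1) assms(1)] Idm_in[OF assms(1)]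
        zero_mor_in[OF assms(1) M(2)]] Tri_Idm[OF assms(1) M(3)] by simp
qed

text \<open>Weak cokernel property: zero and \<open>w\<close> start a map of triangles to 0 -> W ->
  W, and the filler supplied by \<open>Tri_morphism\<close> is the factorization.\<close>

lemma Tri_lift_cone:
  assumes t: "Tri T X Y Z f g h" and W: "W \<in> Ob T" and w: "w \<in> homs T Y W"
    and z: "w \<star> f = zero_mor T X W"
  obtains v where "v \<in> homs T Z W" "v \<star> g = w"
proof -
  obtain N where "is_zero_ob T N" using zero_ob_exists by blast
  note d = TriD[OF t]
  note N = zero_ob_Ob[OF \<open>is_zero_ob T N\<close>]
  have "w \<star> f = zero_mor T N W \<star> zero_mor T X N"
    using comp_zero_right[OF d(1) N W zero_mor_in[OF N W]] z by simp
  then obtain c where c: "c \<in> homs T Z W" "c \<star> g = Idm T W \<star> w"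
    using Tri_morphism[OF t Tri_zero_left[OF W \<open>is_zero_ob T N\<close>] zero_mor_in[OF d(1) N] w] by blast
  then show thesis using that Comp_Idm_left[OF d(2) W w] by simp
qed

text \<open>Dual of \<open>Tri_lift_cone\<close>. Since \<open>Tri_morphism\<close> supplies only
  the third map, both triangles are rotated until the wanted first map stands there; it is then
  desuspended, and the two signs created by rotation cancel.\<close>

lemma Tri_lift_cocone:
  assumes t: "Tri T X Y Z f g h" and W: "W \<in> Ob T" and w: "w \<in> homs T W Y"
    and z: "g \<star> w = zero_mor T W Z"
  obtains v where "v \<in> homs T W X" "f \<star> v = w"
proof -
  obtain N where N0: "is_zero_ob T N" using zero_ob_exists by blast
  note d = TriD[OF t]
  note N = zero_ob_Ob[OF N0]
  note S = Shift_Ob[OF W] Shift_Ob[OF d(1)] Shift_Ob[OF d(2)]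
  note t2 = Tri_rotate1[OF Tri_Idm[OF W N0]]
  have "zero_mor T N Z \<star> zero_mor T W N = g \<star> w"
    using comp_zero_right[OF W N d(3) zero_mor_in[OF N d(3)]] z by simp
  then obtain c where c: "c \<in> homs T (Shift T W) (Shift T X)"
    "ShiftM T w \<star> inv\<^bsub>Hom T (Shift T W) (Shift T W)\<^esub> (ShiftM T (Idm T W)) =
      inv\<^bsub>Hom T (Shift T X) (Shift T Y)\<^esub> (ShiftM T f) \<star> c"
    using Tri_morphism[OF t2 Tri_rotate1[OF t] w zero_mor_in[OF N d(3)]] by blast
  obtain v where v: "v \<in> homs T W X" "ShiftM T v = c" using ShiftM_cases[OF W d(1) c(1)] by blast
  have "inv\<^bsub>Hom T (Shift T W) (Shift T Y)\<^esub> (ShiftM T w) =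
      inv\<^bsub>Hom T (Shift T W) (Shift T Y)\<^esub> (ShiftM T f \<star> c)"
    using c(2) by (simp add: comp_neg_right[OF S(1,1,3)] comp_neg_left[OF S] ShiftM_in W d w c(1)
        ShiftM_Idm Comp_Idm_right[OF S(1,3)] Idm_in S)
  then have "ShiftM T w = ShiftM T f \<star> c"
    by (metis neg_neg[OF S(1) S(3)] ShiftM_in[OF W d(2) w]
        Comp_in[OF S c(1) ShiftM_in[OF d(1,2,4)]])
  then have "ShiftM T w = ShiftM T (f \<star> v)" using ShiftM_Comp[OF W d(1,2) v(1) d(4)] v(2) by simp
  then have "w = f \<star> v" using ShiftM_inj[OF W d(2) w] Comp_in[OF W d(1,2) v(1) d(4)] by blast
  with v that show thesis by blast
qed

text \<open>The triangle X -> X -> 0 maps to the given one by the identity and \<open>f\<close>,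
  which makes the composite pass through a zero object.\<close>

lemma Tri_comp_zero:
  assumes t: "Tri T X Y Z f g h" shows "g \<star> f = zero_mor T X Z"
proof -
  obtain N where N0: "is_zero_ob T N" using zero_ob_exists by blast
  note d = TriD[OF t]
  note N = zero_ob_Ob[OF N0]
  obtain c where c: "c \<in> homs T N Z" "c \<star> zero_mor T X N = g \<star> f"
    using Tri_morphism[OF Tri_Idm[OF d(1) N0] t Idm_in[OF d(1)] d(4)] by blast
  then show ?thesis using comp_zero_right[OF d(1) N d(3) c(1)] by simp
qed

lemma tri_rotate: "tri T X Y Z \<Longrightarrow> tri T Y Z (Shift T X)"
  unfolding tri_def using Tri_rotate1 by blast

lemma tri_unrotate: "tri T Y Z (Shift T X) \<Longrightarrow> X \<in> Ob T \<Longrightarrow> tri T X Y Z"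
  unfolding tri_def using Tri_unrotate by metis

lemma tri_Shift:
  assumes "X \<in> Ob T" "Y \<in> Ob T" "Z \<in> Ob T"
  shows "tri T (Shift T X) (Shift T Y) (Shift T Z) \<longleftrightarrow> tri T X Y Z"
  using tri_rotate tri_unrotate assms by meson

lemma tri_zero_left: "W \<in> Ob T \<Longrightarrow> is_zero_ob T M \<Longrightarrow> tri T M W W"
  using Tri_zero_left triI by metis

lemma tri_zero_right: "W \<in> Ob T \<Longrightarrow> is_zero_ob T M \<Longrightarrow> tri T W W M"
  using Tri_Idm triI by metis

lemma orth_tri_right:
  assumes "tri T X Y Z" "W \<in> Ob T" "orth T W X" "orth T W Z"
  shows "orth T W Y"
proof (rule orthI)
  fix w assume w: "w \<in> homs T W Y"
  obtain f g h where t: "Tri T X Y Z f g h" using assms(1) tri_def by metis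
  note d = TriD[OF t]
  have "g \<star> w = zero_mor T W Z" using assms(4) Comp_in[OF assms(2) d(2,3) w d(5)] orth_def by metis
  then obtain v where v: "v \<in> homs T W X" "f \<star> v = w" using Tri_lift_cocone[OF t assms(2) w] by blast
  then show "w = zero_mor T W Y"
    using assms(3) comp_zero_right[OF assms(2) d(1,2,4)] orth_def by metis
qed

lemma orth_tri_left:
  assumes "tri T X Y Z" "W \<in> Ob T" "orth T X W" "orth T Z W"
  shows "orth T Y W"
proof (rule orthI)
  fix w assume w: "w \<in> homs T Y W"
  obtain f g h where t: "Tri T X Y Z f g h" using assms(1) tri_def by metis
  note d = TriD[OF t]
  have "w \<star> f = zero_mor T X W" using assms(3) Comp_in[OF d(1,2) assms(2) d(4) w] orth_def by metis
  then obtain v where v: "v \<in> homs T Z W" "v \<star> g = w" using Tri_lift_cone[OF t assms(2) w] by blast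
  then show "w = zero_mor T Y W"
    using assms(4) comp_zero_left[OF d(2,3) assms(2) d(5)] orth_def by metis
qed

text \<open>The octahedral axiom says that forming extensions is associative.\<close>

lemma tri_assoc1:
  assumes "tri T X F U" "tri T F E V"
  shows "\<exists>W. tri T X E W \<and> tri T U W V"
proof -
  obtain f g h f' g' h' where t: "Tri T X F U f g h" "Tri T F E V f' g' h'"
    using assms tri_def by metis
  note d = TriD[OF t(1)] TriD[OF t(2)]
  have "f' \<star> f \<in> homs T X E" using Comp_in d by blast
  then obtain W v w where "Tri T X E W (f' \<star> f) v w" using Tri_cone d by metis
  then show ?thesis using Tri_octahedral[OF t] triI by metis
qed

text \<open>The octahedron for the composable maps E -> W -> V of the rotated triangles, with the
  result shifted back by one. The map E -> V stays explicit because \<open>strict_mono_Tri\<close>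
  has to recognise it.\<close>

lemma Tri_assoc2:
  assumes t1: "Tri T X E W f g h" and t2: "Tri T U W V u q r"
  shows "\<exists>F k l. tri T X F U \<and> Tri T F E V k (q \<star> g) l"
proof -
  note d = TriD[OF t1] TriD[OF t2]
  have c: "q \<star> g \<in> homs T E V" using Comp_in d by blast
  then obtain G v w where t3: "Tri T E V G (q \<star> g) v w" using Tri_cone d by metis
  obtain F where F: "F \<in> Ob T" "G = Shift T F" using Shift_Ob_cases TriD[OF t3] by metis
  obtain k where k: "Tri T F E V k (q \<star> g) v" using Tri_unrotate[OF t3 F(2,1)] by blast
  have "tri T (Shift T X) G (Shift T U)"
    using Tri_octahedral[OF Tri_rotate1[OF t1] Tri_rotate1[OF t2] t3] triI by metis
  then have "tri T X F U" using tri_Shift F d by metis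
  with k show ?thesis by blast
qed

lemma tri_assoc2:
  assumes "tri T X E W" "tri T U W V"
  shows "\<exists>F. tri T X F U \<and> tri T F E V"
  using assms Tri_assoc2 tri_def by metis

text \<open>Lifting the identity of \<open>Y\<close> through \<open>f\<close> gives a right inverse.
  In the triangle rotated backwards the first term is zero, so the identity of \<open>X\<close>
  factors through \<open>f\<close>, which gives a left inverse.\<close>

lemma Tri_zero_cone_iso:
  assumes t: "Tri T X Y N f g h" and N: "is_zero_ob T N"
  shows "is_iso_mor T X Y f"
proof -
  note d = TriD[OF t]
  have "g \<star> Idm T Y = zero_mor T Y N"
    using zero_ob_orth_right[OF N d(2)] Comp_Idm_right[OF d(2,3,5)] d(5) orth_def by metis
  then obtain r where r: "r \<in> homs T Y X" "f \<star> r = Idm T Y"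
    using Tri_lift_cocone[OF t d(2) Idm_in[OF d(2)]] by blast
  obtain M where M: "is_zero_ob T M" "Shift T M = N" using zero_ob_cases[OF N] by blast
  obtain k where k: "Tri T M X Y k f g"
    using Tri_unrotate[OF t M(2)[symmetric] zero_ob_Ob[OF M(1)]] by blast
  note dk = TriD[OF k]
  have "Idm T X \<star> k = zero_mor T M X"
    using zero_ob_orth_left[OF M(1) d(1)] Comp_Idm_left[OF dk(1,2,4)] dk(4) orth_def by metis
  then obtain l where l: "l \<in> homs T Y X" "l \<star> f = Idm T X"
    using Tri_lift_cone[OF k d(1) Idm_in[OF d(1)]] by blast
  have "l = l \<star> (f \<star> r)" using r(2) Comp_Idm_right[OF d(2,1) l(1)] by simp
  also have "\<dots> = (l \<star> f) \<star> r" using Comp_assoc[OF d(2,1,2,1) r(1) d(4) l(1)] by simp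
  also have "\<dots> = r" using l(2) Comp_Idm_left[OF d(2,1) r(1)] by simp
  finally have "l = r" .
  with l r d show ?thesis unfolding is_iso_mor_def by blast
qed

lemma tri_zero_cone_iso: "tri T X Y N \<Longrightarrow> is_zero_ob T N \<Longrightarrow> iso_obs T X Y"
  unfolding tri_def iso_obs_def using Tri_zero_cone_iso TriD by meson

lemma tri_zero_cocone_iso:
  assumes "tri T M X Y" "is_zero_ob T M"
  shows "iso_obs T X Y"
  using assms tri_rotate tri_zero_cone_iso zero_ob_Shift zero_ob_Ob by metis

text \<open>\<open>Tri_iso\<close> wants the three new maps in advance; they are the old ones
  conjugated by the isomorphisms.\<close>

lemma tri_iso:
  assumes t: "tri T X Y Z" and "iso_obs T X X'" "iso_obs T Y Y'" "iso_obs T Z Z'"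
  shows "tri T X' Y' Z'"
proof -
  obtain f g h where t: "Tri T X Y Z f g h" using assms(1) tri_def by metis
  obtain a a' where a: "X' \<in> Ob T" "is_iso_mor T X X' a" "a \<in> homs T X X'" "a' \<in> homs T X' X"
      "a' \<star> a = Idm T X"
    using assms(2) unfolding iso_obs_def is_iso_mor_def by blast
  obtain b b' where b: "Y' \<in> Ob T" "is_iso_mor T Y Y' b" "b \<in> homs T Y Y'" "b' \<in> homs T Y' Y"
      "b' \<star> b = Idm T Y"
    using assms(3) unfolding iso_obs_def is_iso_mor_def by blast
  obtain c c' where c: "Z' \<in> Ob T" "is_iso_mor T Z Z' c" "c \<in> homs T Z Z'" "c' \<in> homs T Z' Z"
      "c' \<star> c = Idm T Z"
    using assms(4) unfolding iso_obs_def is_iso_mor_def by blast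
  note d = TriD[OF t]
  note S = Shift_Ob[OF d(1)] Shift_Ob[OF a(1)]
  note Sa = ShiftM_in[OF d(1) a(1,3)]
  have fa: "f \<star> a' \<in> homs T X' Y" using Comp_in[OF a(1) d(1,2) a(4) d(4)] .
  have gb: "g \<star> b' \<in> homs T Y' Z" using Comp_in[OF b(1) d(2,3) b(4) d(5)] .
  have hc: "h \<star> c' \<in> homs T Z' (Shift T X)" using Comp_in[OF c(1) d(3) S(1) c(4) d(6)] .
  have "b \<star> f = (b \<star> f \<star> a') \<star> a"
    using Comp_assoc[OF d(1) a(1) d(2) b(1) a(3) fa b(3)] Comp_assoc[OF d(1) a(1) d(1,2) a(3,4) d(4)]
      a(5) Comp_Idm_right[OF d(1,2,4)] by simp
  moreover have "c \<star> g = (c \<star> g \<star> b') \<star> b"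
    using Comp_assoc[OF d(2) b(1) d(3) c(1) b(3) gb c(3)] Comp_assoc[OF d(2) b(1) d(2,3) b(3,4) d(5)]
      b(5) Comp_Idm_right[OF d(2,3,5)] by simp
  moreover have "ShiftM T a \<star> h = (ShiftM T a \<star> h \<star> c') \<star> c"
    using Comp_assoc[OF d(3) c(1) S c(3) hc Sa] Comp_assoc[OF d(3) c(1) d(3) S(1) c(3,4) d(6)]
      c(5) Comp_Idm_right[OF d(3) S(1) d(6)] by simp
  ultimately have "Tri T X' Y' Z' (b \<star> f \<star> a') (c \<star> g \<star> b') (ShiftM T a \<star> h \<star> c')"
    using Tri_iso[OF t a(1) b(1) c(1) Comp_in[OF a(1) d(2) b(1) fa b(3)]
        Comp_in[OF b(1) d(3) c(1) gb c(3)] Comp_in[OF c(1) S hc Sa] a(2) b(2) c(2)] by blast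
  then show ?thesis by (rule triI)
qed

lemma tri_zero_zero:
  assumes "tri T X Y Z" "is_zero_ob T X" "is_zero_ob T Z"
  shows "is_zero_ob T Y"
  using tri_zero_cone_iso[OF assms(1,3)] iso_zero_ob assms(2) by blast

text \<open>A triangle whose connecting morphism vanishes splits, so that its outer terms can be
  interchanged.\<close>

lemma tri_swap:
  assumes "tri T X E Y" "orth T Y (Shift T X)"
  shows "tri T Y E X"
proof -
  obtain f g h where t: "Tri T X E Y f g h" using assms(1) tri_def by metis
  note d = TriD[OF t]
  note S = Shift_Ob[OF d(1)]
  obtain N where N: "is_zero_ob T N" using zero_ob_exists by blast
  have "h = zero_mor T Y (Shift T X)" using assms(2) d(6) orth_def by metis
  then have "h \<star> Idm T Y = zero_mor T Y (Shift T X)" using Comp_Idm_right[OF d(3) S d(6)] by simp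
  then obtain s where s: "s \<in> homs T Y E" "g \<star> s = Idm T Y"
    using Tri_lift_cocone[OF Tri_rotate1[OF t] d(3) Idm_in[OF d(3)]] by blast
  \<comment> \<open>Octahedron for the section \<open>s\<close> followed by \<open>g\<close>: their
    composite is the identity, with cone \<open>N\<close>, and the cones of \<open>s\<close> and
    \<open>g\<close> are \<open>C\<close> and X[1]. The resulting triangle C -> 0 -> X[1] identifies
    \<open>C\<close> with \<open>X\<close>.\<close>
  obtain C p q where C: "Tri T Y E C s p q" using Tri_cone[OF d(3,2) s(1)] by blast
  have "tri T C N (Shift T X)"
    using Tri_octahedral[OF C Tri_rotate1[OF t], of N "zero_mor T Y N" "zero_mor T N (Shift T Y)"]
      Tri_Idm[OF d(3) N] s(2) triI by metis
  then have "tri T X C N" using tri_unrotate d(1) by blast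
  then have "iso_obs T C X" using tri_zero_cone_iso N iso_obs_sym by blast
  then show ?thesis by (rule tri_iso[OF triI[OF C] iso_obs_refl[OF d(3)] iso_obs_refl[OF d(2)]])
qed

end

section \<open>Full subcategories and slicings\<close>

lemma full_subcat_simps [simp]:
  "Ob (full_subcat T S) = Ob T \<inter> S"
  "Hom (full_subcat T S) = Hom T"
  "Comp (full_subcat T S) = Comp T"
  "Idm (full_subcat T S) = Idm T"
  "Shift (full_subcat T S) = Shift T"
  "ShiftM (full_subcat T S) = ShiftM T"
  "Tri (full_subcat T S) X Y Z f g h \<longleftrightarrow> X \<in> S \<and> Y \<in> S \<and> Z \<in> S \<and> Tri T X Y Z f g h"
  "homs (full_subcat T S) = homs T"
  "zero_mor (full_subcat T S) = zero_mor T"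
  "is_iso_mor (full_subcat T S) = is_iso_mor T"
  "orth (full_subcat T S) = orth T"
  by (simp_all add: full_subcat_def homs_def zero_mor_def is_iso_mor_def orth_def fun_eq_iff)

lemma tri_full_subcat [simp]:
  "tri (full_subcat T S) X Y Z \<longleftrightarrow> X \<in> S \<and> Y \<in> S \<and> Z \<in> S \<and> tri T X Y Z"
  by (auto simp: tri_def)

lemma iso_obs_full_subcat [simp]:
  "iso_obs (full_subcat T S) X Y \<longleftrightarrow> X \<in> S \<and> Y \<in> S \<and> iso_obs T X Y"
  by (auto simp: iso_obs_def)

lemma is_biproduct_full_subcat [simp]:
  "is_biproduct (full_subcat T S) X Y W \<longleftrightarrow> X \<in> S \<and> Y \<in> S \<and> W \<in> S \<and> is_biproduct T X Y W"
  by (auto simp: is_biproduct_def)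

context preadditive_category
begin

lemma preadditive_full_subcat: "preadditive_category (full_subcat T S)"
  apply (rule preadditive_category.intro)
  subgoal for X Y X' Y' f using homs_disjoint[of X Y X' Y' f] by simp
  subgoal for X using Idm_in[of X] by simp
  subgoal for X Y Z f g using Comp_in[of X Y Z f g] by simp
  subgoal for X Y f using Comp_Idm_right[of X Y f] by simp
  subgoal for X Y f using Comp_Idm_left[of X Y f] by simp
  subgoal for W X Y Z f g h using Comp_assoc[of W X Y Z f g h] by simp
  subgoal for X Y using Hom_comm_group[of X Y] by simp
  subgoal for X Y Z g using Comp_additive_right[of X Y Z g] by simp
  subgoal for X Y Z f using Comp_additive_left[of X Y Z f] by simp
  done

lemma is_zero_ob_full_subcat [simp]:
  "is_zero_ob (full_subcat T S) N \<longleftrightarrow> N \<in> S \<and> is_zero_ob T N"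
  using zero_ob_iff preadditive_category.zero_ob_iff[OF preadditive_full_subcat] by auto

end

context triangulated_category
begin

text \<open>Closure of \<open>S\<close> enters only where an axiom produces objects: zero,
  biproducts, shifts and cones. In the octahedral axiom all objects are given beforehand, and
  fullness supplies the morphisms.\<close>

lemma triangulated_full_subcat:
  assumes S: "triangulated_subcat T S"
  shows "triangulated_category (full_subcat T S)"
proof -
  interpret S: preadditive_category "full_subcat T S" by (rule preadditive_full_subcat)
  have bip: "W \<in> S" if "X \<in> S" "Y \<in> S" "is_biproduct T X Y W" for X Y W
    using S that unfolding triangulated_subcat_def additive_subcat_def by blast
  have sh: "Shift T X \<in> S \<longleftrightarrow> X \<in> S" if "X \<in> Ob T" for X
    using S that unfolding triangulated_subcat_def by blast
  have cone: "Z \<in> S" if "X \<in> S" "Y \<in> S" "Tri T X Y Z f g h" for X Y Z f g h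
    using S that unfolding triangulated_subcat_def by blast
  show ?thesis
  proof (intro triangulated_category.intro additive_category.intro S.preadditive_category_axioms
      additive_category_axioms.intro triangulated_category_axioms.intro)
    show "\<exists>N. is_zero_ob (full_subcat T S) N"
    proof -
      obtain N where "N \<in> S" "is_zero_ob T N"
        using S unfolding triangulated_subcat_def additive_subcat_def by blast
      then show ?thesis by auto
    qed
    show "\<exists>W. is_biproduct (full_subcat T S) X Y W"
      if "X \<in> Ob (full_subcat T S)" "Y \<in> Ob (full_subcat T S)" for X Y
    proof -
      have XY: "X \<in> Ob T" "Y \<in> Ob T" "X \<in> S" "Y \<in> S" using that by auto
      obtain W where W: "is_biproduct T X Y W" using biproduct_exists[OF XY(1,2)] ..
      have "is_biproduct (full_subcat T S) X Y W" using W bip[OF XY(3,4) W] XY(3,4) by simp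
      then show ?thesis ..
    qed
    show "bij_betw (Shift (full_subcat T S)) (Ob (full_subcat T S)) (Ob (full_subcat T S))"
    proof -
      have "inj_on (Shift T) (Ob T \<inter> S)"
        using bij_betw_imp_inj_on[OF Shift_bij] inj_on_subset by blast
      moreover have "Shift T ` (Ob T \<inter> S) = Ob T \<inter> S"
      proof (intro equalityI subsetI)
        fix Y assume "Y \<in> Shift T ` (Ob T \<inter> S)"
        then show "Y \<in> Ob T \<inter> S" using sh Shift_Ob by auto
      next
        fix Y assume Y: "Y \<in> Ob T \<inter> S"
        then obtain X where "X \<in> Ob T" "Shift T X = Y" using Shift_Ob_cases by blast
        then show "Y \<in> Shift T ` (Ob T \<inter> S)" using sh Y by auto
      qed
      ultimately show ?thesis by (simp add: bij_betw_def)
    qed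
  next
    fix X Y Z f g h X' Y' Z' f' g' h' a b c
    assume "Tri (full_subcat T S) X Y Z f g h"
      "X' \<in> Ob (full_subcat T S)" "Y' \<in> Ob (full_subcat T S)" "Z' \<in> Ob (full_subcat T S)"
      "f' \<in> homs (full_subcat T S) X' Y'" "g' \<in> homs (full_subcat T S) Y' Z'"
      "h' \<in> homs (full_subcat T S) Z' (Shift (full_subcat T S) X')"
      "is_iso_mor (full_subcat T S) X X' a" "is_iso_mor (full_subcat T S) Y Y' b"
      "is_iso_mor (full_subcat T S) Z Z' c"
      "Comp (full_subcat T S) b f = Comp (full_subcat T S) f' a"
      "Comp (full_subcat T S) c g = Comp (full_subcat T S) g' b"
      "Comp (full_subcat T S) (ShiftM (full_subcat T S) a) h = Comp (full_subcat T S) h' c"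
    then show "Tri (full_subcat T S) X' Y' Z' f' g' h'"
      using Tri_iso[of X Y Z f g h X' Y' Z' f' g' h' a b c] by simp
  next
    fix X Y f assume "X \<in> Ob (full_subcat T S)" "Y \<in> Ob (full_subcat T S)" "f \<in> homs (full_subcat T S) X Y"
    then have XY: "X \<in> Ob T" "Y \<in> Ob T" "f \<in> homs T X Y" "X \<in> S" "Y \<in> S" by simp_all
    then obtain Z g h where t: "Tri T X Y Z f g h" using Tri_cone[OF XY(1-3)] by metis
    have "Tri (full_subcat T S) X Y Z f g h" using t cone[OF XY(4,5) t] XY(4,5) by simp
    then show "\<exists>Z g h. Tri (full_subcat T S) X Y Z f g h" by metis
  next
    fix X Y Z f g h
    assume "X \<in> Ob (full_subcat T S)" "Y \<in> Ob (full_subcat T S)" "Z \<in> Ob (full_subcat T S)"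
      "f \<in> homs (full_subcat T S) X Y" "g \<in> homs (full_subcat T S) Y Z"
      "h \<in> homs (full_subcat T S) Z (Shift (full_subcat T S) X)"
    then show "Tri (full_subcat T S) X Y Z f g h \<longleftrightarrow> Tri (full_subcat T S) Y Z (Shift (full_subcat T S) X) g h
       (inv\<^bsub>Hom (full_subcat T S) (Shift (full_subcat T S) X) (Shift (full_subcat T S) Y)\<^esub> ShiftM (full_subcat T S) f)"
      using Tri_rotate[of X Y Z f g h] sh[of X] by simp
  next
    fix X Y Z f g h X' Y' Z' f' g' h' a b
    assume "Tri (full_subcat T S) X Y Z f g h" "Tri (full_subcat T S) X' Y' Z' f' g' h'"
      "a \<in> homs (full_subcat T S) X X'" "b \<in> homs (full_subcat T S) Y Y'"
      "Comp (full_subcat T S) b f = Comp (full_subcat T S) f' a"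
    then show "\<exists>c\<in>homs (full_subcat T S) Z Z'.
          Comp (full_subcat T S) c g = Comp (full_subcat T S) g' b \<and>
          Comp (full_subcat T S) (ShiftM (full_subcat T S) a) h = Comp (full_subcat T S) h' c"
      using Tri_morphism[of X Y Z f g h X' Y' Z' f' g' h' a b] by simp
  next
    fix X Y U f p q Z V g r s W v w
    assume "Tri (full_subcat T S) X Y U f p q" "Tri (full_subcat T S) Y Z V g r s"
      "Tri (full_subcat T S) X Z W (Comp (full_subcat T S) g f) v w"
    then show "\<exists>a b. Tri (full_subcat T S) U W V a b (Comp (full_subcat T S) (ShiftM (full_subcat T S) p) s) \<and>
              Comp (full_subcat T S) a p = Comp (full_subcat T S) v g \<and> Comp (full_subcat T S) w a = q \<and>
              Comp (full_subcat T S) b v = r \<and>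
              Comp (full_subcat T S) s b = Comp (full_subcat T S) (ShiftM (full_subcat T S) f) w"
      using Tri_octahedral[of X Y U f p q Z V g r s W v w] by simp
  next
    fix X Y assume "X \<in> Ob (full_subcat T S)" "Y \<in> Ob (full_subcat T S)"
    then show "bij_betw (ShiftM (full_subcat T S)) (homs (full_subcat T S) X Y)
         (homs (full_subcat T S) (Shift (full_subcat T S) X) (Shift (full_subcat T S) Y))"
      "ShiftM (full_subcat T S) \<in> hom (Hom (full_subcat T S) X Y)
         (Hom (full_subcat T S) (Shift (full_subcat T S) X) (Shift (full_subcat T S) Y))"
      using ShiftM_bij[of X Y] ShiftM_additive[of X Y] by simp_all
  next
    fix X assume "X \<in> Ob (full_subcat T S)"
    then show "ShiftM (full_subcat T S) (Idm (full_subcat T S) X)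
        = Idm (full_subcat T S) (Shift (full_subcat T S) X)"
      using ShiftM_Idm by simp
  next
    fix X Y Z f g
    assume "X \<in> Ob (full_subcat T S)" "Y \<in> Ob (full_subcat T S)" "Z \<in> Ob (full_subcat T S)"
      "f \<in> homs (full_subcat T S) X Y" "g \<in> homs (full_subcat T S) Y Z"
    then show "ShiftM (full_subcat T S) (Comp (full_subcat T S) g f) =
        Comp (full_subcat T S) (ShiftM (full_subcat T S) g) (ShiftM (full_subcat T S) f)"
      using ShiftM_Comp[of X Y Z f g] by simp
  next
    fix X Y Z f g h
    assume "Tri (full_subcat T S) X Y Z f g h"
    then show "X \<in> Ob (full_subcat T S) \<and> Y \<in> Ob (full_subcat T S) \<and> Z \<in> Ob (full_subcat T S) \<and>
      f \<in> homs (full_subcat T S) X Y \<and> g \<in> homs (full_subcat T S) Y Z \<and>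
      h \<in> homs (full_subcat T S) Z (Shift (full_subcat T S) X)"
      using Tri_types[of X Y Z f g h] by simp
  next
    fix X N
    assume "X \<in> Ob (full_subcat T S)" "is_zero_ob (full_subcat T S) N"
    then show "Tri (full_subcat T S) X X N (Idm (full_subcat T S) X) (zero_mor (full_subcat T S) X N)
          (zero_mor (full_subcat T S) N (Shift (full_subcat T S) X))"
      using Tri_Idm[of X N] by simp
  qed
qed

end

text \<open>\<open>HN_above T P t E\<close>: a filtration with decreasing phases above \<open>t\<close> exists, in which, unlike in
  \<open>HN_filtration\<close>, factors may be zero objects.\<close>

inductive HN_above :: "('o, 'm) tricat \<Rightarrow> (real \<Rightarrow> 'o set) \<Rightarrow> real \<Rightarrow> 'o \<Rightarrow> bool"
  for T :: "('o, 'm) tricat" and P :: "real \<Rightarrow> 'o set" where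
  zero: "is_zero_ob T E \<Longrightarrow> HN_above T P t E"
| step: "\<lbrakk>HN_above T P \<psi> F; tri T F E Q; Q \<in> P \<psi>; t < \<psi>\<rbrakk> \<Longrightarrow> HN_above T P t E"

lemma HN_filtration_phases:
  assumes "HN_filtration T P E n F Q \<phi>" "i < j" "j < n"
  shows "\<phi> j < \<phi> i"
proof -
  have "Suc (i + k) < n \<longrightarrow> \<phi> (Suc (i + k)) < \<phi> i" for k
  proof (induction k)
    case 0
    then show ?case using assms(1) by (simp add: HN_filtration_def)
  next
    case (Suc k)
    show ?case
    proof
      assume *: "Suc (i + Suc k) < n"
      then have "\<phi> (Suc (i + Suc k)) < \<phi> (i + Suc k)" using assms(1) by (simp add: HN_filtration_def)
      then show "\<phi> (Suc (i + Suc k)) < \<phi> i" using Suc.IH * by simp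
    qed
  qed
  from this[of "j - Suc i"] assms(2,3) show ?thesis by simp
qed

lemma HN_filtration_tri:
  assumes "HN_filtration T P E n F Q \<phi>" "j < n"
  shows "tri T (F j) (F (Suc j)) (Q j)" "Q j \<in> P (\<phi> j)" "\<not> is_zero_ob T (Q j)"
  using assms by (auto simp: HN_filtration_def tri_def)

lemma HN_filtration_HN_above:
  assumes "HN_filtration T P E n F Q \<phi>" "k \<le> n" "\<And>j. j < k \<Longrightarrow> t < \<phi> j"
  shows "HN_above T P t (F k)"
  using assms(2,3)
proof (induction k arbitrary: t)
  case 0
  then show ?case using assms(1) by (auto simp: HN_filtration_def intro: HN_above.zero)
next
  case (Suc k)
  then have k: "k < n" by simp
  have "HN_above T P (\<phi> k) (F k)"
    using Suc.IH Suc.prems HN_filtration_phases[OF assms(1) _ k] by simp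
  then show ?case
    using HN_filtration_tri[OF assms(1) k] Suc.prems(2)[of k] by (auto intro: HN_above.step)
qed

context triangulated_category
begin

text \<open>A step with zero factor is an isomorphism, so it is dropped and \<open>E\<close> takes
  the place of the last term; with no steps left, \<open>E\<close> is itself zero and becomes the
  whole filtration.\<close>

lemma HN_above_imp_HN_filtration:
  assumes "HN_above T P t E"
  shows "\<exists>n F Q \<phi>. HN_filtration T P E n F Q \<phi> \<and> (\<forall>j<n. t < \<phi> j)"
  using assms
proof (induction rule: HN_above.induct)
  case (zero E t)
  then have "HN_filtration T P E 0 (\<lambda>_. E) (\<lambda>_. E) (\<lambda>_. t)" by (simp add: HN_filtration_def)
  then show ?case by blast
next
  case (step \<psi> G E R t)
  then obtain n F Q \<phi> where H: "HN_filtration T P G n F Q \<phi>" "\<forall>j<n. \<psi> < \<phi> j" by blast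
  have tri: "j < n \<Longrightarrow> tri T (F j) (F (Suc j)) (Q j)" for j
    using HN_filtration_tri(1)[OF H(1)] .
  show ?case
  proof (cases "is_zero_ob T R")
    case True
    have iso: "iso_obs T G E" using tri_zero_cone_iso step.hyps(2) True by blast
    show ?thesis
    proof (cases n)
      case 0
      then have "is_zero_ob T E" using H(1) iso iso_zero_ob by (auto simp: HN_filtration_def)
      then have "HN_filtration T P E 0 (\<lambda>_. E) Q \<phi>" by (simp add: HN_filtration_def)
      then show ?thesis by blast
    next
      case (Suc m)
      have "tri T ((F(n := E)) j) ((F(n := E)) (Suc j)) (Q j)" if "j < n" for j
      proof (cases "Suc j = n")
        case True
        have "G = F (Suc j)" using H(1) True by (simp add: HN_filtration_def)
        then have "tri T (F j) E (Q j)"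
          using tri_iso[OF tri[OF that] iso_obs_refl _ iso_obs_refl, of E] iso triD[OF tri[OF that]]
          by simp
        then show ?thesis using True by auto
      next
        case False
        then show ?thesis using tri[OF that] that by simp
      qed
      then have "HN_filtration T P E n (F(n := E)) Q \<phi>"
        using H(1) Suc by (auto simp: HN_filtration_def tri_def)
      moreover have "\<forall>j<n. t < \<phi> j" using H(2) step.hyps(4) by force
      ultimately show ?thesis by blast
    qed
  next
    case False
    let ?F = "F(Suc n := E)" and ?Q = "Q(n := R)" and ?\<phi> = "\<phi>(n := \<psi>)"
    have "tri T (?F j) (?F (Suc j)) (?Q j)" if "j < Suc n" for j
      using tri[of j] step.hyps(2) H(1) that by (auto simp: HN_filtration_def less_Suc_eq)
    moreover have "Suc j < Suc n \<Longrightarrow> ?\<phi> (Suc j) < ?\<phi> j" for j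
      using H by (auto simp: HN_filtration_def)
    ultimately have "HN_filtration T P E (Suc n) ?F ?Q ?\<phi>"
      using H(1) step.hyps(3) False by (auto simp: HN_filtration_def tri_def less_Suc_eq)
    moreover have "\<forall>j<Suc n. t < ?\<phi> j" using H(2) step.hyps(4) by (force simp: less_Suc_eq)
    ultimately show ?thesis by blast
  qed
qed

end

section \<open>Orthogonality calculus for a single slicing\<close>

locale sliced_category = triangulated_category T for T :: "('o, 'm) tricat" +
  fixes P :: "real \<Rightarrow> 'o set"
  assumes slicing: "slicing T P"
begin

lemma P_Ob: "E \<in> P \<phi> \<Longrightarrow> E \<in> Ob T"
  using slicing unfolding slicing_def additive_subcat_def by blast

lemma P_iso: "E \<in> P \<phi> \<Longrightarrow> iso_obs T E E' \<Longrightarrow> E' \<in> P \<phi>"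
  using slicing unfolding slicing_def additive_subcat_def replete_def by blast

lemma P_zero:
  assumes "is_zero_ob T N" shows "N \<in> P \<phi>"
proof -
  obtain M where "M \<in> P \<phi>" "is_zero_ob T M"
    using slicing unfolding slicing_def additive_subcat_def by blast
  then show ?thesis using P_iso iso_obs_zero assms by blast
qed

lemma P_orth:
  assumes "X \<in> P \<phi>1" "Y \<in> P \<phi>2" "\<phi>2 < \<phi>1" shows "orth T X Y"
  using assms slicing orth_singleton[OF P_Ob P_Ob] unfolding slicing_def by blast

lemma P_Shift_eq: "P (\<phi> + 1) = Shift T ` P \<phi>"
  using slicing unfolding slicing_def by blast

lemma P_Shift: "X \<in> Ob T \<Longrightarrow> Shift T X \<in> P (\<phi> + 1) \<longleftrightarrow> X \<in> P \<phi>"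
  unfolding P_Shift_eq using Shift_inj P_Ob by blast

lemma HN_exists:
  assumes "E \<in> Ob T" obtains n F Q \<phi> where "HN_filtration T P E n F Q \<phi>"
proof (cases "is_zero_ob T E")
  case True
  then have "HN_filtration T P E 0 (\<lambda>_. E) (\<lambda>_. E) (\<lambda>_. 0)" by (simp add: HN_filtration_def)
  then show ?thesis by (rule that)
next
  case False
  then show ?thesis using slicing assms that unfolding slicing_def by blast
qed

lemma HN_above_exists:
  assumes "E \<in> Ob T" obtains t where "HN_above T P t E"
proof -
  obtain n F Q \<phi> where H: "HN_filtration T P E n F Q \<phi>" using HN_exists[OF assms] .
  \<comment> \<open>One below the least phase; the value for the empty filtration is
    arbitrary.\<close>
  define t where "t = (if n = 0 then 0 else Min (\<phi> ` {..<n}) - 1)"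
  have "t < \<phi> j" if "j < n" for j
  proof -
    have "Min (\<phi> ` {..<n}) \<le> \<phi> j" using that by (intro Min_le) auto
    moreover have "t = Min (\<phi> ` {..<n}) - 1" using that by (simp add: t_def)
    ultimately show ?thesis by linarith
  qed
  then have "HN_above T P t (F n)" using HN_filtration_HN_above[OF H] by blast
  then show thesis using that H by (simp add: HN_filtration_def)
qed

text \<open>\<open>lorth {..<b}\<close> plays the role of the objects with phases at least
  \<open>b\<close>, and \<open>rorth {b..}\<close> that of the objects with phases below
  \<open>b\<close>. Described by orthogonality instead of generators, both are visibly closed under
  extensions.\<close>

definition lorth :: "real set \<Rightarrow> 'o set" where
  "lorth U = {E \<in> Ob T. \<forall>\<psi>\<in>U. \<forall>Y\<in>P \<psi>. orth T E Y}"

definition rorth :: "real set \<Rightarrow> 'o set" where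
  "rorth U = {E \<in> Ob T. \<forall>\<psi>\<in>U. \<forall>Y\<in>P \<psi>. orth T Y E}"

lemma lorth_Ob: "E \<in> lorth U \<Longrightarrow> E \<in> Ob T" by (simp add: lorth_def)
lemma rorth_Ob: "E \<in> rorth U \<Longrightarrow> E \<in> Ob T" by (simp add: rorth_def)

lemma lorth_ext: "tri T X E Y \<Longrightarrow> X \<in> lorth U \<Longrightarrow> Y \<in> lorth U \<Longrightarrow> E \<in> lorth U"
  using triD orth_tri_left P_Ob by (fastforce simp: lorth_def)

lemma rorth_ext: "tri T X E Y \<Longrightarrow> X \<in> rorth U \<Longrightarrow> Y \<in> rorth U \<Longrightarrow> E \<in> rorth U"
  using triD orth_tri_right P_Ob by (fastforce simp: rorth_def)

lemma lorth_antimono: "U \<subseteq> V \<Longrightarrow> lorth V \<subseteq> lorth U" by (auto simp: lorth_def)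

lemma P_lorth: "\<forall>\<psi>\<in>U. \<psi> < \<phi> \<Longrightarrow> P \<phi> \<subseteq> lorth U"
  using P_Ob P_orth by (auto simp: lorth_def)

lemma P_rorth: "\<forall>\<psi>\<in>U. \<phi> < \<psi> \<Longrightarrow> P \<phi> \<subseteq> rorth U"
  using P_Ob P_orth by (auto simp: rorth_def)

lemma P_unshift:
  assumes "Y \<in> P \<psi>" obtains Y' where "Y' \<in> P (\<psi> - 1)" "Shift T Y' = Y"
  using assms P_Shift_eq[of "\<psi> - 1"] that by auto

lemma lorth_Shift:
  assumes "X \<in> lorth U" "\<And>\<psi>. \<psi> \<in> V \<Longrightarrow> \<psi> - 1 \<in> U"
  shows "Shift T X \<in> lorth V"
proof -
  have X: "X \<in> Ob T" using assms(1) lorth_Ob by blast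
  have "orth T (Shift T X) Y" if "\<psi> \<in> V" "Y \<in> P \<psi>" for \<psi> Y
  proof -
    obtain Y' where Y': "Y' \<in> P (\<psi> - 1)" "Shift T Y' = Y" using P_unshift \<open>Y \<in> P \<psi>\<close> by blast
    then have "orth T X Y'" using assms(1) assms(2)[OF that(1)] by (simp add: lorth_def)
    then show ?thesis using orth_Shift[OF X P_Ob[OF Y'(1)]] Y'(2) by simp
  qed
  then show ?thesis using X Shift_Ob by (simp add: lorth_def)
qed

lemma rorth_unshift:
  assumes "Shift T X \<in> rorth U" "X \<in> Ob T" "\<And>\<psi>. \<psi> \<in> V \<Longrightarrow> \<psi> + 1 \<in> U"
  shows "X \<in> rorth V"
proof -
  have "orth T Y X" if "\<psi> \<in> V" "Y \<in> P \<psi>" for \<psi> Y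
  proof -
    have "Shift T Y \<in> P (\<psi> + 1)" using P_Shift[OF P_Ob] that(2) by blast
    then have "orth T (Shift T Y) (Shift T X)" using assms(1) assms(3)[OF that(1)] by (simp add: rorth_def)
    then show ?thesis using orth_Shift[OF P_Ob[OF that(2)] assms(2)] by simp
  qed
  then show ?thesis using assms by (simp add: rorth_def)
qed

text \<open>In the triangle Q j[-1] -> F j -> F (j + 1) the first term receives no map from
  \<open>Q 0\<close>, for reasons of phase. So vanishing of Hom(Q 0, E) would descend to
  \<open>F 1\<close>, which is isomorphic to the nonzero \<open>Q 0\<close>. All terms are shifted
  by one to avoid [-1].\<close>

lemma HN_first_not_orth:
  assumes H: "HN_filtration T P E n F Q \<phi>" and n: "0 < n"
  shows "\<not> orth T (Q 0) E"
proof
  assume o: "orth T (Q 0) E"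
  note t = HN_filtration_tri[OF H]
  have Q0: "Q 0 \<in> Ob T" using t(2)[OF n] P_Ob by blast
  have "orth T (Q 0) (F (n - k))" if "k < n" for k
    using that
  proof (induction k)
    case 0
    then show ?case using o H by (simp add: HN_filtration_def)
  next
    case (Suc k)
    define j where "j = n - Suc k"
    have j: "j < n" "0 < j" "Suc j = n - k" using Suc.prems by (auto simp: j_def)
    have O: "F j \<in> Ob T" "F (Suc j) \<in> Ob T" using triD[OF t(1)[OF j(1)]] by auto
    have "orth T (Shift T (Q 0)) (Q j)"
    proof (rule P_orth)
      show "Shift T (Q 0) \<in> P (\<phi> 0 + 1)" using P_Shift Q0 t(2)[OF n] by blast
      show "\<phi> j < \<phi> 0 + 1" using HN_filtration_phases[OF H j(2,1)] by simp
    qed (use t(2)[OF j(1)] in blast)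
    moreover have "orth T (Shift T (Q 0)) (Shift T (F (Suc j)))"
      using orth_Shift[OF Q0 O(2)] Suc j(3) by simp
    ultimately have "orth T (Shift T (Q 0)) (Shift T (F j))"
      using orth_tri_right[OF tri_rotate[OF tri_rotate[OF t(1)[OF j(1)]]]] Shift_Ob[OF Q0] by blast
    then show ?case using orth_Shift[OF Q0 O(1)] j_def by simp
  qed
  from this[of "n - 1"] n have o1: "orth T (Q 0) (F (Suc 0))" by simp
  have "iso_obs T (F (Suc 0)) (Q 0)"
    using tri_zero_cocone_iso t(1)[OF n] H by (simp add: HN_filtration_def)
  then have "orth T (Q 0) (Q 0)"
    using o1 orth_tri_right[OF tri_iso[OF tri_zero_right] Q0, of "F (Suc 0)"]
      zero_ob_orth_right[OF _ Q0] zero_ob_exists iso_obs_refl zero_ob_Ob triD[OF t(1)[OF n]] by metis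
  then show False using orth_self_zero_ob Q0 t(3)[OF n] by blast
qed

text \<open>With Q the last factor, F (n - 1)[1] is built from factors of larger phase and has no
  map to Q. If \<open>E\<close> had none either, the triangle E -> Q -> F (n - 1)[1] would kill the
  identity of Q.\<close>

lemma HN_last_not_orth:
  assumes H: "HN_filtration T P E n F Q \<phi>" and n: "0 < n"
  shows "\<not> orth T E (Q (n - 1))"
proof
  assume o: "orth T E (Q (n - 1))"
  note t = HN_filtration_tri[OF H]
  define m where "m = n - 1"
  have m: "m < n" "Suc m = n" using n by (auto simp: m_def)
  have Qm: "Q m \<in> Ob T" using t(2)[OF m(1)] P_Ob by blast
  have "orth T (Shift T (F k)) (Q m)" if "k \<le> m" for k
    using that
  proof (induction k)
    case 0
    have "is_zero_ob T (F 0)" using H by (simp add: HN_filtration_def)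
    then show ?case using zero_ob_orth_left zero_ob_Shift zero_ob_Ob Qm by blast
  next
    case (Suc k)
    then have k: "k < n" using m by simp
    have O: "Q k \<in> Ob T" using triD[OF t(1)[OF k]] by auto
    have "orth T (Shift T (Q k)) (Q m)"
    proof (rule P_orth)
      show "Shift T (Q k) \<in> P (\<phi> k + 1)" using P_Shift O t(2)[OF k] by blast
      show "\<phi> m < \<phi> k + 1" using HN_filtration_phases[OF H, of k m] m Suc by simp
    qed (use t(2)[OF m(1)] in blast)
    moreover have "tri T (Shift T (F k)) (Shift T (F (Suc k))) (Shift T (Q k))"
      using tri_Shift t(1)[OF k] triD by blast
    ultimately show ?case using orth_tri_left Suc Qm by auto
  qed
  then have "orth T (Shift T (F m)) (Q m)" by simp
  moreover have "F (Suc m) = E" using H m by (simp add: HN_filtration_def)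
  ultimately have "orth T (Q m) (Q m)"
    using orth_tri_left[OF tri_rotate[OF t(1)[OF m(1)]] Qm] o m_def by simp
  then show False using orth_self_zero_ob Qm t(3)[OF m(1)] by blast
qed

lemma HN_rorth:
  assumes "HN_filtration T P E n F Q \<phi>" "0 < n" "E \<in> rorth U" shows "\<phi> 0 \<notin> U"
  using HN_first_not_orth[OF assms(1,2)] HN_filtration_tri(2)[OF assms(1,2)] assms(3)
  by (auto simp: rorth_def)

lemma HN_lorth:
  assumes "HN_filtration T P E n F Q \<phi>" "0 < n" "E \<in> lorth U" shows "\<phi> (n - 1) \<notin> U"
  using HN_last_not_orth[OF assms(1,2)] HN_filtration_tri(2)[OF assms(1), of "n - 1"] assms(2,3)
  by (auto simp: lorth_def)

lemma HN_filtration_phase_bounds: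
  assumes "HN_filtration T P E n F Q \<phi>" "j < n"
  shows "\<phi> j \<le> \<phi> 0" "\<phi> (n - 1) \<le> \<phi> j"
proof -
  show "\<phi> j \<le> \<phi> 0" using HN_filtration_phases[OF assms(1), of 0 j] assms(2) by (cases "j = 0") auto
  have "j = n - 1 \<or> j < n - 1" using assms(2) by linarith
  then show "\<phi> (n - 1) \<le> \<phi> j" using HN_filtration_phases[OF assms(1), of j "n - 1"] assms(2) by auto
qed

text \<open>Orthogonality to the slices on either side of \<psi> bounds the first phase from above
  and the last from below. Hence the \<open>THE\<close> in \<open>phi_plus\<close> and
  \<open>phi_minus\<close> is well defined on semistable objects.\<close>

lemma P_nonzero_HN:
  assumes E: "E \<in> P \<psi>" "\<not> is_zero_ob T E" and H: "HN_filtration T P E n F Q \<phi>"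
  shows "0 < n" "\<phi> 0 = \<psi>" "\<phi> (n - 1) = \<psi>"
proof -
  show n: "0 < n" using E(2) H by (auto simp: HN_filtration_def intro: gr0I)
  have "\<phi> 0 \<notin> {\<psi><..}" using HN_rorth[OF H n] P_rorth[of "{\<psi><..}" \<psi>] E by auto
  moreover have "\<phi> (n - 1) \<notin> {..<\<psi>}" using HN_lorth[OF H n] P_lorth[of "{..<\<psi>}" \<psi>] E by auto
  ultimately show "\<phi> 0 = \<psi>" "\<phi> (n - 1) = \<psi>"
    using HN_filtration_phase_bounds(2)[OF H n] by auto
qed

lemma phi_plus_P: "E \<in> P \<psi> \<Longrightarrow> \<not> is_zero_ob T E \<Longrightarrow> phi_plus T P E = \<psi>"
  unfolding phi_plus_def using P_nonzero_HN HN_exists P_Ob by (intro the_equality) metis+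

lemma phi_minus_P: "E \<in> P \<psi> \<Longrightarrow> \<not> is_zero_ob T E \<Longrightarrow> phi_minus T P E = \<psi>"
  unfolding phi_minus_def using P_nonzero_HN HN_exists P_Ob by (intro the_equality) metis+

text \<open>The first phase is at most \<psi> and the last at least \<psi>, so there is a single
  factor. As both conditions are stable under extensions, \<open>P_ext\<close> follows.\<close>

lemma P_intro:
  assumes "E \<in> lorth {..<\<psi>}" "E \<in> rorth {\<psi><..}"
  shows "E \<in> P \<psi>"
proof (cases "is_zero_ob T E")
  case False
  obtain n F Q \<phi> where H: "HN_filtration T P E n F Q \<phi>" using HN_exists lorth_Ob assms by metis
  have n: "0 < n" using False H by (auto simp: HN_filtration_def intro: gr0I)
  have b: "\<phi> 0 \<le> \<psi>" "\<psi> \<le> \<phi> (n - 1)" using HN_rorth[OF H n assms(2)] HN_lorth[OF H n assms(1)] by auto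
  have n1: "n = 1"
  proof (rule ccontr)
    assume "n \<noteq> 1"
    then have "\<phi> (n - 1) < \<phi> 0" using n HN_filtration_phases[OF H, of 0 "n - 1"] by simp
    with b show False by simp
  qed
  then have "\<phi> 0 = \<psi>" using b by simp
  have "iso_obs T (F (Suc 0)) (Q 0)"
    using tri_zero_cocone_iso HN_filtration_tri(1)[OF H n] H by (simp add: HN_filtration_def)
  then have "iso_obs T (Q 0) E" using H n1 iso_obs_sym by (simp add: HN_filtration_def)
  then show ?thesis using P_iso HN_filtration_tri(2)[OF H n] \<open>\<phi> 0 = \<psi>\<close> by blast
qed (simp add: P_zero)

lemma P_ext: "tri T X E Y \<Longrightarrow> X \<in> P \<psi> \<Longrightarrow> Y \<in> P \<psi> \<Longrightarrow> E \<in> P \<psi>"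
  by (rule P_intro; erule lorth_ext rorth_ext)
    (use P_lorth[of "{..<\<psi>}" \<psi>] P_rorth[of "{\<psi><..}" \<psi>] in auto)

text \<open>The orthogonality conditions confine all phases of a filtration to the interval, and the
  filtration then exhibits the object as an iterated extension. The right-hand side is the form in
  which membership is checked later.\<close>

lemma P_interval_eq:
  assumes "a < b"
  shows "P_interval T P {a<..<b} = lorth {..a} \<inter> rorth {b..}"
proof (intro equalityI subsetI)
  fix E assume "E \<in> P_interval T P {a<..<b}"
  then show "E \<in> lorth {..a} \<inter> rorth {b..}" unfolding P_interval_def
  proof (induction rule: ext_closure.induct)
    case (base X)
    then obtain \<phi> where "a < \<phi>" "\<phi> < b" "X \<in> P \<phi>" by auto
    then show ?case using P_lorth[of "{..a}" \<phi>] P_rorth[of "{b..}" \<phi>] by auto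
  next
    case (ext X Y E f g h)
    then show ?case using lorth_ext[OF triI[OF ext.hyps(3)]] rorth_ext[OF triI[OF ext.hyps(3)]] by simp
  qed
next
  fix E assume E: "E \<in> lorth {..a} \<inter> rorth {b..}"
  then obtain n F Q \<phi> where H: "HN_filtration T P E n F Q \<phi>" using HN_exists lorth_Ob by blast
  have "F k \<in> P_interval T P {a<..<b}" if "k \<le> n" for k
    using that
  proof (induction k)
    case 0
    \<comment> \<open>A zero object lies in every slice; the midpoint names one inside the interval,
      so that the closure has a generator to start from.\<close>
    have "F 0 \<in> P ((a + b) / 2)" using H P_zero by (simp add: HN_filtration_def)
    moreover have "a < (a + b) / 2" "(a + b) / 2 < b" using assms by auto
    ultimately show ?case unfolding P_interval_def by (intro ext_closure.base) auto
  next
    case (Suc k)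
    then have k: "k < n" by simp
    then have "0 < n" by simp
    have "\<phi> 0 < b" "a < \<phi> (n - 1)"
      using HN_rorth[OF H \<open>0 < n\<close>, of "{b..}"] HN_lorth[OF H \<open>0 < n\<close>, of "{..a}"] E by simp_all
    then have "\<phi> k \<in> {a<..<b}" using HN_filtration_phase_bounds[OF H k] by simp
    then have "Q k \<in> (\<Union>\<phi>\<in>{a<..<b}. P \<phi>)" using HN_filtration_tri(2)[OF H k] by blast
    then have "Q k \<in> P_interval T P {a<..<b}" unfolding P_interval_def by (rule ext_closure.base)
    then show ?case
      using Suc HN_filtration_tri(1)[OF H k] unfolding P_interval_def tri_def by (auto intro: ext_closure.ext)
  qed
  then show "E \<in> P_interval T P {a<..<b}" using H by (auto simp: HN_filtration_def)
qed

lemma truncation: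
  assumes "E \<in> Ob T"
  shows "\<exists>W1 W2. tri T W1 E W2 \<and> W1 \<in> lorth {..<b} \<and> W2 \<in> rorth {b..}"
proof -
  have zl: "N \<in> lorth U" and zr: "N \<in> rorth U" if "is_zero_ob T N" for N U
    using that zero_ob_Ob zero_ob_orth_left zero_ob_orth_right P_Ob by (auto simp: lorth_def rorth_def)
  obtain t where "HN_above T P t E" using HN_above_exists assms .
  \<comment> \<open>The added clause serves the induction: if \<open>b\<close> is at most the last
    phase, nothing is cut off; otherwise the last factor belongs to the lower part and is absorbed
    into \<open>W2\<close> by associativity.\<close>
  then have "(b \<le> t \<longrightarrow> E \<in> lorth {..<b}) \<and> ?thesis"
  proof (induction rule: HN_above.induct)
    case (zero E t)
    then show ?case using zl zr tri_zero_left zero_ob_Ob by blast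
  next
    case (step \<psi> F E Q t)
    obtain N where N: "is_zero_ob T N" using zero_ob_exists by blast
    have O: "E \<in> Ob T" using triD step by blast
    show ?case
    proof (cases "b \<le> \<psi>")
      case True
      then have "Q \<in> lorth {..<b}" using P_lorth[of "{..<b}" \<psi>] step.hyps(3) by auto
      then have "E \<in> lorth {..<b}" using lorth_ext[OF step.hyps(2)] step.IH True by blast
      then show ?thesis using tri_zero_right[OF O N] zr[OF N] by blast
    next
      case False
      then have Q: "Q \<in> rorth {b..}" using P_rorth[of "{b..}" \<psi>] step by force
      obtain W1 W2 where W: "tri T W1 F W2" "W1 \<in> lorth {..<b}" "W2 \<in> rorth {b..}"
        using step.IH by blast
      obtain V where "tri T W1 E V" "tri T W2 V Q" using tri_assoc1[OF W(1) step.hyps(2)] by blast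
      moreover from this have "V \<in> rorth {b..}" using rorth_ext W(3) Q by blast
      ultimately show ?thesis using W(2) False step.hyps(4) by (intro conjI) (simp, blast)
    qed
  qed
  then show ?thesis by blast
qed

text \<open>\<open>lorth\<close> controls only maps into semistable objects; the filtration of
  \<open>L\<close>, whose phases are all below \<open>b\<close>, extends this to
  \<open>L\<close>.\<close>

lemma lorth_rorth_orth:
  assumes "G \<in> lorth {..<b}" "L \<in> rorth {b..}"
  shows "orth T G L"
proof -
  obtain n F Q \<phi> where H: "HN_filtration T P L n F Q \<phi>" using HN_exists rorth_Ob assms by metis
  have G: "G \<in> Ob T" using assms lorth_Ob by blast
  have "orth T G (F k)" if "k \<le> n" for k
    using that
  proof (induction k)
    case 0
    then show ?case using H zero_ob_orth_right G by (simp add: HN_filtration_def)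
  next
    case (Suc k)
    then have k: "k < n" "0 < n" by auto
    have "\<phi> k < b"
      using HN_rorth[OF H k(2) assms(2)] HN_filtration_phase_bounds(1)[OF H k(1)] by simp
    then have "orth T G (Q k)" using HN_filtration_tri(2)[OF H k(1)] assms(1) by (auto simp: lorth_def)
    then show ?case using orth_tri_right[OF HN_filtration_tri(1)[OF H k(1)] G] Suc by simp
  qed
  then show ?thesis using H by (auto simp: HN_filtration_def)
qed

end

section \<open>The glued slicing\<close>

context triangulated_category
begin

text \<open>The cone \<open>C\<close> of \<open>i1\<close> is identified with \<open>Y\<close>:
  \<open>p2\<close> factors through \<open>C\<close> by \<open>r\<close>, and the inverse of
  \<open>r\<close> is \<open>i2\<close> followed by \<open>q\<close>.\<close>

lemma biproduct_tri:
  assumes "is_biproduct T X Y W"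
  shows "tri T X W Y"
proof -
  obtain i1 i2 p1 p2 where O: "X \<in> Ob T" "Y \<in> Ob T" "W \<in> Ob T"
    and m: "i1 \<in> homs T X W" "i2 \<in> homs T Y W" "p1 \<in> homs T W X" "p2 \<in> homs T W Y"
    and e: "p1 \<star> i1 = Idm T X" "p2 \<star> i2 = Idm T Y" "p2 \<star> i1 = zero_mor T X Y"
      "i1 \<star> p1 \<otimes>\<^bsub>Hom T W W\<^esub> i2 \<star> p2 = Idm T W"
    using assms unfolding is_biproduct_def by blast
  obtain C q h where C: "Tri T X W C i1 q h" using Tri_cone[OF O(1,3) m(1)] by blast
  note d = TriD[OF C]
  note S = Shift_Ob[OF O(1)] Shift_Ob[OF O(3)]
  have qi: "q \<star> i1 = zero_mor T X C" by (rule Tri_comp_zero[OF C])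
  obtain r where r: "r \<in> homs T C Y" "r \<star> q = p2" using Tri_lift_cone[OF C O(2) m(4) e(3)] .
  define s where "s = q \<star> i2"
  have s: "s \<in> homs T Y C" unfolding s_def by (rule Comp_in[OF O(2,3) d(3) m(2) d(5)])
  have rs: "r \<star> s = Idm T Y"
    unfolding s_def using Comp_assoc[OF O(2,3) d(3) O(2) m(2) d(5) r(1)] r(2) e(2) by simp
  \<comment> \<open>The composite of \<open>h\<close> with the shift of \<open>i1\<close> is zero,
    and \<open>i1\<close> has a left inverse. Vanishing of \<open>h\<close> is what makes
    \<open>q\<close> cancellable on the right below.\<close>
  have h0: "h = zero_mor T C (Shift T X)"
  proof -
    note Mi = ShiftM_in[OF O(1,3) m(1)]
    note Mp = ShiftM_in[OF O(3,1) m(3)]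
    have "inv\<^bsub>Hom T (Shift T X) (Shift T W)\<^esub> (ShiftM T i1) \<star> h = zero_mor T C (Shift T W)"
      by (rule Tri_comp_zero[OF Tri_rotate1[OF Tri_rotate1[OF C]]])
    then have "inv\<^bsub>Hom T C (Shift T W)\<^esub> (ShiftM T i1 \<star> h) = zero_mor T C (Shift T W)"
      using comp_neg_left[OF d(3) S d(6) Mi] by simp
    then have "ShiftM T i1 \<star> h = zero_mor T C (Shift T W)"
      using neg_neg[OF d(3) S(2) Comp_in[OF d(3) S d(6) Mi]] neg_zero[OF d(3) S(2)] by simp
    then have "ShiftM T p1 \<star> ShiftM T i1 \<star> h = zero_mor T C (Shift T X)"
      using comp_zero_right[OF d(3) S(2,1) Mp] by simp
    then have "(ShiftM T p1 \<star> ShiftM T i1) \<star> h = zero_mor T C (Shift T X)"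
      using Comp_assoc[OF d(3) S S(1) d(6) Mi Mp] by simp
    then show ?thesis
      using ShiftM_Comp[OF O(1,3,1) m(1,3)] e(1) ShiftM_Idm[OF O(1)] Comp_Idm_left[OF d(3) S(1) d(6)]
      by simp
  qed
  \<comment> \<open>After composition with \<open>q\<close> both sides become \<open>q\<close>: the
    decomposition of the identity of \<open>W\<close> is inserted, and its first summand is killed
    by \<open>q\<close>.\<close>
  have sr: "s \<star> r = Idm T C"
  proof (rule right_cancel[OF d(2,3,3) d(5)])
    show "s \<star> r \<in> homs T C C" by (rule Comp_in[OF d(3) O(2) d(3) r(1) s])
    show "Idm T C \<in> homs T C C" by (rule Idm_in[OF d(3)])
    interpret h: group_hom "Hom T W W" "Hom T W C" "\<lambda>f. q \<star> f"
      by (rule comp_right_group_hom[OF d(2,2,3,5)])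
    have c: "i1 \<star> p1 \<in> homs T W W" "i2 \<star> p2 \<in> homs T W W"
      using Comp_in[OF O(3,1,3) m(3,1)] Comp_in[OF O(3,2,3) m(4,2)] by auto
    have "q \<star> i1 \<star> p1 = zero_mor T W C"
      using Comp_assoc[OF O(3,1,3) d(3) m(3,1) d(5)] qi comp_zero_left[OF O(3,1) d(3) m(3)] by simp
    moreover have "q \<star> (i1 \<star> p1 \<otimes>\<^bsub>Hom T W W\<^esub> i2 \<star> p2) = q \<star> i1 \<star> p1 \<otimes>\<^bsub>Hom T W C\<^esub> q \<star> i2 \<star> p2"
      using c by (intro h.hom_mult) (auto simp: homs_def)
    moreover have "q \<star> i2 \<star> p2 \<in> carrier (Hom T W C)"
      using Comp_in[OF O(3,3) d(3) c(2) d(5)] by (simp add: homs_def)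
    ultimately have "q \<star> i2 \<star> p2 = q"
      using e(4) Comp_Idm_right[OF d(2,3,5)] by (simp add: zero_mor_def)
    moreover have "(s \<star> r) \<star> q = q \<star> i2 \<star> p2"
      unfolding s_def using Comp_assoc[OF O(3) d(3) O(2) d(3) d(5) r(1) s] r(2)
        Comp_assoc[OF O(3,2,3) d(3) m(4,2) d(5)] s_def by simp
    ultimately show "(s \<star> r) \<star> q = Idm T C \<star> q" using Comp_Idm_left[OF d(2,3,5)] by simp
  next
    fix u assume u: "u \<in> homs T C C" "u \<star> q = zero_mor T W C"
    obtain v where "v \<in> homs T (Shift T X) C" "v \<star> h = u"
      using Tri_lift_cone[OF Tri_rotate1[OF C] d(3) u] .
    then show "u = zero_mor T C C" using h0 comp_zero_right[OF d(3) S(1) d(3)] by simp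
  qed
  have "iso_obs T C Y" unfolding iso_obs_def is_iso_mor_def using d(3) O(2) r(1) s rs sr by blast
  then show ?thesis by (rule tri_iso[OF triI[OF C] iso_obs_refl[OF O(1)] iso_obs_refl[OF O(3)]])
qed

lemma shift_int_0 [simp]: "shift_int T 0 X = X"
  by (simp add: shift_int_def)

lemma shift_int_Ob:
  assumes "X \<in> Ob T" shows "shift_int T i X \<in> Ob T"
proof -
  have "(Shift T ^^ n) X \<in> Ob T" for n using Shift_Ob assms by (induction n) auto
  moreover have "(inv_into (Ob T) (Shift T) ^^ n) X \<in> Ob T" for n
    using assms bij_betw_imp_surj_on[OF Shift_bij] by (induction n) (auto intro!: inv_into_into)
  ultimately show ?thesis by (simp add: shift_int_def)
qed

lemma shift_int_succ:
  assumes "X \<in> Ob T" shows "shift_int T (i + 1) X = Shift T (shift_int T i X)"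
proof (cases "i \<ge> 0")
  case True
  then show ?thesis by (simp add: shift_int_def nat_add_distrib)
next
  case False
  let ?s = "inv_into (Ob T) (Shift T)"
  \<comment> \<open>\<open>n\<close> belongs to \<open>i + 1\<close>, so that \<open>i = -1\<close>
    gives \<open>n = 0\<close>, where both branches of \<open>shift_int\<close> are the
    identity.\<close>
  define n where "n = nat (- (i + 1))"
  have n: "nat (- i) = Suc n" using False by (simp add: n_def)
  have e: "shift_int T (i + 1) X = (?s ^^ n) X"
    using False by (cases "i + 1 = 0") (simp_all add: shift_int_def n_def)
  then have "(?s ^^ n) X \<in> Shift T ` Ob T"
    using shift_int_Ob[OF assms, of "i + 1"] bij_betw_imp_surj_on[OF Shift_bij] by simp
  then have "Shift T (?s ((?s ^^ n) X)) = (?s ^^ n) X" by (rule f_inv_into_f)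
  then show ?thesis using False e n by (simp add: shift_int_def)
qed

lemma orth_shift_int:
  assumes "X \<in> Ob T" "Y \<in> Ob T"
  shows "orth T (shift_int T i X) (shift_int T (i + k) Y) \<longleftrightarrow> orth T X (shift_int T k Y)"
proof (induction i rule: int_induct[where k = 0])
  case base
  show ?case by simp
next
  case (step1 i)
  have "shift_int T (i + 1 + k) Y = Shift T (shift_int T (i + k) Y)"
    using shift_int_succ[OF assms(2), of "i + k"] by (simp add: algebra_simps)
  then show ?case
    using step1 shift_int_succ[OF assms(1)] orth_Shift[OF shift_int_Ob shift_int_Ob, OF assms] by simp
next
  case (step2 i)
  have "shift_int T (i + k) Y = Shift T (shift_int T (i - 1 + k) Y)"
    using shift_int_succ[OF assms(2), of "i - 1 + k"] by simp
  moreover have "shift_int T i X = Shift T (shift_int T (i - 1) X)"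
    using shift_int_succ[OF assms(1), of "i - 1"] by simp
  ultimately show ?case
    using step2 orth_Shift[OF shift_int_Ob shift_int_Ob, OF assms] by simp
qed

lemma shift_int_slices:
  assumes "\<And>\<phi>. P \<phi> \<subseteq> Ob T" "\<And>\<phi>. P (\<phi> + 1) = Shift T ` P \<phi>"
  shows "P (\<phi> + of_int k) = shift_int T k ` P (\<phi> :: real)"
proof (induction k rule: int_induct[where k = 0])
  case base
  show ?case by simp
next
  case (step1 i)
  have "P (\<phi> + of_int (i + 1)) = Shift T ` shift_int T i ` P \<phi>"
    using assms(2)[of "\<phi> + of_int i"] step1 by (simp add: add.assoc)
  also have "\<dots> = shift_int T (i + 1) ` P \<phi>"
    unfolding image_image using shift_int_succ assms(1) by (intro image_cong) (auto simp: subset_iff)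
  finally show ?case .
next
  case (step2 i)
  have "Shift T ` P (\<phi> + of_int (i - 1)) = shift_int T i ` P \<phi>"
    using assms(2)[of "\<phi> + of_int (i - 1)"] step2 by simp
  also have "\<dots> = Shift T ` shift_int T (i - 1) ` P \<phi>"
    unfolding image_image using shift_int_succ[of _ "i - 1"] assms(1)
    by (intro image_cong) (auto simp: subset_iff)
  finally have "Shift T ` P (\<phi> + of_int (i - 1)) = Shift T ` shift_int T (i - 1) ` P \<phi>" .
  moreover have "P (\<phi> + of_int (i - 1)) \<subseteq> Ob T" "shift_int T (i - 1) ` P \<phi> \<subseteq> Ob T"
    using assms(1) shift_int_Ob by blast+
  ultimately show ?case using inj_on_image_eq_iff[OF bij_betw_imp_inj_on[OF Shift_bij]] by blast
qed

text \<open>The definition provides closure under cones and shifts; two rotations exhibit E[1] as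
  the cone of a map Y -> X[1].\<close>

lemma triangulated_subcat_ext:
  assumes S: "triangulated_subcat T S" and t: "tri T X E Y" and XY: "X \<in> S" "Y \<in> S"
  shows "E \<in> S"
proof -
  note O = triD[OF t]
  have sh: "Shift T X \<in> S \<longleftrightarrow> X \<in> S" if "X \<in> Ob T" for X
    using S that unfolding triangulated_subcat_def by blast
  have cone: "Z \<in> S" if "X \<in> S" "Y \<in> S" "Tri T X Y Z f g h" for X Y Z f g h
    using S that unfolding triangulated_subcat_def by blast
  obtain f g h where "Tri T Y (Shift T X) (Shift T E) f g h"
    using tri_rotate[OF tri_rotate[OF t]] tri_def by metis
  then have "Shift T E \<in> S" using cone sh XY O by blast
  then show ?thesis using sh O by blast
qed

end

section \<open>Decomposition triangles and their exchange\<close>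

locale semiorthogonal = triangulated_category D for D :: "('o, 'm) tricat" +
  fixes \<A> \<B> :: "'o set"
  assumes sod: "semiorthogonal_decomposition D \<A> \<B>"
begin

lemma subcat_A: "triangulated_subcat D \<A>" and subcat_B: "triangulated_subcat D \<B>"
  using sod by (simp_all add: semiorthogonal_decomposition_def)

lemma subcat_A_Ob: "\<A> \<subseteq> Ob D" and subcat_B_Ob: "\<B> \<subseteq> Ob D"
  using subcat_A subcat_B by (auto simp: triangulated_subcat_def additive_subcat_def)

lemma BA_orth: "Y \<in> \<B> \<Longrightarrow> X \<in> \<A> \<Longrightarrow> orth D Y X"
  using sod by (auto simp: semiorthogonal_decomposition_def orth_def)

lemma decomposition:
  assumes "E \<in> Ob D" obtains Y X where "Y \<in> \<B>" "X \<in> \<A>" "tri D Y E X"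
  using sod assms unfolding semiorthogonal_decomposition_def tri_def by metis

lemma Shift_A: "X \<in> \<A> \<Longrightarrow> Shift D X \<in> \<A>"
  using subcat_A subcat_A_Ob unfolding triangulated_subcat_def by (metis subsetD)

lemma zero_ob_A: "is_zero_ob D N \<Longrightarrow> N \<in> \<A>" and zero_ob_B: "is_zero_ob D N \<Longrightarrow> N \<in> \<B>"
proof -
  assume N: "is_zero_ob D N"
  obtain M where "M \<in> \<A>" "is_zero_ob D M"
    using subcat_A unfolding triangulated_subcat_def additive_subcat_def by blast
  moreover obtain M' where "M' \<in> \<B>" "is_zero_ob D M'"
    using subcat_B unfolding triangulated_subcat_def additive_subcat_def by blast
  moreover have "replete D \<A>" "replete D \<B>"
    using subcat_A subcat_B by (simp_all add: triangulated_subcat_def additive_subcat_def)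
  ultimately show "N \<in> \<A>" "N \<in> \<B>"
    using iso_obs_zero[OF _ N] unfolding replete_def by metis+
qed

text \<open>\<open>E\<close> is a successive extension of \<open>Y1\<close>, \<open>X1\<close>,
  \<open>Y2\<close>, \<open>X2\<close>. Since Hom(Y2, X1[1]) = 0, the middle two change places,
  after which the terms from \<B> and those from \<A> can be bracketed separately.\<close>

lemma decomposition_ext:
  assumes "tri D Y1 E1 X1" "tri D Y2 E2 X2" "tri D E1 E E2" "X1 \<in> \<A>" "Y2 \<in> \<B>"
  shows "\<exists>Y X. tri D Y1 Y Y2 \<and> tri D X1 X X2 \<and> tri D Y E X"
proof -
  obtain U where U: "tri D Y1 E U" "tri D X1 U E2" using tri_assoc1[OF assms(1,3)] by blast
  obtain V where V: "tri D X1 V Y2" "tri D V U X2" using tri_assoc2[OF U(2) assms(2)] by blast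
  have "tri D Y2 V X1" using tri_swap[OF V(1)] BA_orth assms(4,5) Shift_A by blast
  then obtain X where X: "tri D Y2 U X" "tri D X1 X X2" using tri_assoc1[OF _ V(2)] by blast
  obtain Y where "tri D Y1 Y Y2" "tri D Y E X" using tri_assoc2[OF U(1) X(1)] by blast
  with X show ?thesis by blast
qed

end

text \<open>The last two assumptions are the form in which the hypotheses of the theorem are used;
  \<open>cross_orthogonality\<close> derives them.\<close>

locale glued_slicings = semiorthogonal D \<A> \<B> for D :: "('o, 'm) tricat" and \<A> \<B> +
  fixes PA PB :: "real \<Rightarrow> 'o set"
  assumes slicing_A: "slicing (full_subcat D \<A>) PA"
    and slicing_B: "slicing (full_subcat D \<B>) PB"
    and cross_orth: "\<lbrakk>X \<in> PA \<phi>; Y \<in> PB \<psi>; \<psi> < \<phi>\<rbrakk> \<Longrightarrow> orth D X Y"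
    and cross_orth_Shift: "\<lbrakk>X \<in> PA \<phi>; Y \<in> PB \<psi>; \<psi> < \<phi>\<rbrakk> \<Longrightarrow> orth D X (Shift D Y)"
begin

sublocale A: sliced_category "full_subcat D \<A>" PA
  using triangulated_full_subcat[OF subcat_A] slicing_A
  by (simp add: sliced_category_def sliced_category_axioms_def)

sublocale B: sliced_category "full_subcat D \<B>" PB
  using triangulated_full_subcat[OF subcat_B] slicing_B
  by (simp add: sliced_category_def sliced_category_axioms_def)

lemma PA_in: "X \<in> PA \<phi> \<Longrightarrow> X \<in> \<A> \<and> X \<in> Ob D" using A.P_Ob by auto
lemma PB_in: "X \<in> PB \<phi> \<Longrightarrow> X \<in> \<B> \<and> X \<in> Ob D" using B.P_Ob by auto

lemma PA_ext: "tri D X E Y \<Longrightarrow> X \<in> PA \<phi> \<Longrightarrow> Y \<in> PA \<phi> \<Longrightarrow> E \<in> PA \<phi>"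
  using A.P_ext[of X E Y] triangulated_subcat_ext[OF subcat_A, of X E Y] PA_in by simp

lemma PB_ext: "tri D X E Y \<Longrightarrow> X \<in> PB \<phi> \<Longrightarrow> Y \<in> PB \<phi> \<Longrightarrow> E \<in> PB \<phi>"
  using B.P_ext[of X E Y] triangulated_subcat_ext[OF subcat_B, of X E Y] PB_in by simp

lemma zero_PA: "is_zero_ob D N \<Longrightarrow> N \<in> PA \<phi>" and zero_PB: "is_zero_ob D N \<Longrightarrow> N \<in> PB \<phi>"
  using A.P_zero B.P_zero zero_ob_A zero_ob_B by simp_all

definition PD :: "real \<Rightarrow> 'o set" where
  "PD \<phi> = {E. \<exists>Y\<in>PB \<phi>. \<exists>X\<in>PA \<phi>. tri D Y E X}"

lemma PDI: "Y \<in> PB \<phi> \<Longrightarrow> X \<in> PA \<phi> \<Longrightarrow> tri D Y E X \<Longrightarrow> E \<in> PD \<phi>"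
  by (auto simp: PD_def)

lemma PDE:
  assumes "E \<in> PD \<phi>" obtains Y X where "Y \<in> PB \<phi>" "X \<in> PA \<phi>" "tri D Y E X"
  using assms by (auto simp: PD_def)

lemma PD_Ob: "E \<in> PD \<phi> \<Longrightarrow> E \<in> Ob D"
  using triD by (auto simp: PD_def)

lemma PA_PD: assumes "X \<in> PA \<phi>" shows "X \<in> PD \<phi>"
proof -
  obtain N where "is_zero_ob D N" using zero_ob_exists by blast
  then show ?thesis using PDI[OF zero_PB assms tri_zero_left] PA_in[OF assms] by blast
qed

lemma PB_PD: assumes "Y \<in> PB \<phi>" shows "Y \<in> PD \<phi>"
proof -
  obtain N where "is_zero_ob D N" using zero_ob_exists by blast
  then show ?thesis using PDI[OF assms zero_PA tri_zero_right] PB_in[OF assms] by blast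
qed

text \<open>The new term is absorbed into the \<A>-component; this settles the case of equal phases
  in \<open>glued_HN_insert\<close>.\<close>

lemma PD_PA: assumes "tri D E F X" "E \<in> PD \<phi>" "X \<in> PA \<phi>" shows "F \<in> PD \<phi>"
proof -
  obtain Y X' where 1: "Y \<in> PB \<phi>" "X' \<in> PA \<phi>" "tri D Y E X'" by (rule PDE[OF assms(2)])
  obtain W where W: "tri D Y F W" "tri D X' W X" using tri_assoc1[OF 1(3) assms(1)] by blast
  then show ?thesis using PDI[OF 1(1) PA_ext W(1)] 1(2) assms(3) by blast
qed

lemma PD_ext:
  assumes "tri D E1 E E2" "E1 \<in> PD \<phi>" "E2 \<in> PD \<phi>" shows "E \<in> PD \<phi>"
proof -
  obtain Y1 X1 where 1: "Y1 \<in> PB \<phi>" "X1 \<in> PA \<phi>" "tri D Y1 E1 X1" by (rule PDE[OF assms(2)])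
  obtain Y2 X2 where 2: "Y2 \<in> PB \<phi>" "X2 \<in> PA \<phi>" "tri D Y2 E2 X2" by (rule PDE[OF assms(3)])
  obtain Y X where "tri D Y1 Y Y2" "tri D X1 X X2" "tri D Y E X"
    using decomposition_ext[OF 1(3) 2(3) assms(1)] 1 2 PA_in PB_in by metis
  then show ?thesis using PDI[OF PB_ext[OF _ 1(1) 2(1)] PA_ext[OF _ 1(2) 2(2)]] by blast
qed

lemma PD_additive: "additive_subcat D (PD \<phi>)"
  unfolding additive_subcat_def replete_def
proof (intro conjI allI ballI impI)
  show "PD \<phi> \<subseteq> Ob D" using PD_Ob by blast
  fix E E' assume *: "E \<in> PD \<phi> \<and> iso_obs D E E'"
  then obtain Y X where 1: "Y \<in> PB \<phi>" "X \<in> PA \<phi>" "tri D Y E X" using PDE by blast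
  have "tri D Y E' X"
    using tri_iso[OF 1(3) iso_obs_refl conjunct2[OF *] iso_obs_refl] PA_in[OF 1(2)] PB_in[OF 1(1)] by simp
  then show "E' \<in> PD \<phi>" using PDI 1 by blast
next
  show "\<exists>N\<in>PD \<phi>. is_zero_ob D N" using zero_ob_exists PA_PD zero_PA by blast
next
  fix X Y W assume "X \<in> PD \<phi>" "Y \<in> PD \<phi>" "is_biproduct D X Y W"
  then show "W \<in> PD \<phi>" using PD_ext[OF biproduct_tri] by blast
qed

lemma PD_Shift: "PD (\<phi> + 1) = Shift D ` PD \<phi>"
proof (intro equalityI subsetI)
  fix E assume "E \<in> PD (\<phi> + 1)"
  then obtain Y X where 1: "Y \<in> PB (\<phi> + 1)" "X \<in> PA (\<phi> + 1)" "tri D Y E X" by (rule PDE)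
  obtain Y' X' where 2: "Y' \<in> PB \<phi>" "Shift D Y' = Y" "X' \<in> PA \<phi>" "Shift D X' = X"
    using 1 A.P_Shift_eq B.P_Shift_eq by auto
  obtain E' where E': "E' \<in> Ob D" "Shift D E' = E" using Shift_Ob_cases triD[OF 1(3)] by metis
  have "tri D Y' E' X'" using tri_Shift[of Y' E' X'] 1(3) 2 E' PA_in PB_in by simp
  then show "E \<in> Shift D ` PD \<phi>" using PDI 2 E' by blast
next
  fix E assume "E \<in> Shift D ` PD \<phi>"
  then obtain E' where E': "E' \<in> PD \<phi>" "E = Shift D E'" by blast
  then obtain Y X where 1: "Y \<in> PB \<phi>" "X \<in> PA \<phi>" "tri D Y E' X" using PDE by blast
  have "tri D (Shift D Y) E (Shift D X)" using tri_Shift[of Y E' X] 1 E' triD by blast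
  moreover have "Shift D Y \<in> PB (\<phi> + 1)" "Shift D X \<in> PA (\<phi> + 1)"
    using 1 A.P_Shift_eq B.P_Shift_eq by auto
  ultimately show "E \<in> PD (\<phi> + 1)" using PDI by blast
qed

text \<open>Four vanishings between components: inside \<B> and inside \<A> by the given slicings,
  from \<B> to \<A> by semiorthogonality, from \<A> to \<B> by \<open>cross_orth\<close>.\<close>

lemma PD_orth:
  assumes "E \<in> PD \<phi>" "F \<in> PD \<psi>" "\<psi> < \<phi>" shows "orth D E F"
proof -
  obtain Y1 X1 where 1: "Y1 \<in> PB \<phi>" "X1 \<in> PA \<phi>" "tri D Y1 E X1" by (rule PDE[OF assms(1)])
  obtain Y2 X2 where 2: "Y2 \<in> PB \<psi>" "X2 \<in> PA \<psi>" "tri D Y2 F X2" by (rule PDE[OF assms(2)])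
  have i: "Y1 \<in> \<B>" "Y1 \<in> Ob D" "X1 \<in> Ob D" "X2 \<in> \<A>" using PA_in PB_in 1 2 by blast+
  have "orth D Y1 F"
    using orth_tri_right[OF 2(3) i(2)] B.P_orth[OF 1(1) 2(1) assms(3)] BA_orth[OF i(1,4)] by simp
  moreover have "orth D X1 F"
    using orth_tri_right[OF 2(3) i(3)] A.P_orth[OF 1(2) 2(2) assms(3)] cross_orth[OF 1(2) 2(1) assms(3)]
    by simp
  ultimately show ?thesis using orth_tri_left[OF 1(3)] triD[OF 2(3)] by blast
qed

text \<open>\<open>glued_HN s t E\<close>: \<open>E\<close> has a Harder--Narasimhan filtration with phases above \<open>t\<close> whose factors of
  phase below \<open>s\<close> come from \<open>\<B>\<close>; a factor from \<open>\<A>\<close> of phase at most \<open>s\<close> can be moved into its place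
  past them.\<close>

inductive glued_HN :: "real \<Rightarrow> real \<Rightarrow> 'o \<Rightarrow> bool" where
  zero: "is_zero_ob D E \<Longrightarrow> glued_HN s t E"
| step: "\<lbrakk>glued_HN s \<psi> F; tri D F E Q; Q \<in> PD \<psi>; \<psi> < s \<Longrightarrow> Q \<in> PB \<psi>; t < \<psi>\<rbrakk> \<Longrightarrow> glued_HN s t E"

lemma glued_HN_mono: "glued_HN s t E \<Longrightarrow> s' \<le> s \<Longrightarrow> t' \<le> t \<Longrightarrow> glued_HN s' t' E"
proof (induction arbitrary: t' rule: glued_HN.induct)
  case (zero E s t)
  then show ?case by (blast intro: glued_HN.zero)
next
  case (step s \<psi> F E Q t)
  have "glued_HN s' \<psi> F" using step by simp
  then show ?case using step by (intro glued_HN.step[of s' \<psi> F E Q]) auto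
qed

text \<open>One step of an insertion sort: \<open>X\<close> enters at the low end and moves up past
  the factors of smaller phase. These come from \<B> because \<phi> \<le> s, so
  \<open>cross_orth_Shift\<close> permits each exchange. Afterwards only factors of phase below
  \<phi> are sure to come from \<B>, whence the new first parameter.\<close>

lemma glued_HN_insert:
  assumes "glued_HN s t F" "X \<in> PA \<phi>" "tri D F E X" "t < \<phi>" "\<phi> \<le> s"
  shows "glued_HN \<phi> t E"
  using assms
proof (induction arbitrary: E rule: glued_HN.induct)
  case (zero F s t)
  then show ?case using glued_HN.step[of \<phi> \<phi> F E X t] glued_HN.zero PA_PD by blast
next
  case (step s \<psi> G F Q t)
  consider "\<phi> < \<psi>" | "\<phi> = \<psi>" | "\<psi> < \<phi>" by linarith
  then show ?case
  proof cases
    case 1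
    then have "glued_HN s \<phi> F" using glued_HN.step[of s \<psi> G F Q \<phi>] step.hyps by blast
    then have "glued_HN \<phi> \<phi> F" using glued_HN_mono step.prems(4) by blast
    then show ?thesis using glued_HN.step[of \<phi> \<phi> F E X t] step.prems PA_PD by blast
  next
    case 2
    obtain W where W: "tri D G E W" "tri D Q W X" using tri_assoc1[OF step.hyps(2) step.prems(2)] by blast
    have "W \<in> PD \<phi>" using PD_PA[OF W(2)] step.hyps(3) step.prems(1) 2 by simp
    moreover have "glued_HN \<phi> \<phi> G" using glued_HN_mono[OF step.hyps(1)] step.prems(4) 2 by simp
    ultimately show ?thesis using glued_HN.step[of \<phi> \<phi> G E W t] W(1) step.prems by blast
  next
    case 3
    then have Q: "Q \<in> PB \<psi>" using step.hyps(4) step.prems by simp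
    obtain W where W: "tri D G E W" "tri D Q W X" using tri_assoc1[OF step.hyps(2) step.prems(2)] by blast
    have "tri D X W Q" using tri_swap[OF W(2)] cross_orth_Shift[OF step.prems(1) Q 3] by blast
    then obtain H where H: "tri D G H X" "tri D H E Q" using tri_assoc2[OF W(1)] by blast
    have "glued_HN \<phi> \<psi> H" using step.IH[OF step.prems(1) H(1) 3 step.prems(4)] .
    then show ?thesis using glued_HN.step[of \<phi> \<psi> H E Q t] H(2) Q PB_PD step.hyps by blast
  qed
qed

lemma glued_HN_imp_HN_above: "glued_HN s t E \<Longrightarrow> HN_above D PD t E"
  by (induction rule: glued_HN.induct) (auto intro: HN_above.intros)

lemma HN_above_B_glued_HN: "HN_above (full_subcat D \<B>) PB t Y \<Longrightarrow> glued_HN s t Y"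
proof (induction rule: HN_above.induct)
  case (zero E t)
  then show ?case using glued_HN.zero by simp
next
  case (step \<psi> F E Q t)
  then show ?case using glued_HN.step[of s \<psi> F E Q t] PB_PD by simp
qed

text \<open>The \<A>-factors are inserted in order of decreasing phase into the filtration of
  \<open>Y\<close>. The first parameter stays below all \<A>-phases already inserted, and the next
  one does not exceed it, as \<open>glued_HN_insert\<close> demands.\<close>

lemma HN_above_A_glued_HN:
  assumes "HN_above (full_subcat D \<A>) PA a X" "HN_above (full_subcat D \<B>) PB b Y" "tri D Y E X"
  shows "glued_HN a (min a b) E"
  using assms
proof (induction arbitrary: E rule: HN_above.induct)
  case (zero X a)
  then have z: "is_zero_ob D X" by simp
  \<comment> \<open>With no \<A>-factor present the first parameter is free; in the filtration
    \<open>Y\<close> is merely replaced by the isomorphic \<open>E\<close>.\<close>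
  have "glued_HN s b E" for s
    using HN_above_B_glued_HN[OF zero(2), of s]
  proof (cases rule: glued_HN.cases)
    case zero
    then show ?thesis using tri_zero_zero[OF \<open>tri D Y E X\<close> _ z] glued_HN.zero by blast
  next
    case (step \<psi> F Q)
    have "iso_obs D Y E" using tri_zero_cone_iso[OF \<open>tri D Y E X\<close> z] .
    then have "tri D F E Q" using tri_iso[OF step(2) iso_obs_refl _ iso_obs_refl] triD[OF step(2)] by blast
    then show ?thesis using glued_HN.step step by blast
  qed
  then show ?case using glued_HN_mono by (meson min.cobounded2 order_refl)
next
  case (step \<psi> X' X Q a)
  then have tX: "tri D X' X Q" by simp
  obtain G where G: "tri D Y G X'" "tri D G E Q" using tri_assoc2[OF step.prems(2) tX] by blast
  have "glued_HN \<psi> (min \<psi> b) G" using step.IH[OF step.prems(1) G(1)] .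
  then have "glued_HN \<psi> (min a b) G" using step.hyps(4) glued_HN_mono by fastforce
  then have "glued_HN \<psi> (min a b) E" using glued_HN_insert[OF _ step.hyps(3) G(2)] step.hyps(4) by simp
  then show ?case using step.hyps(4) glued_HN_mono by fastforce
qed

lemma PD_HN: assumes "E \<in> Ob D" shows "\<exists>n F Q \<phi>. HN_filtration D PD E n F Q \<phi>"
proof -
  obtain Y X where 1: "Y \<in> \<B>" "X \<in> \<A>" "tri D Y E X" by (rule decomposition[OF assms])
  have O: "X \<in> Ob (full_subcat D \<A>)" "Y \<in> Ob (full_subcat D \<B>)"
    using 1 subcat_A_Ob subcat_B_Ob by auto
  obtain a b where "HN_above (full_subcat D \<A>) PA a X" "HN_above (full_subcat D \<B>) PB b Y"
    using A.HN_above_exists[OF O(1)] B.HN_above_exists[OF O(2)] by metis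
  then show ?thesis using HN_above_imp_HN_filtration[OF glued_HN_imp_HN_above[OF HN_above_A_glued_HN[OF _ _ 1(3)]]] by blast
qed

lemma slicing_PD: "slicing D PD"
  unfolding slicing_def
proof (intro conjI allI impI ballI)
  fix \<phi>1 \<phi>2 :: real and X Y assume "\<phi>2 < \<phi>1" "X \<in> PD \<phi>1" "Y \<in> PD \<phi>2"
  then show "homs D X Y = {zero_mor D X Y}"
    using PD_orth orth_singleton[OF PD_Ob PD_Ob] by blast
qed (use PD_additive PD_Shift PD_HN in auto)

sublocale D: sliced_category D PD
  by unfold_locales (rule slicing_PD)

text \<open>An object of a glued slice is an extension of objects of the two hearts, and the slices
  of the components are contained in the glued ones, so each set of generators lies in the extension
  closure of the other.\<close>

lemma heart_PD: "heart D PD = gl D (heart (full_subcat D \<A>) PA) (heart (full_subcat D \<B>) PB)"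
proof -
  have mono: "ext_closure D G \<subseteq> ext_closure D H" if "G \<subseteq> ext_closure D H" for G H
  proof
    fix E assume "E \<in> ext_closure D G"
    then show "E \<in> ext_closure D H"
      by (induction rule: ext_closure.induct) (use that in \<open>blast intro: ext_closure.ext\<close>)+
  qed
  have sub: "ext_closure (full_subcat D S) G \<subseteq> ext_closure D G" for S G
  proof
    fix E assume "E \<in> ext_closure (full_subcat D S) G"
    then show "E \<in> ext_closure D G"
      by (induction rule: ext_closure.induct) (auto intro: ext_closure.intros)
  qed
  show ?thesis
    unfolding heart_def P_interval_def gl_def
  proof (intro equalityI mono subsetI)
    fix E assume "E \<in> (\<Union>\<phi>\<in>{0<..1}. PD \<phi>)"
    then obtain \<phi> where \<phi>: "\<phi> \<in> {0<..1}" "E \<in> PD \<phi>" by blast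
    then obtain Y X where 1: "Y \<in> PB \<phi>" "X \<in> PA \<phi>" "tri D Y E X" using PDE by blast
    let ?G = "ext_closure (full_subcat D \<A>) (\<Union>\<phi>\<in>{0<..1}. PA \<phi>) \<union>
                  ext_closure (full_subcat D \<B>) (\<Union>\<phi>\<in>{0<..1}. PB \<phi>)"
    have "X \<in> ext_closure (full_subcat D \<A>) (\<Union>\<phi>\<in>{0<..1}. PA \<phi>)"
      "Y \<in> ext_closure (full_subcat D \<B>) (\<Union>\<phi>\<in>{0<..1}. PB \<phi>)"
      using 1 \<phi>(1) by (auto intro!: ext_closure.base)
    then have "X \<in> ext_closure D ?G" "Y \<in> ext_closure D ?G" by (auto intro!: ext_closure.base)
    then show "E \<in> ext_closure D ?G" using 1(3) unfolding tri_def by (blast intro: ext_closure.ext)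
  next
    fix E assume "E \<in> ext_closure (full_subcat D \<A>) (\<Union>\<phi>\<in>{0<..1}. PA \<phi>) \<union>
                  ext_closure (full_subcat D \<B>) (\<Union>\<phi>\<in>{0<..1}. PB \<phi>)"
    then have "E \<in> ext_closure D (\<Union>\<phi>\<in>{0<..1}. PA \<phi>) \<union> ext_closure D (\<Union>\<phi>\<in>{0<..1}. PB \<phi>)"
      using sub by blast
    moreover have "ext_closure D (\<Union>\<phi>\<in>{0<..1}. PA \<phi>) \<subseteq> ext_closure D (\<Union>\<phi>\<in>{0<..1}. PD \<phi>)"
      by (rule mono) (use PA_PD in \<open>blast intro: ext_closure.base\<close>)
    moreover have "ext_closure D (\<Union>\<phi>\<in>{0<..1}. PB \<phi>) \<subseteq> ext_closure D (\<Union>\<phi>\<in>{0<..1}. PD \<phi>)"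
      by (rule mono) (use PB_PD in \<open>blast intro: ext_closure.base\<close>)
    ultimately show "E \<in> ext_closure D (\<Union>\<phi>\<in>{0<..1}. PD \<phi>)" by blast
  qed
qed

end

section \<open>Adjoints of the inclusions and Grothendieck groups\<close>

text \<open>A universal arrow from \<open>E\<close> to \<open>S\<close>, the value of a left adjoint
  at one object together with its unit; it can be compared with others without choosing a
  functor.\<close>

definition reflection :: "('o, 'm) tricat \<Rightarrow> 'o set \<Rightarrow> 'o \<Rightarrow> 'o \<Rightarrow> 'm \<Rightarrow> bool" where
  "reflection T S E X r \<longleftrightarrow> X \<in> S \<and> X \<in> Ob T \<and> r \<in> homs T E X \<and>
     (\<forall>W\<in>Ob T \<inter> S. bij_betw (\<lambda>u. Comp T u r) (homs T X W) (homs T E W))"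

definition coreflection :: "('o, 'm) tricat \<Rightarrow> 'o set \<Rightarrow> 'o \<Rightarrow> 'o \<Rightarrow> 'm \<Rightarrow> bool" where
  "coreflection T S E X r \<longleftrightarrow> X \<in> S \<and> X \<in> Ob T \<and> r \<in> homs T X E \<and>
     (\<forall>W\<in>Ob T \<inter> S. bij_betw (\<lambda>u. Comp T r u) (homs T W X) (homs T W E))"

context preadditive_category
begin

lemma reflection_cases:
  assumes "reflection T S E X r" "W \<in> Ob T" "W \<in> S" "w \<in> homs T E W"
  obtains u where "u \<in> homs T X W" "u \<star> r = w"
proof -
  have "w \<in> (\<lambda>u. u \<star> r) ` homs T X W"
    using assms by (auto simp: reflection_def bij_betw_def)
  then show thesis using that by auto
qed

lemma reflection_inj:
  assumes "reflection T S E X r" "W \<in> Ob T" "W \<in> S" "u \<in> homs T X W" "v \<in> homs T X W" "u \<star> r = v \<star> r"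
  shows "u = v"
proof -
  have "inj_on (\<lambda>u. u \<star> r) (homs T X W)" using assms by (auto simp: reflection_def bij_betw_def)
  then show ?thesis using assms(4-6) by (auto dest: inj_onD)
qed

lemma coreflection_cases:
  assumes "coreflection T S E X r" "W \<in> Ob T" "W \<in> S" "w \<in> homs T W E"
  obtains u where "u \<in> homs T W X" "r \<star> u = w"
proof -
  have "w \<in> (\<lambda>u. r \<star> u) ` homs T W X"
    using assms by (auto simp: coreflection_def bij_betw_def)
  then show thesis using that by auto
qed

lemma coreflection_inj:
  assumes "coreflection T S E X r" "W \<in> Ob T" "W \<in> S" "u \<in> homs T W X" "v \<in> homs T W X" "r \<star> u = r \<star> v"
  shows "u = v"
proof -
  have "inj_on (\<lambda>u. r \<star> u) (homs T W X)" using assms by (auto simp: coreflection_def bij_betw_def)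
  then show ?thesis using assms(4-6) by (auto dest: inj_onD)
qed

lemma reflection_unique:
  assumes E: "E \<in> Ob T" and r: "reflection T S E X r" "reflection T S E Y s"
  shows "iso_obs T X Y"
proof -
  have X: "X \<in> Ob T" "X \<in> S" "r \<in> homs T E X" and Y: "Y \<in> Ob T" "Y \<in> S" "s \<in> homs T E Y"
    using r by (auto simp: reflection_def)
  obtain a where a: "a \<in> homs T X Y" "a \<star> r = s" using reflection_cases[OF r(1) Y] .
  obtain b where b: "b \<in> homs T Y X" "b \<star> s = r" using reflection_cases[OF r(2) X] .
  have "b \<star> a = Idm T X"
    using reflection_inj[OF r(1) X(1,2) Comp_in[OF X(1) Y(1) X(1) a(1) b(1)] Idm_in[OF X(1)]]
      Comp_assoc[OF E X(1) Y(1) X(1,3) a(1) b(1)] a b Comp_Idm_left[OF E X(1,3)] by simp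
  moreover have "a \<star> b = Idm T Y"
    using reflection_inj[OF r(2) Y(1,2) Comp_in[OF Y(1) X(1) Y(1) b(1) a(1)] Idm_in[OF Y(1)]]
      Comp_assoc[OF E Y(1) X(1) Y(1,3) b(1) a(1)] a b Comp_Idm_left[OF E Y(1,3)] by simp
  ultimately show ?thesis using a b X Y unfolding iso_obs_def is_iso_mor_def by blast
qed

lemma coreflection_unique:
  assumes E: "E \<in> Ob T" and r: "coreflection T S E X r" "coreflection T S E Y s"
  shows "iso_obs T X Y"
proof -
  have X: "X \<in> Ob T" "X \<in> S" "r \<in> homs T X E" and Y: "Y \<in> Ob T" "Y \<in> S" "s \<in> homs T Y E"
    using r by (auto simp: coreflection_def)
  obtain a where a: "a \<in> homs T X Y" "s \<star> a = r" using coreflection_cases[OF r(2) X] .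
  obtain b where b: "b \<in> homs T Y X" "r \<star> b = s" using coreflection_cases[OF r(1) Y] .
  have "b \<star> a = Idm T X"
    using coreflection_inj[OF r(1) X(1,2) Comp_in[OF X(1) Y(1) X(1) a(1) b(1)] Idm_in[OF X(1)]]
      Comp_assoc[OF X(1) Y(1) X(1) E a(1) b(1) X(3)] a b Comp_Idm_right[OF X(1) E X(3)] by simp
  moreover have "a \<star> b = Idm T Y"
    using coreflection_inj[OF r(2) Y(1,2) Comp_in[OF Y(1) X(1) Y(1) b(1) a(1)] Idm_in[OF Y(1)]]
      Comp_assoc[OF Y(1) X(1) Y(1) E b(1) a(1) Y(3)] a b Comp_Idm_right[OF Y(1) E Y(3)] by simp
  ultimately show ?thesis using a b X Y unfolding iso_obs_def is_iso_mor_def by blast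
qed

lemma is_functor_inclusion: "is_functor (full_subcat T S) T (id, id)"
  by (simp add: is_functor_def)

text \<open>Yoneda: the unit is the image of the identity, and naturality turns the adjunction
  bijection into composition with the unit.\<close>

lemma left_adjoint_reflection:
  assumes adj: "adjoint_functors T (full_subcat T S) L (id, id)" and E: "E \<in> Ob T"
  shows "\<exists>r. reflection T S E (fst L E) r"
proof -
  have "\<exists>\<Phi>. (\<forall>X\<in>Ob T. \<forall>Y\<in>Ob T \<inter> S. bij_betw (\<Phi> X Y) (homs T (fst L X) Y) (homs T X Y)) \<and>
      (\<forall>X\<in>Ob T. \<forall>X'\<in>Ob T. \<forall>Y\<in>Ob T \<inter> S. \<forall>Y'\<in>Ob T \<inter> S. \<forall>f\<in>homs T X' X. \<forall>k\<in>homs T Y Y'.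
        \<forall>u\<in>homs T (fst L X) Y. \<Phi> X' Y' (k \<star> (u \<star> snd L f)) = k \<star> (\<Phi> X Y u \<star> f))"
    using adj by (simp add: adjoint_functors_def)
  then obtain \<Phi> where \<Phi>: "\<forall>X\<in>Ob T. \<forall>Y\<in>Ob T \<inter> S. bij_betw (\<Phi> X Y) (homs T (fst L X) Y) (homs T X Y)"
    "\<forall>X\<in>Ob T. \<forall>X'\<in>Ob T. \<forall>Y\<in>Ob T \<inter> S. \<forall>Y'\<in>Ob T \<inter> S. \<forall>f\<in>homs T X' X. \<forall>k\<in>homs T Y Y'.
        \<forall>u\<in>homs T (fst L X) Y. \<Phi> X' Y' (k \<star> (u \<star> snd L f)) = k \<star> (\<Phi> X Y u \<star> f)"
    by (elim exE conjE)
  have bij: "bij_betw (\<Phi> X Y) (homs T (fst L X) Y) (homs T X Y)"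
    if "X \<in> Ob T" "Y \<in> Ob T" "Y \<in> S" for X Y
    using \<Phi>(1) that by simp
  have nat: "\<Phi> X' Y' (k \<star> (u \<star> snd L f)) = k \<star> (\<Phi> X Y u \<star> f)"
    if "X \<in> Ob T" "X' \<in> Ob T" "Y \<in> Ob T" "Y \<in> S" "Y' \<in> Ob T" "Y' \<in> S"
      "f \<in> homs T X' X" "k \<in> homs T Y Y'" "u \<in> homs T (fst L X) Y" for X X' Y Y' f k u
    using \<Phi>(2) that by simp
  have L: "fst L E \<in> Ob T" "fst L E \<in> S" "snd L (Idm T E) = Idm T (fst L E)"
    using adj E unfolding adjoint_functors_def is_functor_def by auto
  define r where "r = \<Phi> E (fst L E) (Idm T (fst L E))"
  have r: "r \<in> homs T E (fst L E)"
    unfolding r_def by (rule bij_betw_apply[OF bij[OF E L(1,2)] Idm_in[OF L(1)]])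
  have "u \<star> r = \<Phi> E W u" if W: "W \<in> Ob T" "W \<in> S" and u: "u \<in> homs T (fst L E) W" for W u
    using nat[OF E E L(1,2) W Idm_in[OF E] u Idm_in[OF L(1)]] L(3) Comp_Idm_left[OF L(1,1) Idm_in[OF L(1)]]
      Comp_Idm_right[OF L(1) W(1) u] Comp_Idm_right[OF E L(1) r] by (simp add: r_def)
  then have "bij_betw (\<lambda>u. u \<star> r) (homs T (fst L E) W) (homs T E W)" if "W \<in> Ob T" "W \<in> S" for W
    using bij[OF E that] that by (subst bij_betw_cong) auto
  then show ?thesis using L r by (auto simp: reflection_def)
qed

lemma right_adjoint_coreflection:
  assumes adj: "adjoint_functors (full_subcat T S) T (id, id) R" and E: "E \<in> Ob T"
  shows "\<exists>r. coreflection T S E (fst R E) r"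
proof -
  have "\<exists>\<Phi>. (\<forall>X\<in>Ob T \<inter> S. \<forall>Y\<in>Ob T. bij_betw (\<Phi> X Y) (homs T X Y) (homs T X (fst R Y))) \<and>
      (\<forall>X\<in>Ob T \<inter> S. \<forall>X'\<in>Ob T \<inter> S. \<forall>Y\<in>Ob T. \<forall>Y'\<in>Ob T. \<forall>f\<in>homs T X' X. \<forall>k\<in>homs T Y Y'.
        \<forall>u\<in>homs T X Y. \<Phi> X' Y' (k \<star> (u \<star> f)) = snd R k \<star> (\<Phi> X Y u \<star> f))"
    using adj by (simp add: adjoint_functors_def)
  then obtain \<Phi> where \<Phi>: "\<forall>X\<in>Ob T \<inter> S. \<forall>Y\<in>Ob T. bij_betw (\<Phi> X Y) (homs T X Y) (homs T X (fst R Y))"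
    "\<forall>X\<in>Ob T \<inter> S. \<forall>X'\<in>Ob T \<inter> S. \<forall>Y\<in>Ob T. \<forall>Y'\<in>Ob T. \<forall>f\<in>homs T X' X. \<forall>k\<in>homs T Y Y'.
        \<forall>u\<in>homs T X Y. \<Phi> X' Y' (k \<star> (u \<star> f)) = snd R k \<star> (\<Phi> X Y u \<star> f)"
    by (elim exE conjE)
  have bij: "bij_betw (\<Phi> X Y) (homs T X Y) (homs T X (fst R Y))"
    if "X \<in> Ob T" "X \<in> S" "Y \<in> Ob T" for X Y
    using \<Phi>(1) that by simp
  have nat: "\<Phi> X' Y' (k \<star> (u \<star> f)) = snd R k \<star> (\<Phi> X Y u \<star> f)"
    if "X \<in> Ob T" "X \<in> S" "X' \<in> Ob T" "X' \<in> S" "Y \<in> Ob T" "Y' \<in> Ob T"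
      "f \<in> homs T X' X" "k \<in> homs T Y Y'" "u \<in> homs T X Y" for X X' Y Y' f k u
    using \<Phi>(2) that by simp
  have R: "fst R E \<in> Ob T" "fst R E \<in> S" "snd R (Idm T E) = Idm T (fst R E)"
    using adj E unfolding adjoint_functors_def is_functor_def by auto
  have "Idm T (fst R E) \<in> \<Phi> (fst R E) E ` homs T (fst R E) E"
    using bij_betw_imp_surj_on[OF bij[OF R(1,2) E]] Idm_in[OF R(1)] by simp
  then obtain r where r: "r \<in> homs T (fst R E) E" "\<Phi> (fst R E) E r = Idm T (fst R E)" by auto
  \<comment> \<open>Naturality makes \<Phi> a left inverse of composition with the counit
    \<open>r\<close>; the other identity then follows from injectivity of \<Phi>.\<close>
  have inv: "\<Phi> W E (r \<star> w) = w" if W: "W \<in> Ob T" "W \<in> S" and w: "w \<in> homs T W (fst R E)" for W w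
    using nat[OF R(1,2) W E E w Idm_in[OF E] r(1)] r(2) R(3) Comp_Idm_left[OF W(1) R(1) w]
      Comp_Idm_left[OF W(1) E Comp_in[OF W(1) R(1) E w r(1)]] by simp
  have "bij_betw (\<lambda>u. r \<star> u) (homs T W (fst R E)) (homs T W E)" if W: "W \<in> Ob T" "W \<in> S" for W
  proof -
    have c: "r \<star> w \<in> homs T W E" if "w \<in> homs T W (fst R E)" for w
      by (rule Comp_in[OF W(1) R(1) E that r(1)])
    have "r \<star> \<Phi> W E u = u" if u: "u \<in> homs T W E" for u
    proof -
      have p: "\<Phi> W E u \<in> homs T W (fst R E)" by (rule bij_betw_apply[OF bij[OF W E] u])
      show ?thesis
        using bij_betw_imp_inj_on[OF bij[OF W E]] inv[OF W p] c[OF p] u by (auto dest: inj_onD)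
    qed
    then show ?thesis
      using inv[OF W] c bij_betw_apply[OF bij[OF W E]] by (intro bij_betw_byWitness[where f' = "\<Phi> W E"]) auto
  qed
  then show ?thesis using R r by (auto simp: coreflection_def)
qed

lemma left_adjoint_exists:
  assumes "\<And>E. E \<in> Ob T \<Longrightarrow> \<exists>X r. reflection T S E X r"
  shows "\<exists>L. adjoint_functors T (full_subcat T S) L (id, id)"
proof -
  obtain X r where R: "\<And>E. E \<in> Ob T \<Longrightarrow> reflection T S E (X E) (r E)" using assms by metis
  have X: "X E \<in> Ob T" "X E \<in> S" "r E \<in> homs T E (X E)" if "E \<in> Ob T" for E
    using R[OF that] by (auto simp: reflection_def)
  \<comment> \<open>By \<open>homs_disjoint\<close> a morphism determines its domain and codomain,
    so the description singles out \<open>E\<close> and \<open>E'\<close> from \<open>f\<close>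
    alone, as a functor acting on bare morphisms requires.\<close>
  define M where "M f = (THE m. \<exists>E\<in>Ob T. \<exists>E'\<in>Ob T. f \<in> homs T E E' \<and> m \<in> homs T (X E) (X E') \<and>
    m \<star> r E = r E' \<star> f)" for f
  have M: "M f \<in> homs T (X E) (X E') \<and> M f \<star> r E = r E' \<star> f"
    if E: "E \<in> Ob T" "E' \<in> Ob T" and f: "f \<in> homs T E E'" for E E' f
  proof -
    obtain m where m: "m \<in> homs T (X E) (X E')" "m \<star> r E = r E' \<star> f"
      using reflection_cases[OF R[OF E(1)] X(1,2)[OF E(2)] Comp_in[OF E X(1)[OF E(2)] f X(3)[OF E(2)]]] .
    have "M f = m"
      unfolding M_def
    proof (rule the_equality)
      show "\<exists>E\<in>Ob T. \<exists>E'\<in>Ob T. f \<in> homs T E E' \<and> m \<in> homs T (X E) (X E') \<and> m \<star> r E = r E' \<star> f"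
        using E f m by blast
    next
      fix m' assume "\<exists>E\<in>Ob T. \<exists>E'\<in>Ob T. f \<in> homs T E E' \<and> m' \<in> homs T (X E) (X E') \<and> m' \<star> r E = r E' \<star> f"
      then obtain F F' where "F \<in> Ob T" "F' \<in> Ob T" "f \<in> homs T F F'" "m' \<in> homs T (X F) (X F')"
        "m' \<star> r F = r F' \<star> f" by blast
      moreover from this have "F = E" "F' = E'" using homs_disjoint[of F F' E E' f] E f by auto
      ultimately show "m' = m" using reflection_inj[OF R[OF E(1)] X(1,2)[OF E(2)]] m by simp
    qed
    with m show ?thesis by simp
  qed
  have "is_functor T (full_subcat T S) (X, M)"
    unfolding is_functor_def
  proof (simp, intro conjI ballI)
    fix E assume E: "E \<in> Ob T"
    note x = X[OF E]
    show "X E \<in> Ob T" "X E \<in> S" using x by auto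
    show "M (Idm T E) = Idm T (X E)"
      using reflection_inj[OF R[OF E] x(1,2) _ Idm_in[OF x(1)]] M[OF E E Idm_in[OF E]]
        Comp_Idm_left[OF E x(1,3)] Comp_Idm_right[OF E x(1,3)] by simp
  next
    fix E E' f assume "E \<in> Ob T" "E' \<in> Ob T" "f \<in> homs T E E'"
    then show "M f \<in> homs T (X E) (X E')" using M by blast
  next
    fix E F G f g assume O: "E \<in> Ob T" "F \<in> Ob T" "G \<in> Ob T" and f: "f \<in> homs T E F" "g \<in> homs T F G"
    have m: "M f \<in> homs T (X E) (X F)" "M f \<star> r E = r F \<star> f"
       "M g \<in> homs T (X F) (X G)" "M g \<star> r F = r G \<star> g"
       "M (g \<star> f) \<in> homs T (X E) (X G)" "M (g \<star> f) \<star> r E = r G \<star> (g \<star> f)"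
      using M[OF O(1,2) f(1)] M[OF O(2,3) f(2)] M[OF O(1,3) Comp_in[OF O f]] by auto
    note x = X(1)[OF O(1)] X(1)[OF O(2)] X(1)[OF O(3)]
    have "(M g \<star> M f) \<star> r E = M g \<star> (r F \<star> f)"
      using Comp_assoc[OF O(1) x X(3)[OF O(1)] m(1,3)] m(2) by simp
    also have "\<dots> = r G \<star> (g \<star> f)"
      using Comp_assoc[OF O(1,2) x(2,3) f(1) X(3)[OF O(2)] m(3)] m(4)
        Comp_assoc[OF O x(3) f X(3)[OF O(3)]] by simp
    finally show "M (g \<star> f) = M g \<star> M f"
      using reflection_inj[OF R[OF O(1)] x(3) X(2)[OF O(3)] m(5) Comp_in[OF x m(1,3)]] m(6) by simp
  qed
  moreover have "\<exists>\<Phi>. (\<forall>E\<in>Ob T. \<forall>Y\<in>Ob T \<inter> S. bij_betw (\<Phi> E Y) (homs T (X E) Y) (homs T E Y)) \<and>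
     (\<forall>E\<in>Ob T. \<forall>E'\<in>Ob T. \<forall>Y\<in>Ob T \<inter> S. \<forall>Y'\<in>Ob T \<inter> S. \<forall>f\<in>homs T E' E. \<forall>k\<in>homs T Y Y'.
       \<forall>u\<in>homs T (X E) Y. \<Phi> E' Y' (k \<star> (u \<star> M f)) = k \<star> (\<Phi> E Y u \<star> f))"
  proof (intro exI[of _ "\<lambda>E Y u. u \<star> r E"] conjI ballI)
    fix E Y assume "E \<in> Ob T" "Y \<in> Ob T \<inter> S"
    then show "bij_betw (\<lambda>u. u \<star> r E) (homs T (X E) Y) (homs T E Y)"
      using R by (auto simp: reflection_def)
  next
    fix E E' Y Y' f k u
    assume E: "E \<in> Ob T" "E' \<in> Ob T" and Y: "Y \<in> Ob T \<inter> S" "Y' \<in> Ob T \<inter> S"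
      and f: "f \<in> homs T E' E" and k: "k \<in> homs T Y Y'" and u: "u \<in> homs T (X E) Y"
    from Y have Y: "Y \<in> Ob T" "Y' \<in> Ob T" by auto
    have m: "M f \<in> homs T (X E') (X E)" "M f \<star> r E' = r E \<star> f" using M[OF E(2,1) f] by auto
    note x = X(1)[OF E(1)] X(1)[OF E(2)]
    have um: "u \<star> M f \<in> homs T (X E') Y" by (rule Comp_in[OF x(2,1) Y(1) m(1) u])
    have "(k \<star> (u \<star> M f)) \<star> r E' = k \<star> ((u \<star> M f) \<star> r E')"
      using Comp_assoc[OF E(2) x(2) Y X(3)[OF E(2)] um k] by simp
    also have "(u \<star> M f) \<star> r E' = u \<star> (r E \<star> f)"
      using Comp_assoc[OF E(2) x(2,1) Y(1) X(3)[OF E(2)] m(1) u] m(2) by simp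
    also have "\<dots> = (u \<star> r E) \<star> f"
      using Comp_assoc[OF E(2,1) x(1) Y(1) f X(3)[OF E(1)] u] .
    finally show "(k \<star> (u \<star> M f)) \<star> r E' = k \<star> ((u \<star> r E) \<star> f)" .
  qed
  ultimately have "adjoint_functors T (full_subcat T S) (X, M) (id, id)"
    unfolding adjoint_functors_def using is_functor_inclusion by simp
  then show ?thesis by blast
qed

lemma right_adjoint_exists:
  assumes "\<And>E. E \<in> Ob T \<Longrightarrow> \<exists>X r. coreflection T S E X r"
  shows "\<exists>R. adjoint_functors (full_subcat T S) T (id, id) R"
proof -
  obtain X r where R: "\<And>E. E \<in> Ob T \<Longrightarrow> coreflection T S E (X E) (r E)" using assms by metis
  have X: "X E \<in> Ob T" "X E \<in> S" "r E \<in> homs T (X E) E" if "E \<in> Ob T" for E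
    using R[OF that] by (auto simp: coreflection_def)
  define M where "M f = (THE m. \<exists>E\<in>Ob T. \<exists>E'\<in>Ob T. f \<in> homs T E E' \<and> m \<in> homs T (X E) (X E') \<and>
    r E' \<star> m = f \<star> r E)" for f
  have M: "M f \<in> homs T (X E) (X E') \<and> r E' \<star> M f = f \<star> r E"
    if E: "E \<in> Ob T" "E' \<in> Ob T" and f: "f \<in> homs T E E'" for E E' f
  proof -
    obtain m where m: "m \<in> homs T (X E) (X E')" "r E' \<star> m = f \<star> r E"
      using coreflection_cases[OF R[OF E(2)] X(1,2)[OF E(1)] Comp_in[OF X(1)[OF E(1)] E X(3)[OF E(1)] f]] .
    have "M f = m"
      unfolding M_def
    proof (rule the_equality)
      show "\<exists>E\<in>Ob T. \<exists>E'\<in>Ob T. f \<in> homs T E E' \<and> m \<in> homs T (X E) (X E') \<and> r E' \<star> m = f \<star> r E"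
        using E f m by blast
    next
      fix m' assume "\<exists>E\<in>Ob T. \<exists>E'\<in>Ob T. f \<in> homs T E E' \<and> m' \<in> homs T (X E) (X E') \<and> r E' \<star> m' = f \<star> r E"
      then obtain F F' where "F \<in> Ob T" "F' \<in> Ob T" "f \<in> homs T F F'" "m' \<in> homs T (X F) (X F')"
        "r F' \<star> m' = f \<star> r F" by blast
      moreover from this have "F = E" "F' = E'" using homs_disjoint[of F F' E E' f] E f by auto
      ultimately show "m' = m" using coreflection_inj[OF R[OF E(2)] X(1,2)[OF E(1)]] m by simp
    qed
    with m show ?thesis by simp
  qed
  have "is_functor T (full_subcat T S) (X, M)"
    unfolding is_functor_def
  proof (simp, intro conjI ballI)
    fix E assume E: "E \<in> Ob T"
    note x = X[OF E]
    show "X E \<in> Ob T" "X E \<in> S" using x by auto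
    show "M (Idm T E) = Idm T (X E)"
      using coreflection_inj[OF R[OF E] x(1,2) _ Idm_in[OF x(1)]] M[OF E E Idm_in[OF E]]
        Comp_Idm_left[OF x(1) E x(3)] Comp_Idm_right[OF x(1) E x(3)] by simp
  next
    fix E E' f assume "E \<in> Ob T" "E' \<in> Ob T" "f \<in> homs T E E'"
    then show "M f \<in> homs T (X E) (X E')" using M by blast
  next
    fix E F G f g assume O: "E \<in> Ob T" "F \<in> Ob T" "G \<in> Ob T" and f: "f \<in> homs T E F" "g \<in> homs T F G"
    have m: "M f \<in> homs T (X E) (X F)" "r F \<star> M f = f \<star> r E"
       "M g \<in> homs T (X F) (X G)" "r G \<star> M g = g \<star> r F"
       "M (g \<star> f) \<in> homs T (X E) (X G)" "r G \<star> M (g \<star> f) = (g \<star> f) \<star> r E"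
      using M[OF O(1,2) f(1)] M[OF O(2,3) f(2)] M[OF O(1,3) Comp_in[OF O f]] by auto
    note x = X(1)[OF O(1)] X(1)[OF O(2)] X(1)[OF O(3)]
    have "r G \<star> (M g \<star> M f) = (g \<star> r F) \<star> M f"
      using Comp_assoc[OF x O(3) m(1,3) X(3)[OF O(3)]] m(4) by simp
    also have "\<dots> = (g \<star> f) \<star> r E"
      using Comp_assoc[OF x(1,2) O(2,3) m(1) X(3)[OF O(2)] f(2)] m(2)
        Comp_assoc[OF x(1) O X(3)[OF O(1)] f] by simp
    finally show "M (g \<star> f) = M g \<star> M f"
      using coreflection_inj[OF R[OF O(3)] x(1) X(2)[OF O(1)] m(5) Comp_in[OF x m(1,3)]] m(6) by simp
  qed
  moreover have "\<exists>\<Phi>. (\<forall>Y\<in>Ob T \<inter> S. \<forall>E\<in>Ob T. bij_betw (\<Phi> Y E) (homs T Y E) (homs T Y (X E))) \<and>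
     (\<forall>Y\<in>Ob T \<inter> S. \<forall>Y'\<in>Ob T \<inter> S. \<forall>E\<in>Ob T. \<forall>E'\<in>Ob T. \<forall>f\<in>homs T Y' Y. \<forall>k\<in>homs T E E'.
       \<forall>u\<in>homs T Y E. \<Phi> Y' E' (k \<star> (u \<star> f)) = M k \<star> (\<Phi> Y E u \<star> f))"
  \<comment> \<open>\<open>adjoint_functors\<close> directs the bijection towards the maps into
    \<open>X E\<close>, so the inverse of composition with the counit is needed.\<close>
  proof (intro exI[of _ "\<lambda>Y E. the_inv_into (homs T Y (X E)) (\<lambda>u. r E \<star> u)"] conjI ballI)
    fix Y E assume "Y \<in> Ob T \<inter> S" "E \<in> Ob T"
    then show "bij_betw (the_inv_into (homs T Y (X E)) (\<lambda>u. r E \<star> u)) (homs T Y E) (homs T Y (X E))"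
      using R by (intro bij_betw_the_inv_into) (auto simp: coreflection_def)
  next
    fix Y Y' E E' f k u
    assume Y': "Y \<in> Ob T \<inter> S" "Y' \<in> Ob T \<inter> S" and E: "E \<in> Ob T" "E' \<in> Ob T"
      and f: "f \<in> homs T Y' Y" and k: "k \<in> homs T E E'" and u: "u \<in> homs T Y E"
    from Y' have Y: "Y \<in> Ob T" "Y' \<in> Ob T" by auto
    note x = X(1)[OF E(1)] X(1)[OF E(2)]
    have m: "M k \<in> homs T (X E) (X E')" "r E' \<star> M k = k \<star> r E" using M[OF E k] by auto
    obtain v where v: "v \<in> homs T Y (X E)" "r E \<star> v = u"
      using coreflection_cases[OF R[OF E(1)] _ _ u] Y' by blast
    have i: "inj_on (\<lambda>u. r E \<star> u) (homs T Y (X E))" "inj_on (\<lambda>u. r E' \<star> u) (homs T Y' (X E'))"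
      using R E Y' by (auto simp: coreflection_def bij_betw_def)
    have u': "the_inv_into (homs T Y (X E)) (\<lambda>u. r E \<star> u) u = v"
      by (rule the_inv_into_f_eq[OF i(1) v(2,1)])
    have vf: "v \<star> f \<in> homs T Y' (X E)" by (rule Comp_in[OF Y(2,1) x(1) f v(1)])
    have "r E' \<star> (M k \<star> (v \<star> f)) = (k \<star> r E) \<star> (v \<star> f)"
      using Comp_assoc[OF Y(2) x E(2) vf m(1) X(3)[OF E(2)]] m(2) by simp
    also have "\<dots> = k \<star> (r E \<star> (v \<star> f))"
      using Comp_assoc[OF Y(2) x(1) E vf X(3)[OF E(1)] k] by simp
    also have "r E \<star> (v \<star> f) = u \<star> f"
      using Comp_assoc[OF Y(2,1) x(1) E(1) f v(1) X(3)[OF E(1)]] v(2) by simp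
    finally show "the_inv_into (homs T Y' (X E')) (\<lambda>u. r E' \<star> u) (k \<star> (u \<star> f)) =
        M k \<star> (the_inv_into (homs T Y (X E)) (\<lambda>u. r E \<star> u) u \<star> f)"
      unfolding u' using the_inv_into_f_eq[OF i(2) _ Comp_in[OF Y(2) x vf m(1)]] by simp
  qed
  ultimately have "adjoint_functors (full_subcat T S) T (id, id) (X, M)"
    unfolding adjoint_functors_def using is_functor_inclusion by simp
  then show ?thesis by blast
qed

end

section \<open>Grothendieck groups and their universal property\<close>

context triangulated_category
begin

lemma K0_relations_carrier: "K0_relations T \<subseteq> carrier (free_Abelian_group (Ob T))"
proof
  fix x assume "x \<in> K0_relations T"
  then obtain X Y Z where x: "x = frag_of Y - frag_of X - frag_of Z" and "tri T X Y Z"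
    unfolding K0_relations_def tri_def by blast
  then have O: "X \<in> Ob T" "Y \<in> Ob T" "Z \<in> Ob T" using triD by blast+
  have "Poly_Mapping.keys x \<subseteq> Poly_Mapping.keys (frag_of Y - frag_of X) \<union> Poly_Mapping.keys (frag_of Z)"
    unfolding x by (rule keys_diff)
  also have "\<dots> \<subseteq> Ob T" using keys_diff[of "frag_of Y" "frag_of X"] O by (auto split: if_splits)
  finally show "x \<in> carrier (free_Abelian_group (Ob T))" by simp
qed

lemma K0_normal: "generate (free_Abelian_group (Ob T)) (K0_relations T) \<lhd> free_Abelian_group (Ob T)"
  using comm_group.subgroup_imp_normal[OF abelian_free_Abelian_group]
    group.generate_is_subgroup[OF group_free_Abelian_group K0_relations_carrier] by blast

lemma K0_comm_group: "comm_group (K0 T)"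
  unfolding K0_def
  using comm_group.abelian_FactGroup[OF abelian_free_Abelian_group]
    group.generate_is_subgroup[OF group_free_Abelian_group K0_relations_carrier] by blast

lemma K0_class_carrier: "E \<in> Ob T \<Longrightarrow> K0_class T E \<in> carrier (K0 T)"
  unfolding K0_def K0_class_def carrier_FactGroup by auto

lemma K0_class_tri:
  assumes "tri T X Y Z"
  shows "K0_class T Y = K0_class T X \<otimes>\<^bsub>K0 T\<^esub> K0_class T Z"
proof -
  let ?F = "free_Abelian_group (Ob T)"
  let ?N = "generate ?F (K0_relations T)"
  have O: "X \<in> Ob T" "Y \<in> Ob T" "Z \<in> Ob T" using triD[OF assms] by auto
  have c: "frag_of X \<in> carrier ?F" "frag_of Y \<in> carrier ?F" "frag_of Z \<in> carrier ?F"
    using O by simp_all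
  have xz: "frag_of X + frag_of Z \<in> carrier ?F"
    using monoid.m_closed[OF group.is_monoid[OF group_free_Abelian_group] c(1,3)] by simp
  have "frag_of Y - frag_of X - frag_of Z \<in> ?N"
    using assms unfolding tri_def K0_relations_def by (intro generate.incl) blast
  then have "frag_of Y - frag_of X - frag_of Z + (frag_of X + frag_of Z) \<in> ?N #>\<^bsub>?F\<^esub> (frag_of X + frag_of Z)"
    unfolding r_coset_def mult_free_Abelian_group by blast
  then have "frag_of Y \<in> ?N #>\<^bsub>?F\<^esub> (frag_of X + frag_of Z)" by simp
  then have "?N #>\<^bsub>?F\<^esub> (frag_of X + frag_of Z) = K0_class T Y"
    unfolding K0_class_def
    by (rule group.repr_independence[OF group_free_Abelian_group _ xz normal_imp_subgroup[OF K0_normal]])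
  then show ?thesis
    using normal.rcos_sum[OF K0_normal c(1,3)] unfolding K0_def K0_class_def by simp
qed

text \<open>By the triangle 0 -> 0 -> 0 the class is its own double.\<close>

lemma K0_class_zero:
  assumes "is_zero_ob T N" shows "K0_class T N = \<one>\<^bsub>K0 T\<^esub>"
proof -
  interpret K: comm_group "K0 T" by (rule K0_comm_group)
  note N = K0_class_carrier[OF zero_ob_Ob[OF assms]]
  show ?thesis
    using K0_class_tri[OF tri_zero_left[OF zero_ob_Ob[OF assms] assms]] K.l_cancel_one'[OF N N] N by simp
qed

lemma K0_class_iso:
  assumes "iso_obs T X Y" shows "K0_class T X = K0_class T Y"
proof -
  interpret K: comm_group "K0 T" by (rule K0_comm_group)
  obtain N where N: "is_zero_ob T N" using zero_ob_exists by blast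
  have O: "X \<in> Ob T" "Y \<in> Ob T" using assms by (auto simp: iso_obs_def)
  have "tri T X Y N"
    using tri_iso[OF tri_zero_right[OF O(1) N] iso_obs_refl[OF O(1)] assms iso_obs_refl[OF zero_ob_Ob[OF N]]] .
  then show ?thesis using K0_class_tri K0_class_zero[OF N] K0_class_carrier[OF O(1)] by simp
qed

text \<open>The extension of \<open>f\<close> to the free group kills the defining relations because
  of \<open>add\<close>, so it descends to the quotient.\<close>

lemma K0_lift:
  assumes G: "comm_group G" and f: "\<And>E. E \<in> Ob T \<Longrightarrow> f E \<in> carrier G"
    and add: "\<And>X Y Z. tri T X Y Z \<Longrightarrow> f Y = f X \<otimes>\<^bsub>G\<^esub> f Z"
  shows "\<exists>h\<in>hom (K0 T) G. \<forall>E\<in>Ob T. h (K0_class T E) = f E"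
proof -
  interpret G: comm_group G by (rule G)
  let ?F = "free_Abelian_group (Ob T)"
  obtain h where h: "h \<in> hom ?F G" "\<And>E. E \<in> Ob T \<Longrightarrow> h (frag_of E) = f E"
    using G.free_Abelian_group_universal[of f "Ob T"] f by blast
  interpret h: group_hom ?F G h
    using h(1) by (simp add: group_hom_def group_hom_axioms_def G.group_axioms)
  have "K0_relations T \<subseteq> kernel ?F G h"
  proof
    fix x assume x: "x \<in> K0_relations T"
    then obtain X Y Z where e: "x = frag_of Y - frag_of X - frag_of Z" and t: "tri T X Y Z"
      unfolding K0_relations_def tri_def by blast
    then have O: "X \<in> Ob T" "Y \<in> Ob T" "Z \<in> Ob T" using triD by blast+
    have xc: "x \<in> carrier ?F" using x K0_relations_carrier by blast
    have c: "frag_of X \<in> carrier ?F" "frag_of Z \<in> carrier ?F" using O by simp_all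
    have "h (x \<otimes>\<^bsub>?F\<^esub> (frag_of X \<otimes>\<^bsub>?F\<^esub> frag_of Z)) = h x \<otimes>\<^bsub>G\<^esub> (h (frag_of X) \<otimes>\<^bsub>G\<^esub> h (frag_of Z))"
      using h.hom_mult[OF xc h.G.m_closed[OF c]] h.hom_mult[OF c] by (simp only:)
    moreover have "x \<otimes>\<^bsub>?F\<^esub> (frag_of X \<otimes>\<^bsub>?F\<^esub> frag_of Z) = frag_of Y" using e by simp
    ultimately have "f X \<otimes>\<^bsub>G\<^esub> f Z = h x \<otimes>\<^bsub>G\<^esub> (f X \<otimes>\<^bsub>G\<^esub> f Z)" using h(2) O add[OF t] by simp
    then have "h x = \<one>\<^bsub>G\<^esub>"
      using G.r_cancel_one'[of "f X \<otimes>\<^bsub>G\<^esub> f Z" "h x"] f O h.hom_closed[OF xc] by simp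
    then show "x \<in> kernel ?F G h" using xc by (simp add: kernel_def)
  qed
  then have "generate ?F (K0_relations T) \<subseteq> kernel ?F G h"
    by (rule h.G.generate_subgroup_incl[OF _ h.subgroup_kernel])
  then obtain g where "g \<in> hom (?F Mod generate ?F (K0_relations T)) G"
    "\<And>x. x \<in> carrier ?F \<Longrightarrow> g (generate ?F (K0_relations T) #>\<^bsub>?F\<^esub> x) = h x"
    using h.FactGroup_universal_kernel[OF K0_normal] by blast
  then show ?thesis using h(2) by (intro bexI[of _ g]) (auto simp: K0_def K0_class_def)
qed

end

section \<open>The two components of an object and their classes\<close>

context semiorthogonal
begin

abbreviation comp_infix_D (infixr "\<star>" 75) where "g \<star> f \<equiv> Comp D g f"

text \<open>Semiorthogonality kills the neighbours of Hom(X, W) -> Hom(E, W) in the long exact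
  sequence: Hom(Y, W) = 0 gives surjectivity, Hom(Y[1], W) = 0 injectivity.\<close>

lemma Tri_reflection:
  assumes t: "Tri D Y E X f g h" and YX: "Y \<in> \<B>" "X \<in> \<A>"
  shows "reflection D \<A> E X g"
proof -
  note d = TriD[OF t]
  have "bij_betw (\<lambda>u. u \<star> g) (homs D X W) (homs D E W)" if W: "W \<in> Ob D" "W \<in> \<A>" for W
  proof (rule bij_betw_imageI)
    have B: "Shift D Y \<in> \<B>"
      using subcat_B YX(1) d(1) unfolding triangulated_subcat_def by blast
    show "inj_on (\<lambda>u. u \<star> g) (homs D X W)"
    proof (rule inj_onI)
      fix u v assume uv: "u \<in> homs D X W" "v \<in> homs D X W" "u \<star> g = v \<star> g"
      show "u = v"
      proof (rule right_cancel[OF d(2,3) W(1) d(5) uv])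
        fix w assume w: "w \<in> homs D X W" "w \<star> g = zero_mor D E W"
        obtain w' where "w' \<in> homs D (Shift D Y) W" "w' \<star> h = w"
          using Tri_lift_cone[OF Tri_rotate1[OF t] W(1) w] .
        then show "w = zero_mor D X W"
          using BA_orth[OF B W(2)] comp_zero_left[OF d(3) Shift_Ob[OF d(1)] W(1) d(6)] by (simp add: orth_def)
      qed
    qed
    show "(\<lambda>u. u \<star> g) ` homs D X W = homs D E W"
    proof (intro equalityI subsetI)
      fix w assume "w \<in> (\<lambda>u. u \<star> g) ` homs D X W"
      then show "w \<in> homs D E W" using Comp_in[OF d(2,3) W(1) d(5)] by auto
    next
      fix w assume w: "w \<in> homs D E W"
      have "w \<star> f = zero_mor D Y W"
        using BA_orth[OF YX(1) W(2)] Comp_in[OF d(1,2) W(1) d(4) w] by (simp add: orth_def)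
      then show "w \<in> (\<lambda>u. u \<star> g) ` homs D X W" using Tri_lift_cone[OF t W(1) w] by blast
    qed
  qed
  then show ?thesis using YX d by (auto simp: reflection_def)
qed

text \<open>Dual of \<open>Tri_reflection\<close>; injectivity uses that X[-1] again lies in
  \<A>.\<close>

lemma Tri_coreflection:
  assumes t: "Tri D Y E X f g h" and YX: "Y \<in> \<B>" "X \<in> \<A>"
  shows "coreflection D \<B> E Y f"
proof -
  note d = TriD[OF t]
  obtain X' where X': "X' \<in> Ob D" "Shift D X' = X" using Shift_Ob_cases[OF d(3)] .
  obtain e where e: "Tri D X' Y E e f g"
    using Tri_unrotate[OF t X'(2)[symmetric] X'(1)] .
  have A: "X' \<in> \<A>" using subcat_A YX(2) X' unfolding triangulated_subcat_def by blast
  have "bij_betw (\<lambda>u. f \<star> u) (homs D W Y) (homs D W E)" if W: "W \<in> Ob D" "W \<in> \<B>" for W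
  proof (rule bij_betw_imageI)
    show "inj_on (\<lambda>u. f \<star> u) (homs D W Y)"
    proof (rule inj_onI)
      fix u v assume uv: "u \<in> homs D W Y" "v \<in> homs D W Y" "f \<star> u = f \<star> v"
      show "u = v"
      proof (rule left_cancel[OF W(1) d(1,2,4) uv])
        fix w assume w: "w \<in> homs D W Y" "f \<star> w = zero_mor D W E"
        obtain w' where "w' \<in> homs D W X'" "e \<star> w' = w" using Tri_lift_cocone[OF e W(1) w] .
        then show "w = zero_mor D W Y"
          using BA_orth[OF W(2) A] comp_zero_right[OF W(1) X'(1) d(1) TriD(4)[OF e]] by (simp add: orth_def)
      qed
    qed
    show "(\<lambda>u. f \<star> u) ` homs D W Y = homs D W E"
    proof (intro equalityI subsetI)
      fix w assume "w \<in> (\<lambda>u. f \<star> u) ` homs D W Y"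
      then show "w \<in> homs D W E" using Comp_in[OF W(1) d(1,2) _ d(4)] by auto
    next
      fix w assume w: "w \<in> homs D W E"
      have "g \<star> w = zero_mor D W X"
        using BA_orth[OF W(2) YX(2)] Comp_in[OF W(1) d(2,3) w d(5)] by (simp add: orth_def)
      then show "w \<in> (\<lambda>u. f \<star> u) ` homs D W Y" using Tri_lift_cocone[OF t W(1) w] by blast
    qed
  qed
  then show ?thesis using YX d by (auto simp: coreflection_def)
qed

lemma decomposition_unique:
  assumes "tri D Y E X" "Y \<in> \<B>" "X \<in> \<A>" "tri D Y' E X'" "Y' \<in> \<B>" "X' \<in> \<A>"
  shows "iso_obs D X X'" "iso_obs D Y Y'"
proof -
  have E: "E \<in> Ob D" using triD[OF assms(1)] by blast
  obtain f g h f' g' h' where t: "Tri D Y E X f g h" "Tri D Y' E X' f' g' h'"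
    using assms(1,4) unfolding tri_def by blast
  show "iso_obs D X X'"
    by (rule reflection_unique[OF E Tri_reflection[OF t(1) assms(2,3)] Tri_reflection[OF t(2) assms(5,6)]])
  show "iso_obs D Y Y'"
    by (rule coreflection_unique[OF E Tri_coreflection[OF t(1) assms(2,3)] Tri_coreflection[OF t(2) assms(5,6)]])
qed

text \<open>Decomposition triangles provide universal arrows for every object, so the adjoints exist
  and \<open>SOME\<close> picks genuine ones; uniqueness of universal arrows compares their values
  with the given components.\<close>

lemma adj_iso:
  assumes t: "tri D Y E X" and YX: "Y \<in> \<B>" "X \<in> \<A>"
  shows "iso_obs D (fst (left_adj_incl D \<A>) E) X" "fst (left_adj_incl D \<A>) E \<in> \<A>"
    "iso_obs D (fst (right_adj_incl D \<B>) E) Y" "fst (right_adj_incl D \<B>) E \<in> \<B>"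
proof -
  obtain f g h where T: "Tri D Y E X f g h" using t unfolding tri_def by blast
  have E: "E \<in> Ob D" using triD[OF t] by blast
  have "\<exists>X r. reflection D \<A> F X r" if "F \<in> Ob D" for F
    using decomposition[OF that] Tri_reflection unfolding tri_def by metis
  then have "adjoint_functors D (full_subcat D \<A>) (left_adj_incl D \<A>) (id, id)"
    unfolding left_adj_incl_def using someI_ex[OF left_adjoint_exists] by blast
  then obtain r where r: "reflection D \<A> E (fst (left_adj_incl D \<A>) E) r"
    using left_adjoint_reflection[OF _ E] by blast
  then show "fst (left_adj_incl D \<A>) E \<in> \<A>" by (simp add: reflection_def)
  show "iso_obs D (fst (left_adj_incl D \<A>) E) X"
    by (rule reflection_unique[OF E r Tri_reflection[OF T YX]])
  have "\<exists>X r. coreflection D \<B> F X r" if "F \<in> Ob D" for F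
    using decomposition[OF that] Tri_coreflection unfolding tri_def by metis
  then have "adjoint_functors (full_subcat D \<B>) D (id, id) (right_adj_incl D \<B>)"
    unfolding right_adj_incl_def using someI_ex[OF right_adjoint_exists] by blast
  then obtain s where s: "coreflection D \<B> E (fst (right_adj_incl D \<B>) E) s"
    using right_adjoint_coreflection[OF _ E] by blast
  then show "fst (right_adj_incl D \<B>) E \<in> \<B>" by (simp add: coreflection_def)
  show "iso_obs D (fst (right_adj_incl D \<B>) E) Y"
    by (rule coreflection_unique[OF E s Tri_coreflection[OF T YX]])
qed

text \<open>The chosen components \<open>a E\<close>, \<open>b E\<close> come without triangles
  between them. \<open>decomposition_ext\<close> yields some decomposition of the middle term whose
  components do fit into triangles, and uniqueness carries its classes over to the chosen
  one.\<close>

lemma K0_components: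
  obtains kA kB where "kA \<in> hom (K0 D) (K0 (full_subcat D \<A>))" "kB \<in> hom (K0 D) (K0 (full_subcat D \<B>))"
    "\<And>Y E X. tri D Y E X \<Longrightarrow> Y \<in> \<B> \<Longrightarrow> X \<in> \<A> \<Longrightarrow> kA (K0_class D E) = K0_class (full_subcat D \<A>) X"
    "\<And>Y E X. tri D Y E X \<Longrightarrow> Y \<in> \<B> \<Longrightarrow> X \<in> \<A> \<Longrightarrow> kB (K0_class D E) = K0_class (full_subcat D \<B>) Y"
proof -
  interpret A: triangulated_category "full_subcat D \<A>" by (rule triangulated_full_subcat[OF subcat_A])
  interpret B: triangulated_category "full_subcat D \<B>" by (rule triangulated_full_subcat[OF subcat_B])
  have "\<exists>Y X. Y \<in> \<B> \<and> X \<in> \<A> \<and> tri D Y E X" if "E \<in> Ob D" for E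
    using decomposition[OF that] by blast
  then obtain a b where ab: "\<And>E. E \<in> Ob D \<Longrightarrow> b E \<in> \<B> \<and> a E \<in> \<A> \<and> tri D (b E) E (a E)"
    by metis
  have KA: "K0_class (full_subcat D \<A>) (a E) = K0_class (full_subcat D \<A>) X"
    and KB: "K0_class (full_subcat D \<B>) (b E) = K0_class (full_subcat D \<B>) Y"
    if t: "tri D Y E X" "Y \<in> \<B>" "X \<in> \<A>" for Y E X
  proof -
    have E: "b E \<in> \<B>" "a E \<in> \<A>" "tri D (b E) E (a E)" using ab triD[OF t(1)] by blast+
    show "K0_class (full_subcat D \<A>) (a E) = K0_class (full_subcat D \<A>) X"
      using decomposition_unique(1)[OF E(3,1,2) t] E t by (intro A.K0_class_iso) simp
    show "K0_class (full_subcat D \<B>) (b E) = K0_class (full_subcat D \<B>) Y"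
      using decomposition_unique(2)[OF E(3,1,2) t] E t by (intro B.K0_class_iso) simp
  qed
  have add: "K0_class (full_subcat D \<A>) (a E) =
      K0_class (full_subcat D \<A>) (a E1) \<otimes>\<^bsub>K0 (full_subcat D \<A>)\<^esub> K0_class (full_subcat D \<A>) (a E2)"
     "K0_class (full_subcat D \<B>) (b E) =
      K0_class (full_subcat D \<B>) (b E1) \<otimes>\<^bsub>K0 (full_subcat D \<B>)\<^esub> K0_class (full_subcat D \<B>) (b E2)"
    if t: "tri D E1 E E2" for E1 E E2
  proof -
    note O = triD[OF t]
    have 1: "b E1 \<in> \<B>" "a E1 \<in> \<A>" "tri D (b E1) E1 (a E1)"
      and 2: "b E2 \<in> \<B>" "a E2 \<in> \<A>" "tri D (b E2) E2 (a E2)" using ab O by blast+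
    obtain Y X where YX: "tri D (b E1) Y (b E2)" "tri D (a E1) X (a E2)" "tri D Y E X"
      using decomposition_ext[OF 1(3) 2(3) t 1(2) 2(1)] by blast
    have m: "Y \<in> \<B>" "X \<in> \<A>"
      using triangulated_subcat_ext[OF subcat_B YX(1) 1(1) 2(1)]
        triangulated_subcat_ext[OF subcat_A YX(2) 1(2) 2(2)] .
    show "K0_class (full_subcat D \<A>) (a E) =
      K0_class (full_subcat D \<A>) (a E1) \<otimes>\<^bsub>K0 (full_subcat D \<A>)\<^esub> K0_class (full_subcat D \<A>) (a E2)"
      using KA[OF YX(3) m] A.K0_class_tri[of "a E1" X "a E2"] YX(2) m 1 2 by simp
    show "K0_class (full_subcat D \<B>) (b E) =
      K0_class (full_subcat D \<B>) (b E1) \<otimes>\<^bsub>K0 (full_subcat D \<B>)\<^esub> K0_class (full_subcat D \<B>) (b E2)"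
      using KB[OF YX(3) m] B.K0_class_tri[of "b E1" Y "b E2"] YX(1) m 1 2 by simp
  qed
  have cA: "K0_class (full_subcat D \<A>) (a E) \<in> carrier (K0 (full_subcat D \<A>))"
    and cB: "K0_class (full_subcat D \<B>) (b E) \<in> carrier (K0 (full_subcat D \<B>))" if "E \<in> Ob D" for E
    using ab[OF that] subcat_A_Ob subcat_B_Ob by (auto intro!: A.K0_class_carrier B.K0_class_carrier)
  obtain kA where kA: "kA \<in> hom (K0 D) (K0 (full_subcat D \<A>))"
    "\<forall>E\<in>Ob D. kA (K0_class D E) = K0_class (full_subcat D \<A>) (a E)"
    using K0_lift[of _ "\<lambda>E. K0_class (full_subcat D \<A>) (a E)", OF A.K0_comm_group cA add(1)] by blast
  obtain kB where kB: "kB \<in> hom (K0 D) (K0 (full_subcat D \<B>))"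
    "\<forall>E\<in>Ob D. kB (K0_class D E) = K0_class (full_subcat D \<B>) (b E)"
    using K0_lift[of _ "\<lambda>E. K0_class (full_subcat D \<B>) (b E)", OF B.K0_comm_group cB add(2)] by blast
  show thesis
  proof (rule that[OF kA(1) kB(1)])
    fix Y E X assume t: "tri D Y E X" "Y \<in> \<B>" "X \<in> \<A>"
    show "kA (K0_class D E) = K0_class (full_subcat D \<A>) X" using kA(2) KA[OF t] triD[OF t(1)] by simp
    show "kB (K0_class D E) = K0_class (full_subcat D \<B>) Y" using kB(2) KB[OF t] triD[OF t(1)] by simp
  qed
qed

end

section \<open>Local finiteness from the support property\<close>

lemma norm_onD:
  assumes "norm_on n N"
  shows "\<And>x. (\<And>i. i \<ge> n \<Longrightarrow> x i = 0) \<Longrightarrow> 0 \<le> N x"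
    and "\<And>x. (\<And>i. i \<ge> n \<Longrightarrow> x i = 0) \<Longrightarrow> N x = 0 \<Longrightarrow> x = (\<lambda>_. 0)"
    and "\<And>x c. (\<And>i. i \<ge> n \<Longrightarrow> x i = 0) \<Longrightarrow> N (\<lambda>i. c * x i) = \<bar>c\<bar> * N x"
    and "\<And>x y. (\<And>i. i \<ge> n \<Longrightarrow> x i = 0) \<Longrightarrow> (\<And>i. i \<ge> n \<Longrightarrow> y i = 0) \<Longrightarrow>
      N (\<lambda>i. x i + y i) \<le> N x + N y"
  using assms unfolding norm_on_def Let_def by simp_all

lemma norm_on_zero: "norm_on n N \<Longrightarrow> N (\<lambda>_. 0) = 0"
  using norm_onD(3)[of n N "\<lambda>_. 0" 0] by simp

text \<open>Triangle inequality, one coordinate at a time. It provides the continuity of the norm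
  needed in \<open>coordinates_le_norm_on\<close>.\<close>

lemma norm_on_le_coordinates:
  assumes N: "norm_on n N" and d: "\<And>i. i \<ge> n \<Longrightarrow> d i = 0"
  shows "N d \<le> (\<Sum>j<n. \<bar>d j\<bar> * N (\<lambda>i. if i = j then 1 else 0))"
proof -
  have "N (\<lambda>i. if i < m then d i else 0) \<le> (\<Sum>j<m. \<bar>d j\<bar> * N (\<lambda>i. if i = j then 1 else 0))"
    if "m \<le> n" for m
    using that
  proof (induction m)
    case 0
    then show ?case using norm_on_zero[OF N] by simp
  next
    case (Suc m)
    have "(\<lambda>i. if i < Suc m then d i else 0) =
        (\<lambda>i. (if i < m then d i else 0) + d m * (if i = m then 1 else 0))"
      by (auto simp: fun_eq_iff less_Suc_eq)
    moreover have "N (\<lambda>i. (if i < m then d i else 0) + d m * (if i = m then 1 else 0)) \<le>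
        N (\<lambda>i. if i < m then d i else 0) + N (\<lambda>i. d m * (if i = m then 1 else 0))"
      using Suc.prems by (intro norm_onD(4)[OF N]) auto
    moreover have "N (\<lambda>i. d m * (if i = m then 1 else 0)) = \<bar>d m\<bar> * N (\<lambda>i. if i = m then 1 else 0)"
      using Suc.prems by (intro norm_onD(3)[OF N]) auto
    ultimately show ?case using Suc by simp
  qed
  from this[of n] have "N (\<lambda>i. if i < n then d i else 0) \<le> (\<Sum>j<n. \<bar>d j\<bar> * N (\<lambda>i. if i = j then 1 else 0))"
    by simp
  moreover have "(\<lambda>i. if i < n then d i else 0) = d" using d by (auto simp: fun_eq_iff)
  ultimately show ?thesis by simp
qed

text \<open>Bolzano-Weierstrass, one coordinate after the other: passing to a further subsequence
  keeps the convergence already obtained.\<close>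

lemma coordinatewise_convergent_subseq:
  fixes y :: "nat \<Rightarrow> nat \<Rightarrow> real"
  assumes "\<And>i. i < n \<Longrightarrow> Bseq (\<lambda>k. y k i)"
  shows "\<exists>r::nat \<Rightarrow> nat. strict_mono r \<and> (\<forall>i<n. convergent (\<lambda>k. y (r k) i))"
  using assms
proof (induction n)
  case 0
  have "strict_mono (id :: nat \<Rightarrow> nat)" by (simp add: strict_mono_def)
  then show ?case by blast
next
  case (Suc n)
  then obtain r where r: "strict_mono r" "\<forall>i<n. convergent (\<lambda>k. y (r k) i)" by force
  obtain s :: "nat \<Rightarrow> nat" where s: "strict_mono s" "monoseq (\<lambda>k. y (r (s k)) n)"
    using seq_monosub[of "\<lambda>k. y (r k) n"] by auto
  have "Bseq (\<lambda>k. y (r (s k)) n)"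
    using Bseq_subseq[OF Suc.prems[of n], of "r \<circ> s"] by simp
  then have n: "convergent (\<lambda>k. y (r (s k)) n)" using s(2) Bseq_monoseq_convergent by blast
  have "convergent (\<lambda>k. y ((r \<circ> s) k) i)" if "i < Suc n" for i
  proof (cases "i = n")
    case False
    then have "convergent (\<lambda>k. y (r k) i)" using r(2) that by simp
    then show ?thesis using convergent_subseq_convergent[OF _ s(1)] by (fastforce simp: o_def)
  qed (use n in simp)
  moreover have "strict_mono (r \<circ> s)" using r(1) s(1) by (rule strict_mono_o)
  ultimately show ?case by blast
qed

text \<open>Equivalence of norms by compactness. If every constant failed, there would be vectors
  with largest coordinate 1 in absolute value and norm tending to 0; a limit of a subsequence has
  norm 0 without being zero.\<close>

lemma coordinates_le_norm_on:
  assumes N: "norm_on n N"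
  shows "\<exists>c>0. \<forall>x. (\<forall>i\<ge>n. x i = 0) \<longrightarrow> (\<forall>i<n. \<bar>x i\<bar> \<le> c * N x)"
proof (rule ccontr)
  assume neg: "\<not> ?thesis"
  have "\<exists>y. (\<forall>i\<ge>n. y i = 0) \<and> (\<forall>i<n. \<bar>y i\<bar> \<le> 1) \<and> (\<exists>i<n. \<bar>y i\<bar> = 1) \<and> N y \<le> 1 / real (Suc k)" for k
  proof -
    have "\<not> (\<forall>x. (\<forall>i\<ge>n. x i = 0) \<longrightarrow> (\<forall>i<n. \<bar>x i\<bar> \<le> real (Suc k) * N x))"
      using neg by (meson of_nat_0_less_iff zero_less_Suc)
    then obtain x j where x: "\<forall>i\<ge>n. x i = 0" and j: "j < n" "real (Suc k) * N x < \<bar>x j\<bar>"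
      by (auto simp: not_le)
    \<comment> \<open>Dividing by the largest coordinate turns the failure of the constant
      \<open>Suc k\<close> into the bound \<open>1 / real (Suc k)\<close> on the norm.\<close>
    define M where "M = Max ((\<lambda>i. \<bar>x i\<bar>) ` {..<n})"
    have ne: "(\<lambda>i. \<bar>x i\<bar>) ` {..<n} \<noteq> {}" using j by auto
    have le: "\<bar>x i\<bar> \<le> M" if "i < n" for i unfolding M_def using that by (intro Max_ge) auto
    have "M \<in> (\<lambda>i. \<bar>x i\<bar>) ` {..<n}" unfolding M_def by (rule Max_in) (use ne in auto)
    then obtain m where m: "m < n" "\<bar>x m\<bar> = M" by auto
    have "0 \<le> real (Suc k) * N x" using norm_onD(1)[OF N, of x] x by simp
    then have M: "0 < M" using j le[OF j(1)] by linarith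
    define y where "y = (\<lambda>i. 1 / M * x i)"
    have "N y = 1 / M * N x" unfolding y_def using norm_onD(3)[OF N, of x "1 / M"] x M by simp
    moreover have "real (Suc k) * N x \<le> M" using j le[OF j(1)] by linarith
    ultimately have "real (Suc k) * N y \<le> 1" using M by (simp add: divide_le_eq)
    then have "N y \<le> 1 / real (Suc k)" by (simp add: le_divide_eq mult.commute)
    moreover have "\<forall>i\<ge>n. y i = 0" "\<forall>i<n. \<bar>y i\<bar> \<le> 1" "\<bar>y m\<bar> = 1"
      using x le m M by (auto simp: y_def abs_mult)
    ultimately show ?thesis using m(1) by blast
  qed
  then obtain y where y: "\<And>k i. i \<ge> n \<Longrightarrow> y k i = 0" "\<And>k i. i < n \<Longrightarrow> \<bar>y k i\<bar> \<le> 1"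
      "\<And>k. \<exists>i<n. \<bar>y k i\<bar> = 1" "\<And>k. N (y k) \<le> 1 / real (Suc k)"
    by metis
  have "Bseq (\<lambda>k. y k i)" if "i < n" for i using y(2)[OF that] by (intro BseqI'[of _ 1]) simp
  then obtain r where r: "strict_mono r" "\<forall>i<n. convergent (\<lambda>k. y (r k) i)"
    using coordinatewise_convergent_subseq by blast
  define l where "l i = (if i < n then lim (\<lambda>k. y (r k) i) else 0)" for i
  have lim: "(\<lambda>k. y (r k) i) \<longlonglongrightarrow> l i" if "i < n" for i
    using r(2) that by (simp add: l_def convergent_LIMSEQ_iff)
  have l0: "l i = 0" if "i \<ge> n" for i using that by (simp add: l_def)
  have bound: "N l \<le> 1 / real (Suc (r k)) + (\<Sum>j<n. \<bar>l j - y (r k) j\<bar> * N (\<lambda>i. if i = j then 1 else 0))" for k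
  proof -
    have "N (\<lambda>i. y (r k) i + (l i - y (r k) i)) \<le> N (y (r k)) + N (\<lambda>i. l i - y (r k) i)"
      by (rule norm_onD(4)[OF N]) (simp_all add: y(1) l0)
    moreover have "N (\<lambda>i. l i - y (r k) i) \<le> (\<Sum>j<n. \<bar>l j - y (r k) j\<bar> * N (\<lambda>i. if i = j then 1 else 0))"
      by (rule norm_on_le_coordinates[OF N]) (simp add: y(1) l0)
    ultimately show ?thesis using y(4)[of "r k"] by simp
  qed
  have "(\<lambda>k. 1 / real (Suc (r k)) + (\<Sum>j<n. \<bar>l j - y (r k) j\<bar> * N (\<lambda>i. if i = j then 1 else 0)))
      \<longlonglongrightarrow> 0 + (\<Sum>j<n. \<bar>l j - l j\<bar> * N (\<lambda>i. if i = j then 1 else 0))"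
  proof (intro tendsto_add tendsto_sum tendsto_mult tendsto_rabs tendsto_diff tendsto_const)
    show "(\<lambda>k. 1 / real (Suc (r k))) \<longlonglongrightarrow> 0"
      using LIMSEQ_subseq_LIMSEQ[OF LIMSEQ_inverse_real_of_nat r(1)] by (simp add: o_def inverse_eq_divide)
  qed (use lim in auto)
  then have "N l \<le> 0" using bound by (intro LIMSEQ_le_const[where x = 0 and a = "N l"]) auto
  then have "N l = 0" using norm_onD(1)[OF N, of l] l0 by force
  then have lz: "l = (\<lambda>_. 0)" using norm_onD(2)[OF N, of l] l0 by blast
  \<comment> \<open>The sum replaces the maximum of the coordinates because it passes to the limit
    term by term.\<close>
  have "(\<lambda>k. \<Sum>i<n. \<bar>y (r k) i\<bar>) \<longlonglongrightarrow> (\<Sum>i<n. \<bar>l i\<bar>)"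
    by (intro tendsto_sum tendsto_rabs) (use lim in auto)
  moreover have "1 \<le> (\<Sum>i<n. \<bar>y (r k) i\<bar>)" for k
  proof -
    obtain i where i: "i < n" "\<bar>y (r k) i\<bar> = 1" using y(3) by blast
    then show ?thesis using member_le_sum[of i "{..<n}" "\<lambda>i. \<bar>y (r k) i\<bar>"] by simp
  qed
  ultimately have "1 \<le> (\<Sum>i<n. \<bar>l i\<bar>)" by (intro LIMSEQ_le_const) auto
  then show False using lz by simp
qed

lemma finite_bounded_lattice_points:
  assumes N: "norm_on n N"
  shows "finite {x :: nat \<Rightarrow>\<^sub>0 int. Poly_Mapping.keys x \<subseteq> {..<n} \<and>
    N (\<lambda>i. real_of_int (Poly_Mapping.lookup x i)) \<le> R}" (is "finite ?S")
proof -
  obtain c where c: "c > 0" "\<And>x i. \<forall>i\<ge>n. x i = 0 \<Longrightarrow> i < n \<Longrightarrow> \<bar>x i\<bar> \<le> c * N x"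
    using coordinates_le_norm_on[OF N] by blast
  let ?B = "{\<lfloor>- (c * R)\<rfloor>..\<lceil>c * R\<rceil>}"
  have "Poly_Mapping.lookup ` ?S \<subseteq> {f. \<forall>i. (i \<in> {..<n} \<longrightarrow> f i \<in> ?B) \<and> (i \<notin> {..<n} \<longrightarrow> f i = 0)}"
  proof (clarify, intro conjI impI)
    fix x :: "nat \<Rightarrow>\<^sub>0 int" and i
    assume x: "Poly_Mapping.keys x \<subseteq> {..<n}" "N (\<lambda>i. real_of_int (Poly_Mapping.lookup x i)) \<le> R"
    have z: "Poly_Mapping.lookup x i = 0" if "i \<ge> n" for i
      using x(1) that in_keys_iff[of i x] by (meson lessThan_iff not_le subsetD)
    show "Poly_Mapping.lookup x i = 0" if "i \<notin> {..<n}" using z that by simp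
    assume "i \<in> {..<n}"
    then have "\<bar>real_of_int (Poly_Mapping.lookup x i)\<bar> \<le> c * N (\<lambda>i. real_of_int (Poly_Mapping.lookup x i))"
      using c(2)[of "\<lambda>i. real_of_int (Poly_Mapping.lookup x i)" i] z by simp
    also have "\<dots> \<le> c * R" using x(2) c(1) by simp
    finally show "Poly_Mapping.lookup x i \<in> ?B" by (simp add: floor_le_iff le_ceiling_iff) linarith
  qed
  then have "finite (Poly_Mapping.lookup ` ?S)"
    using finite_set_of_finite_funs[of "{..<n}" ?B 0] finite_subset by blast
  then show ?thesis by (rule finite_imageD) (simp add: inj_on_def poly_mapping.lookup_inject)
qed

lemma incseq_finite_range_stable:
  fixes g :: "nat \<Rightarrow> real"
  assumes "\<And>n. g n \<le> g (Suc n)" "finite (range g)"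
  shows "\<exists>N. \<forall>n\<ge>N. g (Suc n) = g n"
proof -
  obtain N where N: "g N = Max (range g)"
    using Max_in[OF assms(2)] by (metis UNIV_not_empty image_is_empty imageE)
  have "g n = g N" if "N \<le> n" for n
    using lift_Suc_mono_le[of g, OF assms(1) that] Max_ge[OF assms(2), of "g n"] N by simp
  then show ?thesis by (metis le_SucI)
qed

section \<open>Chains of strict subobjects in thin slices\<close>

context triangulated_category
begin

text \<open>\<open>V\<close> is the quotient of the larger subobject by the smaller; the octahedron
  for \<open>v\<close> followed by \<open>i'\<close> relates it to the quotients of
  \<open>E\<close>. If it vanishes, \<open>v\<close> is invertible and both subobjects
  agree.\<close>

lemma Tri_mono_step:
  assumes t: "Tri T X E Y i p h" "Tri T X' E Y' i' p' h'" and v: "v \<in> homs T X X'" "i' \<star> v = i"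
  obtains V where "tri T X X' V" "tri T V Y Y'"
    "is_zero_ob T V \<longrightarrow> (\<exists>w\<in>homs T X' X. i \<star> w = i')"
proof -
  note d = TriD[OF t(1)]
  note d' = TriD[OF t(2)]
  obtain V q r where V: "Tri T X X' V v q r" using Tri_cone[OF d(1) d'(1) v(1)] by blast
  have "tri T V Y Y'"
    using Tri_octahedral[OF V t(2), of Y p h] t(1) v(2) triI by metis
  moreover have "\<exists>w\<in>homs T X' X. i \<star> w = i'" if z: "is_zero_ob T V"
  proof -
    obtain w where w: "w \<in> homs T X' X" "v \<star> w = Idm T X'"
      using Tri_zero_cone_iso[OF V z] unfolding is_iso_mor_def by blast
    have "i \<star> w = i'"
      using Comp_assoc[OF d'(1) d(1) d'(1,2) w(1) v(1) d'(4)] v(2) w(2) Comp_Idm_right[OF d'(1,2,4)] by simp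
    with w show ?thesis by blast
  qed
  ultimately show thesis using that triI[OF V] by blast
qed

end

context sliced_category
begin

text \<open>In a quasi-abelian category \<open>P(a, b)\<close> with \<open>b \<le> a + 1\<close> strict short exact sequences are
  triangles: the truncation below \<open>b\<close> of the cone of a strict monomorphism is its cokernel.\<close>

lemma strict_mono_Tri:
  assumes ab: "a < b" "b \<le> a + 1"
    and sm: "strict_mono_mor (full_subcat T (P_interval T P {a<..<b})) X E i"
  shows "\<exists>Y\<in>P_interval T P {a<..<b}. \<exists>p h. Tri T X E Y i p h"
proof -
  let ?S = "P_interval T P {a<..<b}"
  note S = P_interval_eq[OF ab(1)]
  obtain Y p where X: "X \<in> Ob T" "X \<in> ?S" and E: "E \<in> Ob T" "E \<in> ?S" and Y: "Y \<in> Ob T" "Y \<in> ?S"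
    and i: "i \<in> homs T X E" and p: "p \<in> homs T E Y" "p \<star> i = zero_mor T X Y"
    and ker: "\<And>W w. W \<in> Ob T \<Longrightarrow> W \<in> ?S \<Longrightarrow> w \<in> homs T W E \<Longrightarrow> p \<star> w = zero_mor T W Y \<Longrightarrow>
        \<exists>!v. v \<in> homs T W X \<and> i \<star> v = w"
    using sm unfolding strict_mono_mor_def is_kernel_def by auto
  obtain W g h where W: "Tri T X E W i g h" using Tri_cone[OF X(1) E(1) i] by blast
  note dW = TriD[OF W]
  have "Shift T X \<in> lorth {..a}" using lorth_Shift[of X "{..a}" "{..a}"] X S by simp
  then have Wl: "W \<in> lorth {..a}" using lorth_ext[OF tri_rotate[OF triI[OF W]]] E S by simp
  \<comment> \<open>The cone may contain a part of phase at least \<open>b\<close>. Its truncation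
    \<open>W2\<close> is the candidate for the cokernel.\<close>
  obtain W1 W2 where "tri T W1 W W2" and W12: "W1 \<in> lorth {..<b}" "W2 \<in> rorth {b..}"
    using truncation[OF dW(3)] by blast
  then obtain c q r where c: "Tri T W1 W W2 c q r" unfolding tri_def by blast
  note dc = TriD[OF c]
  have "Shift T W1 \<in> lorth {..a}" using lorth_Shift[OF W12(1), of "{..a}"] ab(1) by simp
  then have W2l: "W2 \<in> lorth {..a}" using lorth_ext[OF tri_rotate[OF triI[OF c]] Wl] by simp
  define p' where "p' = q \<star> g"
  \<comment> \<open>\<open>K\<close> completes \<open>p'\<close> to a triangle; what remains is to
    identify \<open>K\<close> with \<open>X\<close> over \<open>E\<close>.\<close>
  obtain K k l where K: "tri T X K W1" "Tri T K E W2 k p' l"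
    using Tri_assoc2[OF W c] unfolding p'_def by blast
  note dK = TriD[OF K(2)]
  obtain V where V: "V \<in> Ob T" "Shift T V = W2" using Shift_Ob_cases[OF dK(3)] .
  obtain e where e: "Tri T V K E e k p'" using Tri_unrotate[OF K(2) V(2)[symmetric] V(1)] .
  have "{..a} \<subseteq> {..<b}" using ab(1) by auto
  then have "W1 \<in> lorth {..a}" using W12(1) lorth_antimono by blast
  then have Kl: "K \<in> lorth {..a}" using lorth_ext[OF K(1)] X S by simp
  have "V \<in> rorth {b..}" by (rule rorth_unshift[of _ "{b..}"]) (use V W12 in auto)
  then have Kr: "K \<in> rorth {b..}" using rorth_ext[OF triI[OF e]] E S by simp
  have KS: "K \<in> ?S" using Kl Kr S by simp
  \<comment> \<open>V = W2[-1] has phases below b - 1 \<le> a, hence receives no map from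
    \<open>K\<close>. So \<open>k\<close> can be cancelled against endomorphisms of
    \<open>K\<close>, as \<open>jv\<close> requires.\<close>
  have oKV: "orth T K V"
  proof (rule lorth_rorth_orth[of _ a])
    show "K \<in> lorth {..<a}" using Kl lorth_antimono[of "{..<a}" "{..a}"] by (simp add: subset_iff)
    show "V \<in> rorth {a..}" by (rule rorth_unshift[of _ "{b..}"]) (use V W12 ab(2) in auto)
  qed
  \<comment> \<open>The given cokernel map \<open>p\<close> factors through \<open>W\<close>, and
    further through \<open>W2\<close> because \<open>Y\<close> has only phases below
    \<open>b\<close>. Hence \<open>p\<close> kills \<open>k\<close>, and the kernel property of
    \<open>i\<close> produces \<open>v\<close>.\<close>
  obtain p1 where p1: "p1 \<in> homs T W Y" "p1 \<star> g = p" using Tri_lift_cone[OF W Y(1) p] .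
  have "orth T W1 Y" using lorth_rorth_orth[OF W12(1)] Y S by simp
  then have "p1 \<star> c = zero_mor T W1 Y"
    using Comp_in[OF dc(1,2) Y(1) dc(4) p1(1)] by (simp add: orth_def)
  then obtain p2 where p2: "p2 \<in> homs T W2 Y" "p2 \<star> q = p1" using Tri_lift_cone[OF c Y(1) p1(1)] by blast
  have pp: "p = p2 \<star> p'"
    unfolding p'_def using Comp_assoc[OF E(1) dc(2,3) Y(1) dW(5) dc(5) p2(1)] p1 p2 by simp
  have "p \<star> k = zero_mor T K Y"
    unfolding pp using Comp_assoc[OF dK(1,2,3) Y(1) dK(4,5) p2(1)] Tri_comp_zero[OF K(2)]
      comp_zero_right[OF dK(1,3) Y(1) p2(1)] by simp
  then obtain v where v: "v \<in> homs T K X" "i \<star> v = k" using ker[OF dK(1) KS dK(4)] by blast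
  have "p' \<star> i = zero_mor T X W2"
    unfolding p'_def using Comp_assoc[OF X(1) E(1) dc(2,3) i dW(5) dc(5)] Tri_comp_zero[OF W]
      comp_zero_right[OF X(1) dc(2,3,5)] by simp
  then obtain j where j: "j \<in> homs T X K" "k \<star> j = i" using Tri_lift_cocone[OF K(2) X(1) i] by blast
  have vj: "v \<star> j = Idm T X"
  proof -
    have "i \<star> (v \<star> j) = i" using Comp_assoc[OF X(1) dK(1) X(1) E(1) j(1) v(1) i] v(2) j(2) by simp
    then show ?thesis
      using ker[OF X i p(2)] Comp_in[OF X(1) dK(1) X(1) j(1) v(1)] Idm_in[OF X(1)]
        Comp_Idm_right[OF X(1) E(1) i] by blast
  qed
  have jv: "j \<star> v = Idm T K"
  proof (rule left_cancel[OF dK(1,1,2,4)])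
    show "j \<star> v \<in> homs T K K" by (rule Comp_in[OF dK(1) X(1) dK(1) v(1) j(1)])
    show "Idm T K \<in> homs T K K" by (rule Idm_in[OF dK(1)])
    show "k \<star> (j \<star> v) = k \<star> Idm T K"
      using Comp_assoc[OF dK(1) X(1) dK(1,2) v(1) j(1) dK(4)] v(2) j(2) Comp_Idm_right[OF dK(1,2,4)] by simp
  next
    fix u assume "u \<in> homs T K K" "k \<star> u = zero_mor T K E"
    then obtain u' where "u' \<in> homs T K V" "e \<star> u' = u" using Tri_lift_cocone[OF e dK(1)] by blast
    then show "u = zero_mor T K K"
      using oKV comp_zero_right[OF dK(1) V(1) dK(1) TriD(4)[OF e]] by (simp add: orth_def)
  qed
  have iso: "is_iso_mor T K X v" unfolding is_iso_mor_def using v j vj jv by blast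
  note SV = ShiftM_in[OF dK(1) X(1) v(1)]
  have h': "ShiftM T v \<star> l \<in> homs T W2 (Shift T X)"
    by (rule Comp_in[OF dK(3) Shift_Ob[OF dK(1)] Shift_Ob[OF X(1)] dK(6) SV])
  have "Tri T X E W2 i p' (ShiftM T v \<star> l)"
    by (rule Tri_iso[OF K(2) X(1) E(1) dK(3) i dK(5) h' iso iso_Idm[OF E(1)] iso_Idm[OF dK(3)]])
      (simp_all add: v Comp_Idm_left[OF dK(1,2,4)] Comp_Idm_left[OF dK(2,3,5)] Comp_Idm_right[OF dK(2,3,5)]
        Comp_Idm_right[OF dK(3) Shift_Ob[OF X(1)] h'])
  moreover have "W2 \<in> ?S" using W2l W12 S by simp
  ultimately show ?thesis by blast
qed

text \<open>\<open>f\<close> acts as a length: it is monotone along inclusions of strict subobjects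
  of \<open>E\<close>, detects equality, and has only finitely many values up to
  \<open>f E\<close>.\<close>

lemma finite_length_interval:
  fixes f :: "'o \<Rightarrow> real"
  assumes ab: "a < b" "b \<le> a + 1"
    and add: "\<And>X Y Z. tri T X Y Z \<Longrightarrow> f Y = f X + f Z"
    and nonneg: "\<And>X. X \<in> P_interval T P {a<..<b} \<Longrightarrow> 0 \<le> f X"
    and zero: "\<And>X. X \<in> P_interval T P {a<..<b} \<Longrightarrow> f X = 0 \<Longrightarrow> is_zero_ob T X"
    and fin: "\<And>R. finite (f ` {X \<in> P_interval T P {a<..<b}. f X \<le> R})"
  shows "finite_length_cat (full_subcat T (P_interval T P {a<..<b}))"
  unfolding finite_length_cat_def
proof (intro ballI allI impI)
  let ?S = "P_interval T P {a<..<b}"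
  let ?C = "full_subcat T ?S"
  note S = P_interval_eq[OF ab(1)]
  fix E X i
  assume E: "E \<in> Ob ?C" and "\<forall>n::nat. strict_mono_mor ?C (X n) E (i n)"
  then have sm: "strict_mono_mor ?C (X n) E (i n)" for n by blast
  then have XS: "X n \<in> ?S" for n by (auto simp: strict_mono_mor_def)
  obtain Y p h where Y: "\<And>n. Y n \<in> ?S" and t: "\<And>n. Tri T (X n) E (Y n) (i n) (p n) (h n)"
    using strict_mono_Tri[OF ab sm] by metis
  have "f (X n) \<le> f E" for n using add[OF triI[OF t[of n]]] nonneg[OF Y[of n]] by simp
  then have "range (\<lambda>n. f (X n)) \<subseteq> f ` {X \<in> ?S. f X \<le> f E}" using XS by auto
  then have fr: "finite (range (\<lambda>n. f (X n)))" using fin finite_subset by blast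
  have step: "f (X m) \<le> f (X n) \<and> (f (X n) = f (X m) \<longrightarrow> subobject_le ?C (X n) (i n) (X m) (i m))"
    if sub: "subobject_le ?C (X m) (i m) (X n) (i n)" for m n
  proof -
    obtain v where v: "v \<in> homs T (X m) (X n)" "i n \<star> v = i m"
      using sub by (auto simp: subobject_le_def)
    obtain V where V: "tri T (X m) (X n) V" "tri T V (Y m) (Y n)"
      "is_zero_ob T V \<longrightarrow> (\<exists>w\<in>homs T (X n) (X m). i m \<star> w = i n)"
      by (rule Tri_mono_step[OF t t v])
    \<comment> \<open>\<open>V\<close> has two descriptions: as the cone of X m -> X n its phases
      exceed \<open>a\<close>, and as an extension of \<open>Y m\<close> by Y n[-1] they are below
      \<open>b\<close>.\<close>
    have "Shift T (X m) \<in> lorth {..a}" using lorth_Shift[of "X m" "{..a}" "{..a}"] XS S by simp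
    then have "V \<in> lorth {..a}" using lorth_ext[OF tri_rotate[OF V(1)]] XS S by blast
    moreover have "V \<in> rorth {b..}"
    proof -
      obtain Y' where Y': "Y' \<in> Ob T" "Shift T Y' = Y n" using Shift_Ob_cases triD[OF V(2)] by metis
      have "Y' \<in> rorth {b..}"
        by (rule rorth_unshift[of _ "{b..}"]) (use Y' Y[of n] S in auto)
      moreover have "tri T Y' V (Y m)" using V(2) Y' tri_unrotate by metis
      ultimately show ?thesis using rorth_ext Y S by blast
    qed
    ultimately have VS: "V \<in> ?S" using S by simp
    show ?thesis
      using add[OF V(1)] nonneg[OF VS] zero[OF VS] V(3) by (auto simp: subobject_le_def)
  qed
  show "((\<forall>n. subobject_le ?C (X n) (i n) (X (Suc n)) (i (Suc n))) \<longrightarrow>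
           (\<exists>N. \<forall>n\<ge>N. subobject_le ?C (X (Suc n)) (i (Suc n)) (X n) (i n))) \<and>
        ((\<forall>n. subobject_le ?C (X (Suc n)) (i (Suc n)) (X n) (i n)) \<longrightarrow>
           (\<exists>N. \<forall>n\<ge>N. subobject_le ?C (X n) (i n) (X (Suc n)) (i (Suc n))))"
  proof (intro conjI impI)
    assume "\<forall>n. subobject_le ?C (X n) (i n) (X (Suc n)) (i (Suc n))"
    then have st: "f (X n) \<le> f (X (Suc n)) \<and> (f (X (Suc n)) = f (X n) \<longrightarrow>
        subobject_le ?C (X (Suc n)) (i (Suc n)) (X n) (i n))" for n using step by blast
    have "\<exists>N. \<forall>n\<ge>N. f (X (Suc n)) = f (X n)"
      by (rule incseq_finite_range_stable[OF _ fr]) (use st in blast)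
    then show "\<exists>N. \<forall>n\<ge>N. subobject_le ?C (X (Suc n)) (i (Suc n)) (X n) (i n)"
      using st by blast
  next
    assume "\<forall>n. subobject_le ?C (X (Suc n)) (i (Suc n)) (X n) (i n)"
    then have st: "f (X (Suc n)) \<le> f (X n) \<and> (f (X n) = f (X (Suc n)) \<longrightarrow>
        subobject_le ?C (X n) (i n) (X (Suc n)) (i (Suc n)))" for n using step by blast
    have "finite (range (\<lambda>n. - f (X n)))"
      using finite_imageI[OF fr, of uminus] by (simp add: image_image)
    then have "\<exists>N. \<forall>n\<ge>N. - f (X (Suc n)) = - f (X n)"
      by (intro incseq_finite_range_stable) (use st in auto)
    then show "\<exists>N. \<forall>n\<ge>N. subobject_le ?C (X n) (i n) (X (Suc n)) (i (Suc n))"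
      using st by (metis neg_equal_iff_equal)
  qed
qed

lemma locally_finite_if_support:
  assumes Z: "Z \<in> hom (K0 T) complex_group"
    and charge: "\<And>\<phi> E. E \<in> P \<phi> \<Longrightarrow> \<not> is_zero_ob T E \<Longrightarrow>
      \<exists>m>0. Z (K0_class T E) = complex_of_real m * exp (\<i> * complex_of_real (pi * \<phi>))"
    and supp: "support_property T P Z"
  shows "locally_finite T P"
proof -
  obtain n u Z' N C where u: "u \<in> hom (K0 T) (free_Abelian_group {..<n})"
    and Z': "\<And>x. x \<in> carrier (K0 T) \<Longrightarrow> Z x = Z' (u x)"
    and N: "norm_on n N" and C: "C > 0"
    and bound: "\<And>E. semistable T P E \<Longrightarrow>
      N (\<lambda>i. real_of_int (Poly_Mapping.lookup (u (K0_class T E)) i)) \<le> C * cmod (Z (K0_class T E))"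
    using supp unfolding support_property_def by blast
  interpret K: comm_group "K0 T" by (rule K0_comm_group)
  interpret u: group_hom "K0 T" "free_Abelian_group {..<n}" u
    using u by (simp add: group_hom_def group_hom_axioms_def K.group_axioms)
  have Zadd: "Z (x \<otimes>\<^bsub>K0 T\<^esub> y) = Z x + Z y" if "x \<in> carrier (K0 T)" "y \<in> carrier (K0 T)" for x y
    using Z that by (simp add: hom_def complex_group_def)
  have Z1: "Z \<one>\<^bsub>K0 T\<^esub> = 0" using Zadd[of "\<one>\<^bsub>K0 T\<^esub>" "\<one>\<^bsub>K0 T\<^esub>"] by simp
  define lat where "lat E i = real_of_int (Poly_Mapping.lookup (u (K0_class T E)) i)" for E i
  have keys: "Poly_Mapping.keys (u (K0_class T E)) \<subseteq> {..<n}" if "E \<in> Ob T" for E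
    using u.hom_closed[OF K0_class_carrier[OF that]] by simp
  have lat0: "lat E i = 0" if "E \<in> Ob T" "i \<ge> n" for E i
  proof -
    have "i \<notin> Poly_Mapping.keys (u (K0_class T E))" using keys[OF that(1)] that(2) by auto
    then show ?thesis by (simp add: lat_def in_keys_iff)
  qed
  have lat_add: "lat Y = (\<lambda>i. lat X i + lat W i)" if t: "tri T X Y W" for X Y W
  proof -
    have "u (K0_class T Y) = u (K0_class T X) + u (K0_class T W)"
      using K0_class_tri[OF t] u.hom_mult K0_class_carrier triD[OF t] by simp
    then show ?thesis by (simp add: lat_def fun_eq_iff lookup_add)
  qed
  have lat_zero: "lat E = (\<lambda>_. 0)" if "is_zero_ob T E" for E
    using K0_class_zero[OF that] u.hom_one by (simp add: lat_def fun_eq_iff)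
  show ?thesis
    unfolding locally_finite_def
  proof (intro exI[of _ "1/3"] conjI allI)
    fix t :: real
    let ?a = "t - 1/3" and ?b = "t + 1/3"
    let ?S = "P_interval T P {?a<..<?b}"
    \<comment> \<open>The rotation turns the ray of phase \<open>t\<close> into the positive real
      axis.\<close>
    define f where "f E = Re (Z (K0_class T E) * cis (- (pi * t)))" for E
    have fadd: "f Y = f X + f W" if tr: "tri T X Y W" for X Y W
      using K0_class_tri[OF tr] Zadd K0_class_carrier triD[OF tr] by (simp add: f_def algebra_simps)
    have fzero: "f E = 0" if "is_zero_ob T E" for E using K0_class_zero[OF that] Z1 by (simp add: f_def)
    \<comment> \<open>The three claims are proved together: nonnegativity is what forces both parts
      of an extension with \<open>f = 0\<close> to have \<open>f = 0\<close>. The factor 2 is the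
      inverse of cos(pi/3).\<close>
    have main: "0 \<le> f X \<and> N (lat X) \<le> 2 * C * f X \<and> (f X = 0 \<longrightarrow> is_zero_ob T X)" if "X \<in> ?S" for X
      using that unfolding P_interval_def
    proof (induction rule: ext_closure.induct)
      case (base X)
      then obtain \<phi> where \<phi>: "?a < \<phi>" "\<phi> < ?b" "X \<in> P \<phi>" by auto
      show ?case
      proof (cases "is_zero_ob T X")
        case True
        then show ?thesis using fzero lat_zero norm_on_zero[OF N] by simp
      next
        case False
        then obtain m where m: "m > 0" "Z (K0_class T X) = complex_of_real m * exp (\<i> * complex_of_real (pi * \<phi>))"
          using charge[OF \<phi>(3)] by blast
        have Zc: "Z (K0_class T X) = m * cis (pi * \<phi>)" using m(2) by (simp add: cis_conv_exp)
        have cm: "cmod (Z (K0_class T X)) = m" using Zc m(1) by (simp add: norm_mult)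
        have "\<bar>pi * \<phi> - pi * t\<bar> = pi * \<bar>\<phi> - t\<bar>" by (simp add: abs_mult flip: right_diff_distrib)
        also have "\<bar>\<phi> - t\<bar> \<le> 1/3" using \<phi>(1,2) by linarith
        finally have "cos (pi / 3) \<le> cos \<bar>pi * \<phi> - pi * t\<bar>" by (intro cos_monotone_0_pi_le) auto
        then have cos: "1/2 \<le> cos (pi * \<phi> - pi * t)" by (simp add: cos_60)
        have "f X = m * cos (pi * \<phi> - pi * t)" by (simp add: f_def Zc cos_diff algebra_simps)
        then have fX: "m * (1/2) \<le> f X" using cos m(1) by simp
        have "semistable T P X" using False \<phi>(3) by (auto simp: semistable_def)
        then have "N (lat X) \<le> C * m" using bound[of X] cm unfolding lat_def by simp
        also have "\<dots> \<le> 2 * C * f X" using mult_left_mono[OF fX, of C] C by simp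
        finally show ?thesis using fX m(1) by simp
      qed
    next
      case (ext X Y E g1 g2 g3)
      note tr = triI[OF ext.hyps(3)]
      have "N (lat E) \<le> N (lat X) + N (lat Y)"
        unfolding lat_add[OF tr] using triD[OF tr] lat0 by (intro norm_onD(4)[OF N]) auto
      moreover have "is_zero_ob T E" if "is_zero_ob T X" "is_zero_ob T Y"
        using tri_zero_zero[OF tr that] .
      ultimately show ?case using ext.IH fadd[OF tr] by (auto simp: algebra_simps)
    qed
    show "finite_length_cat (full_subcat T ?S)"
    proof (rule finite_length_interval[where f = f])
      fix R
      let ?L = "{x. Poly_Mapping.keys x \<subseteq> {..<n} \<and>
        N (\<lambda>i. real_of_int (Poly_Mapping.lookup x i)) \<le> 2 * C * R}"
      \<comment> \<open>As \<open>Z\<close> factors through the lattice, the values of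
        \<open>f\<close> up to \<open>R\<close> come from lattice points of norm at most
        \<open>2 * C * R\<close>.\<close>
      have "f ` {X \<in> ?S. f X \<le> R} \<subseteq> (\<lambda>x. Re (Z' x * cis (- (pi * t)))) ` ?L"
      proof clarify
        fix X assume X: "X \<in> ?S" "f X \<le> R"
        then have O: "X \<in> Ob T" using P_interval_eq[of ?a ?b] lorth_Ob by auto
        have "N (lat X) \<le> 2 * C * R" using main[OF X(1)] mult_left_mono[OF X(2), of "2 * C"] C by linarith
        then have "u (K0_class T X) \<in> ?L" using keys[OF O] unfolding lat_def by simp
        moreover have "f X = Re (Z' (u (K0_class T X)) * cis (- (pi * t)))"
          unfolding f_def using Z'[OF K0_class_carrier[OF O]] by simp
        ultimately show "f X \<in> (\<lambda>x. Re (Z' x * cis (- (pi * t)))) ` ?L" by blast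
      qed
      then show "finite (f ` {X \<in> ?S. f X \<le> R})"
        using finite_imageI[OF finite_bounded_lattice_points[OF N]] finite_subset by blast
    qed (use fadd main in auto)
  qed auto
qed

end

section \<open>The glued stability condition\<close>

text \<open>Describes in coordinates the embedding of the second summand of a direct sum of lattices
  behind the first \<open>m\<close> coordinates.\<close>

lemma lookup_frag_extend_shift:
  "Poly_Mapping.lookup (frag_extend (\<lambda>i. frag_of (m + i)) b) j =
    (if j < m then 0 else Poly_Mapping.lookup b (j - m))" for m j :: nat
proof (rule frag_induction[of b UNIV])
  fix x
  show "Poly_Mapping.lookup (frag_extend (\<lambda>i. frag_of (m + i)) (frag_of x)) j =
    (if j < m then 0 else Poly_Mapping.lookup (frag_of x) (j - m))"
    by (auto simp: lookup_single when_def)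
next
  fix a b :: "nat \<Rightarrow>\<^sub>0 int"
  assume "Poly_Mapping.lookup (frag_extend (\<lambda>i. frag_of (m + i)) a) j =
    (if j < m then 0 else Poly_Mapping.lookup a (j - m))"
    "Poly_Mapping.lookup (frag_extend (\<lambda>i. frag_of (m + i)) b) j =
    (if j < m then 0 else Poly_Mapping.lookup b (j - m))"
  then show "Poly_Mapping.lookup (frag_extend (\<lambda>i. frag_of (m + i)) (a - b)) j =
    (if j < m then 0 else Poly_Mapping.lookup (a - b) (j - m))"
    by (simp add: frag_extend_diff lookup_minus)
qed auto

text \<open>The direct sum norm: the first block of coordinates is padded with zeros and the second
  reindexed, so that each lands in the space on which its own norm is defined.\<close>

lemma norm_on_sum:
  assumes M: "norm_on m M" and N: "norm_on n N"
  shows "norm_on (m + n) (\<lambda>x. M (\<lambda>i. if i < m then x i else 0) + N (\<lambda>i. x (m + i)))"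
proof -
  let ?l = "\<lambda>x i. if i < m then x i else (0::real)"
  have l: "\<And>x i. i \<ge> m \<Longrightarrow> ?l x i = 0" by simp
  have r: "x (m + i) = 0" if "\<forall>i\<ge>m + n. x i = 0" "i \<ge> n" for x :: "nat \<Rightarrow> real" and i
    using that by simp
  show ?thesis
    unfolding norm_on_def Let_def
  proof (intro conjI ballI allI impI; clarify?)
    fix x :: "nat \<Rightarrow> real" assume x: "\<forall>i\<ge>m + n. x i = 0"
    have p: "0 \<le> M (?l x)" "0 \<le> N (\<lambda>i. x (m + i))"
      using norm_onD(1)[OF M, of "?l x"] norm_onD(1)[OF N, of "\<lambda>i. x (m + i)"] r[OF x] by auto
    then show "0 \<le> M (?l x) + N (\<lambda>i. x (m + i))" by simp
    assume "M (?l x) + N (\<lambda>i. x (m + i)) = 0"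
    then have "M (?l x) = 0" "N (\<lambda>i. x (m + i)) = 0" using p by linarith+
    then have "?l x = (\<lambda>_. 0)" "(\<lambda>i. x (m + i)) = (\<lambda>_. 0)"
      using norm_onD(2)[OF M, of "?l x"] norm_onD(2)[OF N, of "\<lambda>i. x (m + i)"] r[OF x] by auto
    then have "x i = 0" for i
      by (cases "i < m") (metis, metis le_add_diff_inverse not_less)
    then show "x = (\<lambda>_. 0)" by (simp add: fun_eq_iff)
  next
    fix x :: "nat \<Rightarrow> real" and c assume x: "\<forall>i\<ge>m + n. x i = 0"
    have "?l (\<lambda>i. c * x i) = (\<lambda>i. c * ?l x i)" by (simp add: fun_eq_iff)
    moreover have "M (\<lambda>i. c * ?l x i) = \<bar>c\<bar> * M (?l x)" by (rule norm_onD(3)[OF M]) simp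
    moreover have "N (\<lambda>i. c * x (m + i)) = \<bar>c\<bar> * N (\<lambda>i. x (m + i))"
      by (rule norm_onD(3)[OF N]) (use r[OF x] in simp)
    ultimately show "M (?l (\<lambda>i. c * x i)) + N (\<lambda>i. c * x (m + i)) = \<bar>c\<bar> * (M (?l x) + N (\<lambda>i. x (m + i)))"
      by (simp add: distrib_left)
  next
    fix x y :: "nat \<Rightarrow> real" assume x: "\<forall>i\<ge>m + n. x i = 0" and y: "\<forall>i\<ge>m + n. y i = 0"
    have "?l (\<lambda>i. x i + y i) = (\<lambda>i. ?l x i + ?l y i)" by (simp add: fun_eq_iff)
    moreover have "M (\<lambda>i. ?l x i + ?l y i) \<le> M (?l x) + M (?l y)" by (rule norm_onD(4)[OF M]) simp_all
    moreover have "N (\<lambda>i. x (m + i) + y (m + i)) \<le> N (\<lambda>i. x (m + i)) + N (\<lambda>i. y (m + i))"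
      by (rule norm_onD(4)[OF N]) (use r[OF x] r[OF y] in simp_all)
    ultimately show "M (?l (\<lambda>i. x i + y i)) + N (\<lambda>i. x (m + i) + y (m + i)) \<le>
        M (?l x) + N (\<lambda>i. x (m + i)) + (M (?l y) + N (\<lambda>i. y (m + i)))"
      by simp
  qed
qed

lemma comm_group_complex_group: "comm_group complex_group"
  by (rule comm_groupI) (auto simp: complex_group_def algebra_simps intro: exI[of _ "- x" for x])

lemma (in triangulated_category) charge_one:
  assumes "Z \<in> hom (K0 T) complex_group" shows "Z \<one>\<^bsub>K0 T\<^esub> = 0"
  using hom_one[OF assms] K0_comm_group comm_group_complex_group
  by (simp add: comm_group_def complex_group_def)

text \<open>A component of a semistable object may be zero and is then not
  \<open>semistable\<close>; for zero objects both sides vanish.\<close>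

lemma (in sliced_category) support_bound:
  assumes u: "u \<in> hom (K0 T) (free_Abelian_group {..<n})" and N: "norm_on n N"
    and Z: "Z \<in> hom (K0 T) complex_group"
    and bound: "\<And>E. semistable T P E \<Longrightarrow>
      N (\<lambda>i. real_of_int (Poly_Mapping.lookup (u (K0_class T E)) i)) \<le> C * cmod (Z (K0_class T E))"
    and E: "E \<in> P \<phi>"
  shows "N (\<lambda>i. real_of_int (Poly_Mapping.lookup (u (K0_class T E)) i)) \<le> C * cmod (Z (K0_class T E))"
proof (cases "is_zero_ob T E")
  case True
  have "u \<one>\<^bsub>K0 T\<^esub> = 0"
    using hom_one[OF u] K0_comm_group by (simp add: comm_group_def)
  then show ?thesis
    using K0_class_zero[OF True] norm_on_zero[OF N] charge_one[OF Z] by simp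
next
  case False
  then show ?thesis using bound E by (auto simp: semistable_def)
qed

text \<open>Allowing \<open>m = 0\<close> includes the zero components of a semistable
  object.\<close>

lemma (in sliced_category) charge_ray:
  assumes Z: "Z \<in> hom (K0 T) complex_group"
    and charge: "\<forall>\<phi>. \<forall>E\<in>P \<phi>. \<not> is_zero_ob T E \<longrightarrow>
        (\<exists>m>0. Z (K0_class T E) = complex_of_real m * exp (\<i> * complex_of_real (pi * \<phi>)))"
    and E: "E \<in> P \<phi>"
  shows "\<exists>m\<ge>0. Z (K0_class T E) = complex_of_real m * exp (\<i> * complex_of_real (pi * \<phi>)) \<and>
    (is_zero_ob T E \<or> m > 0)"
proof (cases "is_zero_ob T E")
  case True
  then show ?thesis using K0_class_zero charge_one[OF Z] by (intro exI[of _ 0]) simp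
next
  case False
  then show ?thesis using charge E by (metis less_imp_le)
qed

context glued_slicings
begin

lemma glued_stability:
  assumes ZA: "stability_condition (full_subcat D \<A>) PA ZA"
    and ZB: "stability_condition (full_subcat D \<B>) PB ZB"
  shows "\<exists>Z. is_glued_charge D \<A> \<B> ZA ZB Z \<and> stability_condition D PD Z"
proof -
  obtain kA kB where kA: "kA \<in> hom (K0 D) (K0 (full_subcat D \<A>))" and kB: "kB \<in> hom (K0 D) (K0 (full_subcat D \<B>))"
    and kAE: "\<And>Y E X. tri D Y E X \<Longrightarrow> Y \<in> \<B> \<Longrightarrow> X \<in> \<A> \<Longrightarrow> kA (K0_class D E) = K0_class (full_subcat D \<A>) X"
    and kBE: "\<And>Y E X. tri D Y E X \<Longrightarrow> Y \<in> \<B> \<Longrightarrow> X \<in> \<A> \<Longrightarrow> kB (K0_class D E) = K0_class (full_subcat D \<B>) Y"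
    using K0_components by blast
  have ZAh: "ZA \<in> hom (K0 (full_subcat D \<A>)) complex_group" and ZBh: "ZB \<in> hom (K0 (full_subcat D \<B>)) complex_group"
    using ZA ZB by (simp_all add: stability_condition_def)
  have kAc: "kA x \<in> carrier (K0 (full_subcat D \<A>))" and kBc: "kB x \<in> carrier (K0 (full_subcat D \<B>))"
    if "x \<in> carrier (K0 D)" for x using kA kB that by (auto simp: hom_def)
  define Z where "Z x = ZA (kA x) + ZB (kB x)" for x
  have Z: "Z \<in> hom (K0 D) complex_group"
    using ZAh ZBh kA kB kAc kBc unfolding Z_def hom_def complex_group_def by (simp add: algebra_simps)
  have ZE: "Z (K0_class D E) = ZA (K0_class (full_subcat D \<A>) X) + ZB (K0_class (full_subcat D \<B>) Y)"
    if "tri D Y E X" "Y \<in> \<B>" "X \<in> \<A>" for Y E X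
    using kAE[OF that] kBE[OF that] by (simp add: Z_def)
  have "is_glued_charge D \<A> \<B> ZA ZB Z"
    unfolding is_glued_charge_def
  proof (intro conjI ballI Z)
    fix E assume "E \<in> Ob D"
    then obtain Y X where YX: "Y \<in> \<B>" "X \<in> \<A>" "tri D Y E X" by (rule decomposition)
    note adj = adj_iso[OF YX(3,1,2)]
    have "K0_class (full_subcat D \<A>) (fst (left_adj_incl D \<A>) E) = K0_class (full_subcat D \<A>) X"
      by (rule A.K0_class_iso) (use adj YX in simp)
    moreover have "K0_class (full_subcat D \<B>) (fst (right_adj_incl D \<B>) E) = K0_class (full_subcat D \<B>) Y"
      by (rule B.K0_class_iso) (use adj YX in simp)
    ultimately show "Z (K0_class D E) = ZA (K0_class (full_subcat D \<A>) (fst (left_adj_incl D \<A>) E)) +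
        ZB (K0_class (full_subcat D \<B>) (fst (right_adj_incl D \<B>) E))"
      using ZE[OF YX(3,1,2)] by simp
  qed
  have rayA: "\<forall>\<phi>. \<forall>E\<in>PA \<phi>. \<not> is_zero_ob (full_subcat D \<A>) E \<longrightarrow>
      (\<exists>m>0. ZA (K0_class (full_subcat D \<A>) E) = complex_of_real m * exp (\<i> * complex_of_real (pi * \<phi>)))"
    and rayB: "\<forall>\<phi>. \<forall>E\<in>PB \<phi>. \<not> is_zero_ob (full_subcat D \<B>) E \<longrightarrow>
      (\<exists>m>0. ZB (K0_class (full_subcat D \<B>) E) = complex_of_real m * exp (\<i> * complex_of_real (pi * \<phi>)))"
    using ZA ZB unfolding stability_condition_def by blast+
  have ray: "\<exists>mA\<ge>0. \<exists>mB\<ge>0. ZA (K0_class (full_subcat D \<A>) X) = complex_of_real mA * exp (\<i> * complex_of_real (pi * \<phi>)) \<and>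
      ZB (K0_class (full_subcat D \<B>) Y) = complex_of_real mB * exp (\<i> * complex_of_real (pi * \<phi>)) \<and>
      (is_zero_ob D E \<or> mA + mB > 0)"
    if YX: "Y \<in> PB \<phi>" "X \<in> PA \<phi>" "tri D Y E X" for Y E X \<phi>
  proof -
    obtain mA where mA: "mA \<ge> 0" "ZA (K0_class (full_subcat D \<A>) X) = complex_of_real mA * exp (\<i> * complex_of_real (pi * \<phi>))"
      "is_zero_ob (full_subcat D \<A>) X \<or> mA > 0" using A.charge_ray[OF ZAh rayA YX(2)] by blast
    obtain mB where mB: "mB \<ge> 0" "ZB (K0_class (full_subcat D \<B>) Y) = complex_of_real mB * exp (\<i> * complex_of_real (pi * \<phi>))"
      "is_zero_ob (full_subcat D \<B>) Y \<or> mB > 0" using B.charge_ray[OF ZBh rayB YX(1)] by blast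
    have "is_zero_ob D E \<or> mA + mB > 0"
      using mA(1,3) mB(1,3) tri_zero_zero[OF YX(3)] by auto
    with mA mB show ?thesis by blast
  qed
  have charge: "\<exists>m>0. Z (K0_class D E) = complex_of_real m * exp (\<i> * complex_of_real (pi * \<phi>))"
    if E: "E \<in> PD \<phi>" "\<not> is_zero_ob D E" for E \<phi>
  proof -
    obtain Y X where YX: "Y \<in> PB \<phi>" "X \<in> PA \<phi>" "tri D Y E X" by (rule PDE[OF E(1)])
    obtain mA mB where "ZA (K0_class (full_subcat D \<A>) X) = complex_of_real mA * exp (\<i> * complex_of_real (pi * \<phi>))"
      "ZB (K0_class (full_subcat D \<B>) Y) = complex_of_real mB * exp (\<i> * complex_of_real (pi * \<phi>))"
      "mA + mB > 0" using ray[OF YX] E(2) by blast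
    then show ?thesis
      using ZE[OF YX(3)] PA_in[OF YX(2)] PB_in[OF YX(1)]
      by (intro exI[of _ "mA + mB"]) (simp add: distrib_right)
  qed
  have supp: "support_property D PD Z"
  proof -
    obtain nA uA ZA' NA CA where uA: "uA \<in> hom (K0 (full_subcat D \<A>)) (free_Abelian_group {..<nA})"
      and ZA': "ZA' \<in> hom (free_Abelian_group {..<nA}) complex_group"
        "\<forall>x\<in>carrier (K0 (full_subcat D \<A>)). ZA x = ZA' (uA x)"
      and NA: "norm_on nA NA" "CA > 0"
      and bA: "\<And>E. semistable (full_subcat D \<A>) PA E \<Longrightarrow>
        NA (\<lambda>i. real_of_int (Poly_Mapping.lookup (uA (K0_class (full_subcat D \<A>) E)) i))
          \<le> CA * cmod (ZA (K0_class (full_subcat D \<A>) E))"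
      using ZA unfolding stability_condition_def support_property_def by blast
    obtain nB uB ZB' NB CB where uB: "uB \<in> hom (K0 (full_subcat D \<B>)) (free_Abelian_group {..<nB})"
      and ZB': "ZB' \<in> hom (free_Abelian_group {..<nB}) complex_group"
        "\<forall>x\<in>carrier (K0 (full_subcat D \<B>)). ZB x = ZB' (uB x)"
      and NB: "norm_on nB NB" "CB > 0"
      and bB: "\<And>E. semistable (full_subcat D \<B>) PB E \<Longrightarrow>
        NB (\<lambda>i. real_of_int (Poly_Mapping.lookup (uB (K0_class (full_subcat D \<B>) E)) i))
          \<le> CB * cmod (ZB (K0_class (full_subcat D \<B>) E))"
      using ZB unfolding stability_condition_def support_property_def by blast
    \<comment> \<open>\<open>sh\<close> embeds the second lattice behind the first \<open>nA\<close>
      coordinates; \<open>p1\<close> and \<open>p2\<close> project to the two summands.\<close>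
    define sh where "sh = frag_extend (\<lambda>i. frag_of (nA + i))"
    define p1 where "p1 = frag_extend (\<lambda>i. if i < nA then frag_of i else 0)"
    define p2 where "p2 = frag_extend (\<lambda>i. if i < nA then 0 else frag_of (i - nA))"
    define u where "u x = uA (kA x) + sh (uB (kB x))" for x
    define Z' where "Z' y = ZA' (p1 y) + ZB' (p2 y)" for y
    define N where "N x = NA (\<lambda>i. if i < nA then x i else 0) + NB (\<lambda>i. x (nA + i))" for x
    have kuA: "Poly_Mapping.keys (uA (kA x)) \<subseteq> {..<nA}" and kuB: "Poly_Mapping.keys (uB (kB x)) \<subseteq> {..<nB}"
      if "x \<in> carrier (K0 D)" for x
      using kAc[OF that] kBc[OF that] uA uB by (auto simp: hom_def Pi_iff)
    have ksh: "Poly_Mapping.keys (sh b) \<subseteq> {..<nA + nB}" if "Poly_Mapping.keys b \<subseteq> {..<nB}" for b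
      using keys_frag_extend[of "\<lambda>i. frag_of (nA + i)" b] that unfolding sh_def by fastforce
    have add: "sh (x + y) = sh x + sh y" "p1 (x + y) = p1 x + p1 y" "p2 (x + y) = p2 x + p2 y" for x y
      by (simp_all add: sh_def p1_def p2_def frag_extend_add)
    have u: "u \<in> hom (K0 D) (free_Abelian_group {..<nA + nB})"
    proof (rule homI)
      fix x assume x: "x \<in> carrier (K0 D)"
      show "u x \<in> carrier (free_Abelian_group {..<nA + nB})"
        using keys_add[of "uA (kA x)" "sh (uB (kB x))"] kuA[OF x] ksh[OF kuB[OF x]]
        unfolding u_def by fastforce
    next
      fix x y assume xy: "x \<in> carrier (K0 D)" "y \<in> carrier (K0 D)"
      have "uA (kA (x \<otimes>\<^bsub>K0 D\<^esub> y)) = uA (kA x) + uA (kA y)"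
        using hom_mult[OF kA xy] hom_mult[OF uA kAc[OF xy(1)] kAc[OF xy(2)]] by simp
      moreover have "uB (kB (x \<otimes>\<^bsub>K0 D\<^esub> y)) = uB (kB x) + uB (kB y)"
        using hom_mult[OF kB xy] hom_mult[OF uB kBc[OF xy(1)] kBc[OF xy(2)]] by simp
      ultimately show "u (x \<otimes>\<^bsub>K0 D\<^esub> y) = u x \<otimes>\<^bsub>free_Abelian_group {..<nA + nB}\<^esub> u y"
        by (simp add: u_def add)
    qed
    have kp: "Poly_Mapping.keys (p1 y) \<subseteq> {..<nA}" "Poly_Mapping.keys (p2 y) \<subseteq> {..<nB}"
      if "Poly_Mapping.keys y \<subseteq> {..<nA + nB}" for y
      using keys_frag_extend[of "\<lambda>i. if i < nA then frag_of i else 0" y]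
        keys_frag_extend[of "\<lambda>i. if i < nA then 0 else frag_of (i - nA)" y] that
      unfolding p1_def p2_def by (fastforce split: if_splits)+
    have Z': "Z' \<in> hom (free_Abelian_group {..<nA + nB}) complex_group"
    proof (rule homI)
      fix x y assume "x \<in> carrier (free_Abelian_group {..<nA + nB})" "y \<in> carrier (free_Abelian_group {..<nA + nB})"
      then have k: "Poly_Mapping.keys x \<subseteq> {..<nA + nB}" "Poly_Mapping.keys y \<subseteq> {..<nA + nB}" by simp_all
      have "ZA' (p1 x + p1 y) = ZA' (p1 x) + ZA' (p1 y)" "ZB' (p2 x + p2 y) = ZB' (p2 x) + ZB' (p2 y)"
        using hom_mult[OF ZA'(1), of "p1 x" "p1 y"] hom_mult[OF ZB'(1), of "p2 x" "p2 y"] kp[OF k(1)] kp[OF k(2)]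
        by (simp_all add: complex_group_def)
      then show "Z' (x \<otimes>\<^bsub>free_Abelian_group {..<nA + nB}\<^esub> y) = Z' x \<otimes>\<^bsub>complex_group\<^esub> Z' y"
        by (simp add: Z'_def add complex_group_def)
    qed (simp add: complex_group_def)
    have ZZ': "Z x = Z' (u x)" if x: "x \<in> carrier (K0 D)" for x
    proof -
      have "p1 (uA (kA x)) = frag_extend frag_of (uA (kA x))"
        unfolding p1_def by (rule frag_extend_eq) (use kuA[OF x] in auto)
      moreover have "p2 (uA (kA x)) = 0"
        unfolding p2_def by (rule frag_extend_eq_0) (use kuA[OF x] in auto)
      moreover have "p1 (sh b) = 0" for b
        unfolding p1_def sh_def
        using frag_extend_compose[of "\<lambda>i. if i < nA then frag_of i else 0" "\<lambda>i. nA + i" b]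
        by (simp add: o_def frag_extend_eq_0)
      moreover have "p2 (sh b) = frag_extend frag_of b" for b
        unfolding p2_def sh_def
        using frag_extend_compose[of "\<lambda>i. if i < nA then 0 else frag_of (i - nA)" "\<lambda>i. nA + i" b]
        by (simp add: o_def)
      ultimately have "p1 (u x) = uA (kA x)" "p2 (u x) = uB (kB x)"
        by (simp_all add: u_def add flip: frag_expansion)
      then show ?thesis using ZA'(2) ZB'(2) kAc[OF x] kBc[OF x] by (simp add: Z_def Z'_def)
    qed
    have Nn: "norm_on (nA + nB) N" unfolding N_def by (rule norm_on_sum[OF NA(1) NB(1)])
    have bound: "N (\<lambda>i. real_of_int (Poly_Mapping.lookup (u (K0_class D E)) i))
        \<le> max CA CB * cmod (Z (K0_class D E))" if ss: "semistable D PD E" for E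
    proof -
      obtain \<phi> where "E \<in> PD \<phi>" using ss by (auto simp: semistable_def)
      then obtain Y X where YX: "Y \<in> PB \<phi>" "X \<in> PA \<phi>" "tri D Y E X" using PDE by blast
      have m: "Y \<in> \<B>" "X \<in> \<A>" using PA_in[OF YX(2)] PB_in[OF YX(1)] by auto
      let ?a = "uA (K0_class (full_subcat D \<A>) X)" and ?b = "uB (K0_class (full_subcat D \<B>) Y)"
      have E: "K0_class D E \<in> carrier (K0 D)" using K0_class_carrier triD[OF YX(3)] by blast
      have uE: "u (K0_class D E) = ?a + sh ?b"
        using kAE[OF YX(3) m] kBE[OF YX(3) m] by (simp add: u_def)
      have ka: "Poly_Mapping.lookup ?a i = 0" if "i \<ge> nA" for i
        using kuA[OF E] that kAE[OF YX(3) m] by (auto simp: in_keys_iff subset_iff)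
      have "(\<lambda>i. if i < nA then real_of_int (Poly_Mapping.lookup (u (K0_class D E)) i) else 0) =
          (\<lambda>i. real_of_int (Poly_Mapping.lookup ?a i))"
        by (auto simp: fun_eq_iff uE lookup_add sh_def lookup_frag_extend_shift ka)
      moreover have "(\<lambda>i. real_of_int (Poly_Mapping.lookup (u (K0_class D E)) (nA + i))) =
          (\<lambda>i. real_of_int (Poly_Mapping.lookup ?b i))"
        by (auto simp: fun_eq_iff uE lookup_add sh_def lookup_frag_extend_shift ka)
      ultimately have "N (\<lambda>i. real_of_int (Poly_Mapping.lookup (u (K0_class D E)) i)) =
          NA (\<lambda>i. real_of_int (Poly_Mapping.lookup ?a i)) + NB (\<lambda>i. real_of_int (Poly_Mapping.lookup ?b i))"
        by (simp add: N_def)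
      also have "\<dots> \<le> CA * cmod (ZA (K0_class (full_subcat D \<A>) X)) + CB * cmod (ZB (K0_class (full_subcat D \<B>) Y))"
        by (intro add_mono A.support_bound[OF uA NA(1) ZAh bA YX(2)] B.support_bound[OF uB NB(1) ZBh bB YX(1)])
      also have "\<dots> \<le> max CA CB * cmod (ZA (K0_class (full_subcat D \<A>) X)) + max CA CB * cmod (ZB (K0_class (full_subcat D \<B>) Y))"
        by (intro add_mono mult_right_mono) auto
      \<comment> \<open>Nothing is lost to cancellation: both charges are nonnegative multiples of
        the same unit vector, so their moduli add up.\<close>
      also have "\<dots> = max CA CB * cmod (Z (K0_class D E))"
      proof -
        obtain mA mB where mm: "mA \<ge> 0" "mB \<ge> 0"
          "ZA (K0_class (full_subcat D \<A>) X) = complex_of_real mA * exp (\<i> * complex_of_real (pi * \<phi>))"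
          "ZB (K0_class (full_subcat D \<B>) Y) = complex_of_real mB * exp (\<i> * complex_of_real (pi * \<phi>))"
          using ray[OF YX] by blast
        have c: "cmod (complex_of_real r * exp (\<i> * complex_of_real (pi * \<phi>))) = r" if "r \<ge> 0" for r
          using that by (simp add: norm_mult)
        have "Z (K0_class D E) = complex_of_real (mA + mB) * exp (\<i> * complex_of_real (pi * \<phi>))"
          unfolding ZE[OF YX(3) m] mm(3,4) by (simp add: distrib_right)
        then have "cmod (Z (K0_class D E)) = mA + mB" using c[of "mA + mB"] mm(1,2) by (simp only:)
        then show ?thesis unfolding mm(3,4) c[OF mm(1)] c[OF mm(2)] by (simp add: distrib_left)
      qed
      finally show ?thesis .
    qed
    show ?thesis
      unfolding support_property_def
      by (intro exI[of _ "nA + nB"] bexI[OF _ u] bexI[OF _ Z'] conjI ballI exI[of _ N] exI[of _ "max CA CB"])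
        (use ZZ' Nn bound NA(2) in auto)
  qed
  have "locally_finite D PD" by (rule D.locally_finite_if_support[OF Z charge supp])
  then have "stability_condition D PD Z"
    unfolding stability_condition_def using slicing_PD Z charge supp by blast
  with \<open>is_glued_charge D \<A> \<B> ZA ZB Z\<close> show ?thesis by blast
qed

end

text \<open>Modulo shifts both phases lie in \<open>(0, 1]\<close>, where the phases of \<open>\<B>\<close> are at least those of \<open>\<A>\<close>.
  So if \<open>X\<close> has the larger phase, it is shifted strictly further than \<open>Y\<close>, and even
  \<open>Hom(X, Y[1])\<close> is covered by the vanishing of \<open>Hom(A, B[i])\<close> for \<open>i \<le> 0\<close>.\<close>

lemma (in semiorthogonal) cross_orthogonality:
  assumes slA: "slicing (full_subcat D \<A>) PA" and slB: "slicing (full_subcat D \<B>) PB"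
    and van: "\<And>X Y i. \<lbrakk>X \<in> heart (full_subcat D \<A>) PA; Y \<in> heart (full_subcat D \<B>) PB; i \<le> 0\<rbrakk>
      \<Longrightarrow> orth D X (shift_int D i Y)"
    and ph: "\<And>X Y. \<lbrakk>X \<in> heart (full_subcat D \<A>) PA; Y \<in> heart (full_subcat D \<B>) PB;
        \<not> is_zero_ob D X; \<not> is_zero_ob D Y\<rbrakk>
      \<Longrightarrow> phi_plus (full_subcat D \<A>) PA X \<le> phi_minus (full_subcat D \<B>) PB Y"
    and XY: "X \<in> PA \<phi>" "Y \<in> PB \<psi>" "\<psi> < \<phi>"
  shows "orth D X Y" "orth D X (Shift D Y)"
proof -
  interpret A: sliced_category "full_subcat D \<A>" PA
    using triangulated_full_subcat[OF subcat_A] slA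
    by (simp add: sliced_category_def sliced_category_axioms_def)
  interpret B: sliced_category "full_subcat D \<B>" PB
    using triangulated_full_subcat[OF subcat_B] slB
    by (simp add: sliced_category_def sliced_category_axioms_def)
  have A: "PA r \<subseteq> Ob D \<inter> \<A>" "PA (r + 1) = Shift D ` PA r" for r using A.P_Ob A.P_Shift_eq by auto
  have B: "PB r \<subseteq> Ob D \<inter> \<B>" "PB (r + 1) = Shift D ` PB r" for r using B.P_Ob B.P_Shift_eq by auto
  have O: "X \<in> Ob D" "Y \<in> Ob D" using XY A(1) B(1) by blast+
  \<comment> \<open>Ceiling minus one and not the floor, so that the remainders lie in (0, 1], the
    phase range of the hearts.\<close>
  define k l where "k = \<lceil>\<phi>\<rceil> - 1" and "l = \<lceil>\<psi>\<rceil> - 1"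
  define r s where "r = \<phi> - of_int k" and "s = \<psi> - of_int l"
  have rs: "0 < r" "r \<le> 1" "0 < s" "s \<le> 1"
    unfolding r_def s_def k_def l_def using ceiling_correct[of \<phi>] ceiling_correct[of \<psi>] by simp_all
  have "X \<in> shift_int D k ` PA r"
    using shift_int_slices[of PA r k] A XY(1) by (simp add: r_def)
  then obtain X' where X': "X' \<in> PA r" "X = shift_int D k X'" by blast
  have "Y \<in> shift_int D l ` PB s"
    using shift_int_slices[of PB s l] B XY(2) by (simp add: s_def)
  then obtain Y' where Y': "Y' \<in> PB s" "Y = shift_int D l Y'" by blast
  have O': "X' \<in> Ob D" "Y' \<in> Ob D" using X' Y' A(1) B(1) by blast+
  have h: "X' \<in> heart (full_subcat D \<A>) PA" "Y' \<in> heart (full_subcat D \<B>) PB"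
    using X' Y' rs unfolding heart_def P_interval_def by (auto intro!: ext_closure.base)
  have sh: "orth D X (shift_int D (l + j) Y') \<longleftrightarrow> orth D X' (shift_int D (l + j - k) Y')" for j
    using orth_shift_int[OF O', of k "l + j - k"] X'(2) by (simp add: algebra_simps)
  have main: "orth D X (shift_int D (l + j) Y')" if j: "j \<le> 1" for j
  \<comment> \<open>Zero objects have no phase, so the comparison of phases says nothing about
    them.\<close>
  proof (cases "is_zero_ob D X' \<or> is_zero_ob D Y'")
    case True
    then have "orth D X' (shift_int D (l + j - k) Y')"
    proof
      assume "is_zero_ob D X'"
      then show ?thesis using zero_ob_orth_left shift_int_Ob[OF O'(2)] by blast
    next
      assume "is_zero_ob D Y'"
      have "is_zero_ob D (shift_int D (l + j - k) Y')"
      proof (rule orth_self_zero_ob[OF shift_int_Ob[OF O'(2)]])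
        show "orth D (shift_int D (l + j - k) Y') (shift_int D (l + j - k) Y')"
          using orth_shift_int[OF O'(2,2), of "l + j - k" 0] zero_ob_orth_left[OF \<open>is_zero_ob D Y'\<close> O'(2)]
          by simp
      qed
      then show ?thesis using zero_ob_orth_right O'(1) by blast
    qed
    then show ?thesis using sh by simp
  next
    case False
    have "phi_plus (full_subcat D \<A>) PA X' = r" using A.phi_plus_P[OF X'(1)] False by simp
    moreover have "phi_minus (full_subcat D \<B>) PB Y' = s" using B.phi_minus_P[OF Y'(1)] False by simp
    ultimately have "r \<le> s" using ph[OF h] False by simp
    then have "real_of_int l < real_of_int k" using XY(3) by (simp add: r_def s_def)
    \<comment> \<open>For integers \<open>l < k\<close> means \<open>l + 1 \<le> k\<close>, which
      leaves room for the extra shift \<open>j = 1\<close>.\<close>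
    then have "l + j - k \<le> 0" using j by simp
    then show ?thesis using van[OF h] sh by simp
  qed
  show "orth D X Y" using main[of 0] Y'(2) by simp
  show "orth D X (Shift D Y)" using main[of 1] Y'(2) shift_int_succ[OF O'(2), of l] by simp
qed

theorem corollary1p12:
  fixes D :: "('o, 'm) tricat"
    and \<A> \<B> A0 B0 :: "'o set"
    and P\<^sub>A P\<^sub>B :: "real \<Rightarrow> 'o set"
    and Z\<^sub>A Z\<^sub>B :: "('o \<Rightarrow>\<^sub>0 int) set \<Rightarrow> complex"
  assumes "triangulated_category D"
    and "semiorthogonal_decomposition D \<A> \<B>"
    and "stability_condition (full_subcat D \<A>) P\<^sub>A Z\<^sub>A"
    and "A0 = heart (full_subcat D \<A>) P\<^sub>A"
    and "stability_condition (full_subcat D \<B>) P\<^sub>B Z\<^sub>B"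
    and "B0 = heart (full_subcat D \<B>) P\<^sub>B"
    and "\<And>A B (i::int). \<lbrakk>A \<in> A0; B \<in> B0; i \<le> 0\<rbrakk>
           \<Longrightarrow> homs D A (shift_int D i B) = {zero_mor D A (shift_int D i B)}"
    and "\<And>A B. \<lbrakk>A \<in> A0; B \<in> B0; \<not> is_zero_ob D A; \<not> is_zero_ob D B\<rbrakk>
           \<Longrightarrow> phi_minus (full_subcat D \<B>) P\<^sub>B B \<ge> phi_plus (full_subcat D \<A>) P\<^sub>A A"
  shows "\<exists>Z\<^sub>g\<^sub>l. is_glued_charge D \<A> \<B> Z\<^sub>A Z\<^sub>B Z\<^sub>g\<^sub>l \<and> stability_pair D (gl D A0 B0) Z\<^sub>g\<^sub>l"
proof -
  interpret S: semiorthogonal D \<A> \<B>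
    using assms(1,2) by (simp add: semiorthogonal_def semiorthogonal_axioms_def)
  have sl: "slicing (full_subcat D \<A>) P\<^sub>A" "slicing (full_subcat D \<B>) P\<^sub>B"
    using assms(3,5) by (simp_all add: stability_condition_def)
  have van: "orth D X (shift_int D i Y)"
    if "X \<in> heart (full_subcat D \<A>) P\<^sub>A" "Y \<in> heart (full_subcat D \<B>) P\<^sub>B" "i \<le> 0" for X Y i
    using assms(7)[of X Y i] that by (simp add: orth_def assms(4,6))
  have ph: "phi_plus (full_subcat D \<A>) P\<^sub>A X \<le> phi_minus (full_subcat D \<B>) P\<^sub>B Y"
    if "X \<in> heart (full_subcat D \<A>) P\<^sub>A" "Y \<in> heart (full_subcat D \<B>) P\<^sub>B"
      "\<not> is_zero_ob D X" "\<not> is_zero_ob D Y" for X Y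
    using assms(8)[of X Y] that by (simp add: assms(4,6))
  interpret G: glued_slicings D \<A> \<B> P\<^sub>A P\<^sub>B
    by unfold_locales (use sl S.cross_orthogonality[OF sl van ph] in auto)
  obtain Z where "is_glued_charge D \<A> \<B> Z\<^sub>A Z\<^sub>B Z" "stability_condition D G.PD Z"
    using G.glued_stability[OF assms(3,5)] by blast
  moreover have "heart D G.PD = gl D A0 B0" using G.heart_PD assms(4,6) by simp
  ultimately show ?thesis unfolding stability_pair_def by blast
qed

end
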